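(* Let $h=h_2\circ h_1^\star$ be a mixed tabulation hash function and let $\varepsilon>0$ be a constant. Let $X\subseteq[u]$ be any input set and associate with each $x\in X$ a function $f_x:\mathcal R\to\{0,1\}$. Let $Y=\{x\in X: f_x(h(x))=1\}$ and assume $\mathbb E[|Y|]\le|\Sigma|/(1+\varepsilon)$. Then the set of derived keys $h_1^\star(Y)\subseteq\Sigma^{c+d}$ is peelable with probability $1-O(|\Sigma|^{1-\lfloor d/2\rfloor})$.
   Context: Simple tabulation: fix an integer $c\ge1$ and an alphabet $\Sigma$ whose size is a power of two. A key $x\in[u]$ is viewed as a vector $(x_0,\dots,x_{c-1})$ of $c$ characters in $\Sigma$. A simple tabulation function $g:\Sigma^c\to\mathcal R$ ($\mathcal R=[2^r]$ bit strings, or $\Sigma^d$) is given by $c$ independent fully random tables $T_i:\Sigma\to\mathcal R$ with $g(x)=T_0[x_0]\oplus\cdots\oplus T_{c-1}[x_{c-1}]$ (bitwise XOR). Mixed tabulation: independent simple tabulation functions $h_1:\Sigma^c\to\Sigma^d$, $h_2:\Sigma^{c+d}\to\mathcal R$, derived key $h_1^\star(x)=x\cdot h_1(x)\in\Sigma^{c+d}$ (concatenation), $h(x)=h_2(h_1^\star(x))$. A position character of a key $z\in\Sigma^{c+d}$ is a pair $(i,z_i)$. A set $S\subseteq\Sigma^{c+d}$ of keys is peelable if every non-empty subset $T\subseteq S$ contains a key having a position character not shared by any other key of $T$ (this guarantees that the values $h_2(z)$, $z\in S$, are independent and uniform). Standing assumptions: $c,d=O(1)$, $u^{1/c}\le|\Sigma|\le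 u^{1/(c-1)}$; constants in $O(\cdot)$ may depend on $c,d,\varepsilon$. *)

theory Defs
  imports "HOL-Probability.Probability" "HOL-Probability.Product_PMF"
begin

text \<open>
  The alphabet \<open>\<Sigma>\<close> is represented by \<open>{..<\<sigma>}\<close>, where \<open>\<sigma>\<close> is a power of two, so that bitwise
  exclusive or on \<^typ>\<open>nat\<close> restricts to it.  Vectors of characters are lists.
\<close>

definition words :: "nat \<Rightarrow> nat \<Rightarrow> nat list set" where
  "words \<sigma> k = {z. length z = k \<and> set z \<subseteq> {..<\<sigma>}}"

text \<open>An integer key is identified with its vector of \<open>c\<close> base-\<open>\<sigma>\<close> digits, least significant first.\<close>

definition key_chars :: "nat \<Rightarrow> nat \<Rightarrow> nat \<Rightarrow> nat list" where
  "key_chars \<sigma> c x = map (\<lambda>i. x div \<sigma> ^ i mod \<sigma>) [0..<c]"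

text \<open>
  The entry \<open>T\<^sub>i[a]\<close> of the \<open>i\<close>-th table is \<open>T (i, a)\<close>.  The parameters \<open>add\<close> and \<open>neutral\<close> are
  exclusive or on the range and its neutral element.
\<close>

definition simple_tab :: "('r \<Rightarrow> 'r \<Rightarrow> 'r) \<Rightarrow> 'r \<Rightarrow> (nat \<times> nat \<Rightarrow> 'r) \<Rightarrow> nat list \<Rightarrow> 'r" where
  "simple_tab add neutral T z = foldr add (map (\<lambda>i. T (i, z ! i)) [0..<length z]) neutral"

definition random_tables :: "nat \<Rightarrow> nat \<Rightarrow> 'r set \<Rightarrow> (nat \<times> nat \<Rightarrow> 'r) pmf" where
  "random_tables \<sigma> k R = Pi_pmf ({..<k} \<times> {..<\<sigma>}) undefined (\<lambda>_. pmf_of_set R)"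

type_synonym mixed_tables = "(nat \<times> nat \<Rightarrow> nat list) \<times> (nat \<times> nat \<Rightarrow> nat)"

text \<open>Independent tables for \<open>h\<^sub>1 : \<Sigma>\<^sup>c \<Rightarrow> \<Sigma>\<^sup>d\<close> and for \<open>h\<^sub>2 : \<Sigma>\<^sup>c\<^sup>+\<^sup>d \<Rightarrow> [2\<^sup>r]\<close>.\<close>

definition mixed_pmf :: "nat \<Rightarrow> nat \<Rightarrow> nat \<Rightarrow> nat \<Rightarrow> mixed_tables pmf" where
  "mixed_pmf \<sigma> c d r =
     pair_pmf (random_tables \<sigma> c (words \<sigma> d)) (random_tables \<sigma> (c + d) {..<2 ^ r})"

definition hash1 :: "nat \<Rightarrow> mixed_tables \<Rightarrow> nat list \<Rightarrow> nat list" where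
  "hash1 d T = simple_tab (map2 xor) (replicate d 0) (fst T)"

definition hash2 :: "mixed_tables \<Rightarrow> nat list \<Rightarrow> nat" where
  "hash2 T = simple_tab xor 0 (snd T)"

definition derived_key :: "nat \<Rightarrow> nat \<Rightarrow> nat \<Rightarrow> mixed_tables \<Rightarrow> nat \<Rightarrow> nat list" where
  "derived_key \<sigma> c d T x = key_chars \<sigma> c x @ hash1 d T (key_chars \<sigma> c x)"

definition mixed_tab :: "nat \<Rightarrow> nat \<Rightarrow> nat \<Rightarrow> mixed_tables \<Rightarrow> nat \<Rightarrow> nat" where
  "mixed_tab \<sigma> c d T = hash2 T \<circ> derived_key \<sigma> c d T"

definition selected ::
    "nat \<Rightarrow> nat \<Rightarrow> nat \<Rightarrow> nat set \<Rightarrow> (nat \<Rightarrow> nat \<Rightarrow> bool) \<Rightarrow> mixed_tables \<Rightarrow> nat set" where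
  "selected \<sigma> c d X f T = {x \<in> X. f x (mixed_tab \<sigma> c d T x)}"

definition position_chars :: "nat list \<Rightarrow> (nat \<times> nat) set" where
  "position_chars z = {(i, z ! i) | i. i < length z}"

definition peelable :: "nat list set \<Rightarrow> bool" where
  "peelable S \<longleftrightarrow>
     (\<forall>T \<subseteq> S. T \<noteq> {} \<longrightarrow>
        (\<exists>z \<in> T. \<exists>\<alpha> \<in> position_chars z. \<forall>w \<in> T - {z}. \<alpha> \<notin> position_chars w))"

end

theory Submission imports Defs begin

text \<open>
  Call a set of keys blocked if every position character of every derived key in it is shared; a set
  is peelable unless it contains a blocked set, so consider a minimal blocked \<open>A\<close> among the selected
  keys.  Its proper subsets are peelable, hence the second hash function selects their keys
  independently.  Split the derived positions into \<open>\<lfloor>d/2\<rfloor>\<close> pairs.  Each pair makes \<open>A\<close> the edge set of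
  a bipartite multigraph of minimum degree 2, in which one walks from a fixed key \<open>x \<in> A\<close> until reaching a
  key all of whose input characters have been seen before.  A step to a key with a new character is paid for:
  the selection probabilities sum to at most \<open>\<sigma>/(1+\<epsilon>)\<close> and the collision has probability \<open>1/\<sigma>\<close>, so lengths
  sum geometrically.  If some collision among the keys found is linearly independent of those used, it saves
  a factor \<open>\<sigma>\<close>.  Otherwise the walk contains keys whose input characters cancel in pairs; by Cauchy--Schwarz
  four of them contribute \<open>\<sigma>\<^sup>2\<close> instead of \<open>\<sigma>\<^sup>3\<close>, which saves a factor \<open>\<sigma>\<close> again.  For quadruples through \<open>x\<close>
  this requires \<open>x\<close> to be the first key of \<open>A\<close> in a degeneracy order of the keys with respect to zero-sum
  quadruples.  With \<open>\<sigma>\<close> choices for \<open>x\<close> the total is \<open>O(\<sigma>\<^bsup>1-\<lfloor>d/2\<rfloor>\<^esup>)\<close>.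
\<close>

section \<open>Linear algebra over the two-element field\<close>

text \<open>Selections are known to be independent only on a set without a blocked subset, so the
  charged keys must always form a proper subset of the minimal blocked set. This decides which keys
  are charged: the key that ends a walk is one of polynomially many candidates and can be left
  uncharged; where it has to be charged, an undiscovered key must remain, and a first walk that
  discovers everything needs an argument of its own.

  The degeneracy order is needed because x stays fixed through all walks. Cauchy--Schwarz bounds the
  zero-sum quadruples through x only on average over x, whereas every walk may close in such a
  quadruple, so powers of their number would have to be averaged.

  The number of known keys is unbounded, and each walk costs a polynomial in it. Bounding
  \<open>k + m + 3\<close> by \<open>k * (m + 4)\<close> separates the \<open>k\<close> keys known
  before from the length \<open>m\<close> of the new walk: a geometric series with ratio
  \<open>1 / (1 + \<epsilon>)\<close> absorbs the factor in \<open>m\<close>, and the factor in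
  \<open>k\<close> is handed to the preceding walk.\<close>

definition sdiff :: "'a set \<Rightarrow> 'a set \<Rightarrow> 'a set" where
  "sdiff A B = {e. (e \<in> A) \<noteq> (e \<in> B)}"

lemma in_sdiff [simp]: "e \<in> sdiff A B \<longleftrightarrow> (e \<in> A) \<noteq> (e \<in> B)"
  by (simp add: sdiff_def)

lemma finite_sdiff [simp]: "finite A \<Longrightarrow> finite B \<Longrightarrow> finite (sdiff A B)"
  by (rule finite_subset[of _ "A \<union> B"]) auto

lemma odd_card_sdiff:
  assumes "finite A" "finite B"
  shows "odd (card (sdiff A B)) \<longleftrightarrow> odd (card A) \<noteq> odd (card B)"
proof -
  have 1: "sdiff A B = (A - B) \<union> (B - A)" by auto
  have 2: "card (sdiff A B) = card (A - B) + card (B - A)"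
    unfolding 1 using assms by (intro card_Un_disjoint) auto
  have 3: "card A = card (A - B) + card (A \<inter> B)"
    using assms by (subst card_Un_disjoint[symmetric]) (auto intro: arg_cong[where f=card])
  have 4: "card B = card (B - A) + card (A \<inter> B)"
    using assms by (subst card_Un_disjoint[symmetric]) (auto intro: arg_cong[where f=card])
  show ?thesis unfolding 2 3 4 by auto
qed

lemma odd_card_sdiff_Int:
  assumes "finite A" "finite B"
  shows "odd (card (sdiff A B \<inter> D)) \<longleftrightarrow> odd (card (A \<inter> D)) \<noteq> odd (card (B \<inter> D))"
proof -
  have "sdiff A B \<inter> D = sdiff (A \<inter> D) (B \<inter> D)" by auto
  then show ?thesis using assms by (simp add: odd_card_sdiff)
qed

lemma odd_card_Int_sdiff:
  assumes "finite A"
  shows "odd (card (A \<inter> sdiff D E)) \<longleftrightarrow> odd (card (A \<inter> D)) \<noteq> odd (card (A \<inter> E))"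
proof -
  have "A \<inter> sdiff D E = sdiff (A \<inter> D) (A \<inter> E)" by auto
  then show ?thesis using assms by (simp add: odd_card_sdiff)
qed

text \<open>Finite sets stand for vectors over the two-element field, with \<open>sdiff\<close> as
  addition. Families are lists with the newest vector first: \<open>gf2_indep\<close> asks each
  vector to avoid the span of its tail, which is how independence arises during an
  exploration.\<close>

fun gf2_span :: "'a set list \<Rightarrow> 'a set set" where
  "gf2_span [] = {{}}"
| "gf2_span (B # Bs) = gf2_span Bs \<union> sdiff B ` gf2_span Bs"

fun gf2_indep :: "'a set list \<Rightarrow> bool" where
  "gf2_indep [] \<longleftrightarrow> True"
| "gf2_indep (B # Bs) \<longleftrightarrow> B \<notin> gf2_span Bs \<and> gf2_indep Bs"

lemma empty_in_gf2_span [simp]: "{} \<in> gf2_span Bs"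
  by (induction Bs) auto

lemma gf2_span_subset: "A \<in> gf2_span Bs \<Longrightarrow> A \<subseteq> \<Union> (set Bs)"
proof (induction Bs arbitrary: A)
  case (Cons B Bs)
  then show ?case by (auto dest!: Cons.IH)
qed simp

lemma finite_gf2_span: "A \<in> gf2_span Bs \<Longrightarrow> \<forall>B\<in>set Bs. finite B \<Longrightarrow> finite A"
  by (rule finite_subset[OF gf2_span_subset]) auto

lemma gf2_span_append:
  "A \<in> gf2_span (Bs @ Cs) \<Longrightarrow> \<exists>B\<in>gf2_span Bs. \<exists>C\<in>gf2_span Cs. A = sdiff B C"
proof (induction Bs arbitrary: A)
  case Nil
  then show ?case by (auto simp: sdiff_def)
next
  case (Cons B Bs)
  have split: "\<exists>B'\<in>gf2_span Bs. \<exists>C\<in>gf2_span Cs. A' = sdiff B' C"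
    if "A' \<in> gf2_span (Bs @ Cs)" for A' using Cons.IH that by blast
  from Cons.prems consider "A \<in> gf2_span (Bs @ Cs)"
    | A' where "A' \<in> gf2_span (Bs @ Cs)" "A = sdiff B A'" by auto
  then show ?case
  proof cases
    case 1
    then show ?thesis using split by fastforce
  next
    case 2
    then obtain B' C where "B' \<in> gf2_span Bs" "C \<in> gf2_span Cs" "A' = sdiff B' C" using split by blast
    moreover have "sdiff B (sdiff B' C) = sdiff (sdiff B B') C" by auto
    ultimately show ?thesis using 2(2) by auto
  qed
qed

text \<open>\<open>L\<close> is the set of indices with coefficient 1. Indices are used instead of
  vectors because \<open>g\<close> may take the same value at distinct indices.\<close>

lemma gf2_span_parity:
  assumes "A \<in> gf2_span (map g xs)" "distinct xs"
  shows "\<exists>L\<subseteq>set xs. \<forall>e. e \<in> A \<longleftrightarrow> odd (card {l \<in> L. e \<in> g l})"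
  using assms
proof (induction xs arbitrary: A)
  case Nil
  then show ?case by auto
next
  case (Cons x xs)
  have dist: "distinct xs" using Cons.prems(2) by simp
  from Cons.prems(1) consider "A \<in> gf2_span (map g xs)"
    | A' where "A' \<in> gf2_span (map g xs)" "A = sdiff (g x) A'" by auto
  then show ?case
  proof cases
    case 1
    from Cons.IH[OF 1 dist] obtain L where L: "L \<subseteq> set xs" "\<forall>e. e \<in> A \<longleftrightarrow> odd (card {l \<in> L. e \<in> g l})"
      by blast
    have "L \<subseteq> set (x # xs)" using L(1) by auto
    with L(2) show ?thesis by blast
  next
    case 2
    from Cons.IH[OF 2(1) dist] obtain L
      where L: "L \<subseteq> set xs" "\<forall>e. e \<in> A' \<longleftrightarrow> odd (card {l \<in> L. e \<in> g l})"
      by blast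
    have fin: "finite L" using L(1) finite_subset by blast
    have x: "x \<notin> L" using L(1) Cons.prems(2) by auto
    have "e \<in> A \<longleftrightarrow> odd (card {l \<in> insert x L. e \<in> g l})" for e
    proof -
      have "{l \<in> insert x L. e \<in> g l} = (if e \<in> g x then insert x {l \<in> L. e \<in> g l} else {l \<in> L. e \<in> g l})"
        by auto
      then have "odd (card {l \<in> insert x L. e \<in> g l}) \<longleftrightarrow> (e \<in> g x) \<noteq> odd (card {l \<in> L. e \<in> g l})"
        using fin x by simp
      then show ?thesis using L(2) 2(2) by (metis in_sdiff)
    qed
    moreover have "insert x L \<subseteq> set (x # xs)" using L(1) by auto
    ultimately show ?thesis by blast
  qed
qed

lemma gf2_span_even:
  assumes "A \<in> gf2_span Bs" "\<forall>B\<in>set Bs. finite B" "\<forall>B\<in>set Bs. even (card (B \<inter> D))"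
  shows "even (card (A \<inter> D))"
  using assms
proof (induction Bs arbitrary: A)
  case (Cons B Bs)
  have fin: "finite A'" if "A' \<in> gf2_span Bs" for A'
    using finite_gf2_span[OF that] Cons.prems by auto
  have ev: "even (card (A' \<inter> D))" if "A' \<in> gf2_span Bs" for A'
    using Cons.IH[OF that] Cons.prems by auto
  have "even (card (sdiff B A' \<inter> D))" if "A' \<in> gf2_span Bs" for A'
    using odd_card_sdiff_Int[of B A' D] fin[OF that] ev[OF that] Cons.prems by simp
  then show ?case using Cons.prems(1) ev by auto
qed auto

text \<open>A vector outside a subspace is separated from it by a linear functional, here the parity
  of the intersection with \<open>D\<close>. In the induction \<open>D1\<close> separates
  \<open>A\<close>, and \<open>D2\<close> separates \<open>sdiff B A\<close>, from the span of the
  tail; one of \<open>D1\<close>, \<open>D2\<close> and their sum then vanishes on \<open>B\<close>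
  but not on \<open>A\<close>.\<close>

lemma gf2_dual:
  assumes "finite A" "\<forall>B\<in>set Bs. finite B" "A \<notin> gf2_span Bs"
  shows "\<exists>D. odd (card (A \<inter> D)) \<and> (\<forall>B\<in>set Bs. even (card (B \<inter> D)))"
  using assms
proof (induction Bs arbitrary: A)
  case Nil
  then obtain a where "a \<in> A" by auto
  then show ?case by (intro exI[of _ "{a}"]) auto
next
  case (Cons B Bs)
  have fin: "finite B" using Cons.prems by auto
  have finBs: "\<forall>C\<in>set Bs. finite C" using Cons.prems(2) by simp
  have "A \<notin> gf2_span Bs" using Cons.prems(3) by simp
  from Cons.IH[OF Cons.prems(1) finBs this]
  obtain D1 where D1: "odd (card (A \<inter> D1))" "\<forall>C\<in>set Bs. even (card (C \<inter> D1))" by blast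
  have "sdiff B (sdiff B A) = A" by auto
  then have "sdiff B A \<notin> gf2_span Bs"
    using Cons.prems(3) by (metis UnCI gf2_span.simps(2) imageI)
  from Cons.IH[OF finite_sdiff[OF fin Cons.prems(1)] finBs this]
  obtain D2 where D2: "odd (card (sdiff B A \<inter> D2))" "\<forall>C\<in>set Bs. even (card (C \<inter> D2))" by blast
  have D2': "odd (card (B \<inter> D2)) \<noteq> odd (card (A \<inter> D2))"
    using D2(1) fin Cons.prems(1) by (simp add: odd_card_sdiff_Int)
  consider "even (card (B \<inter> D1))" | "even (card (B \<inter> D2))"
    | "odd (card (B \<inter> D1))" "odd (card (B \<inter> D2))" by auto
  then show ?case
  proof cases
    case 1
    then have "\<forall>C\<in>set (B # Bs). even (card (C \<inter> D1))" using D1 by simp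
    then show ?thesis using D1(1) by blast
  next
    case 2
    then have "\<forall>C\<in>set (B # Bs). even (card (C \<inter> D2))" "odd (card (A \<inter> D2))" using D2 D2' by simp_all
    then show ?thesis by blast
  next
    case 3
    have "\<forall>C\<in>set (B # Bs). even (card (C \<inter> sdiff D1 D2))"
    proof
      fix C assume C: "C \<in> set (B # Bs)"
      then have "finite C" using Cons.prems by blast
      then show "even (card (C \<inter> sdiff D1 D2))"
        using odd_card_Int_sdiff[of C D1 D2] 3 D1 D2 C by auto
    qed
    moreover have "odd (card (A \<inter> sdiff D1 D2))"
      using odd_card_Int_sdiff[OF Cons.prems(1), of D1 D2] D1(1) D2' 3 by blast
    ultimately show ?thesis by blast
  qed
qed

section \<open>Exclusive or and simple tabulation\<close>

lemma xor_less_two_power: "a < 2 ^ k \<Longrightarrow> b < 2 ^ k \<Longrightarrow> xor a b < (2 ^ k :: nat)"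
proof -
  assume "a < 2 ^ k" "b < 2 ^ k"
  then have "take_bit k a = a" "take_bit k b = b" by (simp_all add: take_bit_nat_eq_self_iff)
  then have "take_bit k (xor a b) = xor a b" by simp
  then show ?thesis using take_bit_nat_eq_self_iff by blast
qed

lemma xor_cancel: "xor (xor a b) b = (a :: nat)" "xor a (xor a b) = (b :: nat)"
proof -
  show "xor (xor a b) b = a" by (simp add: xor.assoc)
  show "xor a (xor a b) = b" by (simp flip: xor.assoc)
qed

lemma finite_words [simp]: "finite (words \<sigma> k)"
  unfolding words_def using finite_lists_length_eq[of "{..<\<sigma>}" k] by (simp add: conj_commute)

lemma length_words: "z \<in> words \<sigma> k \<Longrightarrow> length z = k"
  by (simp add: words_def)

lemma nth_words: "z \<in> words \<sigma> k \<Longrightarrow> i < k \<Longrightarrow> z ! i < \<sigma>"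
  unfolding words_def by (auto simp: subset_iff)

lemma words_nthI: "length z = k \<Longrightarrow> (\<And>i. i < k \<Longrightarrow> z ! i < \<sigma>) \<Longrightarrow> z \<in> words \<sigma> k"
  by (auto simp: words_def in_set_conv_nth)

lemma finite_position_chars [simp]: "finite (position_chars z)"
proof -
  have "position_chars z = (\<lambda>i. (i, z ! i)) ` {..<length z}"
    by (auto simp: position_chars_def)
  then show ?thesis by simp
qed

lemma in_position_chars [simp]: "(i, a) \<in> position_chars z \<longleftrightarrow> i < length z \<and> a = z ! i"
  by (auto simp: position_chars_def)

lemma position_chars_inj:
  assumes "length z = length w" "position_chars z = position_chars w"
  shows "z = w"
proof (rule nth_equalityI)
  fix i assume "i < length z"
  then have "(i, z ! i) \<in> position_chars w" using assms(2) in_position_chars by metis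
  then show "z ! i = w ! i" by simp
qed (use assms in auto)

lemma foldr_xor_shift:
  fixes a :: "'i \<Rightarrow> nat"
  assumes "distinct is"
  shows "foldr xor (map (\<lambda>i. xor (a i) (if P i then w else 0)) is) 0 =
    xor (foldr xor (map a is) 0) (if odd (card {i \<in> set is. P i}) then w else 0)"
  using assms
proof (induction "is")
  case (Cons j js)
  have "{i \<in> set (j # js). P i} = (if P j then insert j {i \<in> set js. P i} else {i \<in> set js. P i})"
    by auto
  then have "odd (card {i \<in> set (j # js). P i}) \<longleftrightarrow> P j \<noteq> odd (card {i \<in> set js. P i})"
    using Cons.prems by auto
  then show ?case using Cons by (simp add: xor.assoc xor.commute xor.left_commute)
qed simp

text \<open>A key reads one entry per position, and each entry read from \<open>D\<close>
  contributes a \<open>w\<close>; pairs of them cancel. For the first hash function \<open>D\<close>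
  comes from a dual vector, for the second it is a single entry.\<close>

lemma simple_tab_shift:
  fixes T :: "nat \<times> nat \<Rightarrow> nat"
  assumes "\<And>\<alpha>. \<alpha> \<in> position_chars z \<Longrightarrow> T' \<alpha> = xor (T \<alpha>) (if \<alpha> \<in> D then w else 0)"
  shows "simple_tab xor 0 T' z =
    xor (simple_tab xor 0 T z) (if odd (card (position_chars z \<inter> D)) then w else 0)"
proof -
  have "position_chars z \<inter> D = (\<lambda>i. (i, z ! i)) ` {i \<in> set [0..<length z]. (i, z ! i) \<in> D}"
    by (auto simp: position_chars_def)
  then have card: "card (position_chars z \<inter> D) = card {i \<in> set [0..<length z]. (i, z ! i) \<in> D}"
    by (simp add: card_image inj_on_def)
  have "T' (i, z ! i) = xor (T (i, z ! i)) (if (i, z ! i) \<in> D then w else 0)" if "i < length z" for i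
    using that by (intro assms) simp
  then have "map (\<lambda>i. T' (i, z ! i)) [0..<length z] =
      map (\<lambda>i. xor (T (i, z ! i)) (if (i, z ! i) \<in> D then w else 0)) [0..<length z]"
    by (intro map_cong) auto
  then show ?thesis unfolding simple_tab_def card
    by (simp only: foldr_xor_shift[OF distinct_upt])
qed

lemma foldr_map2_xor:
  fixes L :: "'i \<Rightarrow> nat list"
  assumes "\<And>i. i \<in> set is \<Longrightarrow> length (L i) = d"
  shows "length (foldr (map2 xor) (map L is) (replicate d 0)) = d \<and>
    (\<forall>t<d. foldr (map2 xor) (map L is) (replicate d 0) ! t = foldr xor (map (\<lambda>i. L i ! t) is) 0)"
  using assms
proof (induction "is")
  case (Cons j js)
  then have "length (L j) = d"
    "length (foldr (map2 xor) (map L js) (replicate d 0)) = d \<and>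
    (\<forall>t<d. foldr (map2 xor) (map L js) (replicate d 0) ! t = foldr xor (map (\<lambda>i. L i ! t) js) 0)"
    by simp_all
  then show ?case by simp
qed simp

lemma foldr_xor_less:
  "(\<And>i. i \<in> set is \<Longrightarrow> a i < (2::nat) ^ k) \<Longrightarrow> foldr xor (map a is) 0 < 2 ^ k"
  by (induction "is") (auto intro: xor_less_two_power)

lemma simple_tab_less:
  assumes "\<And>\<alpha>. \<alpha> \<in> position_chars z \<Longrightarrow> T \<alpha> < (2::nat) ^ k"
  shows "simple_tab xor 0 T z < 2 ^ k"
  unfolding simple_tab_def by (rule foldr_xor_less) (auto intro!: assms)

section \<open>Counting tables\<close>

lemma pair_pmf_of_set:
  assumes "finite A" "A \<noteq> {}" "finite B" "B \<noteq> {}"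
  shows "pair_pmf (pmf_of_set A) (pmf_of_set B) = pmf_of_set (A \<times> B)"
proof (rule pmf_eqI)
  fix x :: "'a \<times> 'b"
  obtain a b where x: "x = (a, b)" by fastforce
  have ne: "A \<times> B \<noteq> {}" using assms by blast
  have "pmf (pmf_of_set (A \<times> B)) (a, b) = indicator (A \<times> B) (a, b) / (real (card A) * real (card B))"
    using assms ne by (simp add: pmf_of_set card_cartesian_product)
  moreover have "pmf (pair_pmf (pmf_of_set A) (pmf_of_set B)) (a, b) =
      (indicator A a / real (card A)) * (indicator B b / real (card B))"
    unfolding pmf_pair using assms by (simp add: pmf_of_set)
  moreover have "indicator (A \<times> B) (a, b) = (indicator A a * indicator B b :: real)"
    by (simp add: indicator_def)
  ultimately show "pmf (pair_pmf (pmf_of_set A) (pmf_of_set B)) x = pmf (pmf_of_set (A \<times> B)) x"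
    unfolding x by simp
qed

text \<open>Exclusive or on vectors acts coordinatewise, so every derived character is a simple
  tabulation value of its own, and collisions in different derived positions concern disjoint sets
  of table characters.\<close>

definition h1_char :: "(nat \<times> nat \<Rightarrow> nat list) \<Rightarrow> nat \<Rightarrow> nat list \<Rightarrow> nat" where
  "h1_char T t z = simple_tab xor 0 (\<lambda>\<alpha>. T \<alpha> ! t) z"

text \<open>A triple \<open>(t, u, v)\<close> stands for the collision of \<open>u\<close> and \<open>v\<close> in the derived position \<open>t\<close>.  It says that
  the table characters indexed by \<open>constraint_set (t, u, v)\<close> have exclusive or \<open>0\<close>.\<close>

definition constraint_set :: "nat \<times> nat list \<times> nat list \<Rightarrow> (nat \<times> nat \<times> nat) set" where
  "constraint_set = (\<lambda>(t, u, v). Pair t ` sdiff (position_chars u) (position_chars v))"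

definition satisfies :: "(nat \<times> nat list \<times> nat list) list \<Rightarrow> (nat \<times> nat \<Rightarrow> nat list) \<Rightarrow> bool" where
  "satisfies cs T \<longleftrightarrow> (\<forall>(t, u, v) \<in> set cs. h1_char T t u = h1_char T t v)"

lemma in_constraint_set [simp]:
  "(t', \<alpha>) \<in> constraint_set (t, u, v) \<longleftrightarrow>
    t' = t \<and> (\<alpha> \<in> position_chars u) \<noteq> (\<alpha> \<in> position_chars v)"
  by (auto simp: constraint_set_def)

lemma finite_constraint_set [simp]: "finite (constraint_set x)"
  by (cases x) (simp add: constraint_set_def)

lemma odd_card_constraint_set:
  "odd (card (constraint_set (t, u, v) \<inter> D)) \<longleftrightarrow>
    odd (card (position_chars u \<inter> {\<alpha>. (t, \<alpha>) \<in> D})) \<noteq> odd (card (position_chars v \<inter> {\<alpha>. (t, \<alpha>) \<in> D}))"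
proof -
  have "constraint_set (t, u, v) \<inter> D =
      Pair t ` (sdiff (position_chars u) (position_chars v) \<inter> {\<alpha>. (t, \<alpha>) \<in> D})"
    by (auto simp: constraint_set_def)
  then have "card (constraint_set (t, u, v) \<inter> D) =
      card (sdiff (position_chars u) (position_chars v) \<inter> {\<alpha>. (t, \<alpha>) \<in> D})"
    by (simp add: card_image inj_on_def)
  then show ?thesis by (simp add: odd_card_sdiff_Int)
qed

lemma satisfies_Nil [simp]: "satisfies [] T"
  by (simp add: satisfies_def)

lemma satisfies_Cons:
  "satisfies ((t, u, v) # cs) T \<longleftrightarrow> h1_char T t u = h1_char T t v \<and> satisfies cs T"
  by (simp add: satisfies_def)

lemma satisfies_append: "satisfies (cs @ cs') T \<longleftrightarrow> satisfies cs T \<and> satisfies cs' T"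
  by (simp add: satisfies_def ball_Un)

lemma satisfies_rev: "satisfies (rev cs) T \<longleftrightarrow> satisfies cs T"
  by (simp add: satisfies_def)

text \<open>Fixing the value outside the domain makes the sample space a finite set, so that
  probabilities become quotients of cardinalities.\<close>

definition tables :: "nat \<Rightarrow> nat \<Rightarrow> 'r set \<Rightarrow> (nat \<times> nat \<Rightarrow> 'r) set" where
  "tables \<sigma> k R = PiE_dflt ({..<k} \<times> {..<\<sigma>}) undefined (\<lambda>_. R)"

lemma finite_tables [simp]: "finite R \<Longrightarrow> finite (tables \<sigma> k R)"
  unfolding tables_def by (intro finite_PiE_dflt) auto

lemma tables_nonempty: "R \<noteq> {} \<Longrightarrow> tables \<sigma> k R \<noteq> {}"
  unfolding tables_def by auto

lemma random_tables_eq: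
  assumes "finite R" "R \<noteq> {}"
  shows "random_tables \<sigma> k R = pmf_of_set (tables \<sigma> k R)"
  unfolding random_tables_def tables_def using assms by (intro Pi_pmf_of_set) auto

lemma tables_app: "T \<in> tables \<sigma> k R \<Longrightarrow> \<alpha> \<in> {..<k} \<times> {..<\<sigma>} \<Longrightarrow> T \<alpha> \<in> R"
  unfolding tables_def PiE_dflt_def by blast

lemma tables_outside: "T \<in> tables \<sigma> k R \<Longrightarrow> \<alpha> \<notin> {..<k} \<times> {..<\<sigma>} \<Longrightarrow> T \<alpha> = undefined"
  unfolding tables_def PiE_dflt_def by blast

lemma tablesI:
  assumes "\<And>\<alpha>. \<alpha> \<in> {..<k} \<times> {..<\<sigma>} \<Longrightarrow> T \<alpha> \<in> R" "\<And>\<alpha>. \<alpha> \<notin> {..<k} \<times> {..<\<sigma>} \<Longrightarrow> T \<alpha> = undefined"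
  shows "T \<in> tables \<sigma> k R"
  unfolding tables_def PiE_dflt_def using assms by blast

lemma position_chars_words: "z \<in> words \<sigma> k \<Longrightarrow> position_chars z \<subseteq> {..<k} \<times> {..<\<sigma>}"
  by (auto simp: position_chars_def length_words nth_words)

lemma words_nonempty: "\<sigma> > 0 \<Longrightarrow> words \<sigma> k \<noteq> {}"
proof -
  assume "\<sigma> > 0"
  then have "replicate k 0 \<in> words \<sigma> k" by (auto simp: words_def)
  then show ?thesis by blast
qed

definition shift1 :: "nat \<Rightarrow> nat \<Rightarrow> nat \<Rightarrow> nat \<Rightarrow> (nat \<times> nat \<times> nat) set
    \<Rightarrow> (nat \<times> nat \<Rightarrow> nat list) \<Rightarrow> nat \<times> nat \<Rightarrow> nat list" where
  "shift1 \<sigma> c d w D T = (\<lambda>\<alpha>. if \<alpha> \<in> {..<c} \<times> {..<\<sigma>}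
     then map (\<lambda>t. xor (T \<alpha> ! t) (if (t, \<alpha>) \<in> D then w else 0)) [0..<d] else undefined)"

lemma shift1_in_tables:
  assumes "\<sigma> = 2 ^ s" "T \<in> tables \<sigma> c (words \<sigma> d)" "w < \<sigma>"
  shows "shift1 \<sigma> c d w D T \<in> tables \<sigma> c (words \<sigma> d)"
proof (rule tablesI)
  fix \<alpha> assume a: "\<alpha> \<in> {..<c} \<times> {..<\<sigma>}"
  have "T \<alpha> \<in> words \<sigma> d" using tables_app[OF assms(2) a] .
  then show "shift1 \<sigma> c d w D T \<alpha> \<in> words \<sigma> d"
    using a assms by (auto intro!: words_nthI simp: shift1_def nth_words xor_less_two_power)
qed (auto simp: shift1_def)

lemma shift1_shift1:
  assumes "T \<in> tables \<sigma> c (words \<sigma> d)"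
  shows "shift1 \<sigma> c d w D (shift1 \<sigma> c d w D T) = T"
proof
  fix \<alpha>
  show "shift1 \<sigma> c d w D (shift1 \<sigma> c d w D T) \<alpha> = T \<alpha>"
  proof (cases "\<alpha> \<in> {..<c} \<times> {..<\<sigma>}")
    case True
    have "length (T \<alpha>) = d" using tables_app[OF assms True] by (rule length_words)
    then show ?thesis using True
      by (auto intro!: nth_equalityI simp: shift1_def xor_cancel)
  next
    case False
    then show ?thesis using tables_outside[OF assms False] by (simp add: shift1_def)
  qed
qed

lemma h1_char_shift1:
  assumes "z \<in> words \<sigma> c" "t < d"
  shows "h1_char (shift1 \<sigma> c d w D T) t z =
    xor (h1_char T t z) (if odd (card (position_chars z \<inter> {\<alpha>. (t, \<alpha>) \<in> D})) then w else 0)"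
  unfolding h1_char_def
proof (rule simple_tab_shift)
  fix \<alpha> assume "\<alpha> \<in> position_chars z"
  then have "\<alpha> \<in> {..<c} \<times> {..<\<sigma>}" using position_chars_words[OF assms(1)] by blast
  then show "shift1 \<sigma> c d w D T \<alpha> ! t = xor (T \<alpha> ! t) (if \<alpha> \<in> {\<alpha>. (t, \<alpha>) \<in> D} then w else 0)"
    using assms by (simp add: shift1_def)
qed

text \<open>Shifting the tables on a set dual to the newest collision destroys this collision in a controlled way and
  preserves the others, so the solutions have \<open>\<sigma>\<close> disjoint translates among the solutions of the others.\<close>

lemma card_satisfies:
  assumes \<sigma>: "\<sigma> = 2 ^ s"
    and "gf2_indep (map constraint_set cs)"
    and "\<forall>(t, u, v) \<in> set cs. t < d \<and> u \<in> words \<sigma> c \<and> v \<in> words \<sigma> c"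
  shows "card {T \<in> tables \<sigma> c (words \<sigma> d). satisfies cs T} * \<sigma> ^ length cs
    \<le> card (tables \<sigma> c (words \<sigma> d))"
  using assms(2,3)
proof (induction cs)
  case Nil
  then show ?case by simp
next
  case (Cons x cs)
  obtain t u v where x: "x = (t, u, v)" by (cases x)
  let ?\<Omega> = "tables \<sigma> c (words \<sigma> d)"
  have tuv: "t < d" "u \<in> words \<sigma> c" "v \<in> words \<sigma> c" using Cons.prems(2) x by auto
  have cs: "\<forall>(t, u, v) \<in> set cs. t < d \<and> u \<in> words \<sigma> c \<and> v \<in> words \<sigma> c"
    using Cons.prems(2) by simp
  have "constraint_set x \<notin> gf2_span (map constraint_set cs)" using Cons.prems(1) by simp
  moreover have "\<forall>B\<in>set (map constraint_set cs). finite B" by simp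
  ultimately obtain D where D: "odd (card (constraint_set (t, u, v) \<inter> D))"
    and "\<forall>B\<in>set (map constraint_set cs). even (card (B \<inter> D))"
    using gf2_dual[of "constraint_set x" "map constraint_set cs"] x by auto
  then have Dcs: "even (card (constraint_set y \<inter> D))" if "y \<in> set cs" for y using that by simp
  let ?sh = "\<lambda>(w, T). shift1 \<sigma> c d w D T"
  let ?A = "{T \<in> ?\<Omega>. satisfies (x # cs) T}" and ?B = "{T \<in> ?\<Omega>. satisfies cs T}"
  \<comment> \<open>The newest collision meets \<open>D\<close> in an odd number of table
    characters, so after the shift its two sides differ by exactly \<open>w\<close>. Hence
    \<open>w\<close>, and then \<open>T\<close>, can be read off the shifted table.\<close>
  have shifted: "xor (h1_char (shift1 \<sigma> c d w D T) t u) (h1_char (shift1 \<sigma> c d w D T) t v) = w"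
    if "T \<in> ?A" for w T
  proof -
    have eq: "h1_char T t u = h1_char T t v" using that x by (simp add: satisfies_Cons)
    show ?thesis using D
      unfolding h1_char_shift1[OF tuv(2,1)] h1_char_shift1[OF tuv(3,1)] odd_card_constraint_set eq
      by (auto simp: xor_cancel xor.assoc xor.left_commute)
  qed
  have "card ({..<\<sigma>} \<times> ?A) \<le> card ?B"
  proof (rule card_inj_on_le[of ?sh])
    show "inj_on ?sh ({..<\<sigma>} \<times> ?A)"
    proof (rule inj_onI, clarify)
      fix w T w' T'
      assume T: "T \<in> ?\<Omega>" "satisfies (x # cs) T" and T': "T' \<in> ?\<Omega>" "satisfies (x # cs) T'"
        and eq: "shift1 \<sigma> c d w D T = shift1 \<sigma> c d w' D T'"
      have "w = w'" using shifted[of T w] shifted[of T' w'] T T' eq by simp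
      moreover have "T = T'" using shift1_shift1[OF T(1)] shift1_shift1[OF T'(1)] eq \<open>w = w'\<close> by metis
      ultimately show "w = w' \<and> T = T'" by simp
    qed
    show "?sh ` ({..<\<sigma>} \<times> ?A) \<subseteq> ?B"
    proof clarify
      fix w T assume w: "w < \<sigma>" and T: "T \<in> ?\<Omega>" "satisfies (x # cs) T"
      have "satisfies cs (shift1 \<sigma> c d w D T)"
        unfolding satisfies_def
      proof clarify
        fix t' u' v' assume m: "(t', u', v') \<in> set cs"
        then have b: "t' < d" "u' \<in> words \<sigma> c" "v' \<in> words \<sigma> c" using cs by auto
        have "h1_char T t' u' = h1_char T t' v'" using T(2) m by (auto simp: satisfies_def)
        then show "h1_char (shift1 \<sigma> c d w D T) t' u' = h1_char (shift1 \<sigma> c d w D T) t' v'"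
          using Dcs[OF m] odd_card_constraint_set[of t' u' v' D]
          unfolding h1_char_shift1[OF b(2,1)] h1_char_shift1[OF b(3,1)] by auto
      qed
      then show "shift1 \<sigma> c d w D T \<in> ?\<Omega> \<and> satisfies cs (shift1 \<sigma> c d w D T)"
        using shift1_in_tables[OF \<sigma> T(1) w] by simp
    qed
  qed simp
  then have "\<sigma> * card ?A \<le> card ?B" by (simp add: card_cartesian_product)
  then have "card ?A * \<sigma> ^ length (x # cs) \<le> card ?B * \<sigma> ^ length cs"
    using mult_right_mono[of "\<sigma> * card ?A" "card ?B" "\<sigma> ^ length cs"] by (simp add: algebra_simps)
  also have "\<dots> \<le> card ?\<Omega>" using Cons.IH Cons.prems(1) cs by simp
  finally show ?case .
qed

section \<open>Peeling for the second hash function\<close>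

definition shift2 :: "nat \<times> nat \<Rightarrow> nat \<Rightarrow> (nat \<times> nat \<Rightarrow> nat) \<Rightarrow> nat \<times> nat \<Rightarrow> nat" where
  "shift2 \<alpha> w T = T(\<alpha> := xor (T \<alpha>) w)"

lemma simple_tab_shift2:
  "simple_tab xor 0 (shift2 \<alpha> w T) z =
    (if \<alpha> \<in> position_chars z then xor (simple_tab xor 0 T z) w else simple_tab xor 0 T z)"
proof -
  have "simple_tab xor 0 (shift2 \<alpha> w T) z =
      xor (simple_tab xor 0 T z) (if odd (card (position_chars z \<inter> {\<alpha>})) then w else 0)"
    by (rule simple_tab_shift) (auto simp: shift2_def)
  then show ?thesis by auto
qed

lemma shift2_in_tables:
  assumes "T \<in> tables \<sigma> k {..<2 ^ r}" "\<alpha> \<in> {..<k} \<times> {..<\<sigma>}" "w < 2 ^ r"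
  shows "shift2 \<alpha> w T \<in> tables \<sigma> k {..<2 ^ r}"
proof (rule tablesI)
  fix \<beta> assume "\<beta> \<in> {..<k} \<times> {..<\<sigma>}"
  from tables_app[OF assms(1) this] tables_app[OF assms(1,2)]
  show "shift2 \<alpha> w T \<beta> \<in> {..<2 ^ r}" using assms(3) by (auto simp: shift2_def xor_less_two_power)
next
  fix \<beta> assume "\<beta> \<notin> {..<k} \<times> {..<\<sigma>}"
  with tables_outside[OF assms(1) this] assms(2) show "shift2 \<alpha> w T \<beta> = undefined"
    by (auto simp: shift2_def)
qed

definition all_shared :: "nat \<Rightarrow> nat list set \<Rightarrow> bool" where
  "all_shared k A \<longleftrightarrow> (\<forall>z\<in>A. \<forall>i<k. \<exists>w\<in>A. w \<noteq> z \<and> w ! i = z ! i)"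

text \<open>The peeling argument: an unshared table entry randomizes the hash value of its key.\<close>

lemma card_tables_unshared:
  fixes G :: "nat list \<Rightarrow> nat \<Rightarrow> bool"
  assumes "finite K" "K \<subseteq> words \<sigma> k" "\<And>A. A \<subseteq> K \<Longrightarrow> A \<noteq> {} \<Longrightarrow> \<not> all_shared k A"
  shows "real (card {T \<in> tables \<sigma> k {..<2 ^ r}. \<forall>z\<in>K. G z (simple_tab xor 0 T z)}) =
    real (card (tables \<sigma> k {..<2 ^ r :: nat})) * (\<Prod>z\<in>K. real (card {v. v < 2 ^ r \<and> G z v}) / 2 ^ r)"
  using assms
proof (induction "card K" arbitrary: K)
  case 0
  then show ?case by simp
next
  case (Suc n)
  let ?\<Omega> = "tables \<sigma> k {..<2 ^ r :: nat}"
  have "K \<noteq> {}" using Suc.hyps(2) by auto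
  then have "\<not> all_shared k K" using Suc.prems(3) by blast
  then obtain z i where z: "z \<in> K" "i < k" "\<And>w. w \<in> K \<Longrightarrow> w \<noteq> z \<Longrightarrow> w ! i \<noteq> z ! i"
    unfolding all_shared_def by blast
  define \<alpha> where "\<alpha> = (i, z ! i)"
  have zw: "z \<in> words \<sigma> k" using z Suc.prems by blast
  have \<alpha>in: "\<alpha> \<in> position_chars z" using z(2) zw by (simp add: \<alpha>_def length_words)
  have \<alpha>\<Omega>: "\<alpha> \<in> {..<k} \<times> {..<\<sigma>}" using \<alpha>in position_chars_words[OF zw] by blast
  have \<alpha>out: "\<alpha> \<notin> position_chars w" if "w \<in> K - {z}" for w
    using z(3)[of w] that by (auto simp: \<alpha>_def)
  let ?h = "\<lambda>T z. simple_tab xor 0 T z :: nat"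
  let ?E = "{T \<in> ?\<Omega>. \<forall>z\<in>K - {z}. G z (?h T z)}"
  let ?F = "{T \<in> ?\<Omega>. \<forall>z\<in>K. G z (?h T z)}"
  have hless: "?h T z < 2 ^ r" if "T \<in> ?\<Omega>" for T
  proof (rule simple_tab_less)
    fix \<beta> assume "\<beta> \<in> position_chars z"
    then have "\<beta> \<in> {..<k} \<times> {..<\<sigma>}" using position_chars_words[OF zw] by blast
    then show "T \<beta> < 2 ^ r" using tables_app[OF that] by blast
  qed
  have shift_shift: "shift2 \<alpha> w (shift2 \<alpha> w T) = T" for w T
    by (simp add: shift2_def xor_cancel)
  have h_shift: "?h (shift2 \<alpha> w T) z = xor (?h T z) w" for w T
    using \<alpha>in by (simp add: simple_tab_shift2)
  have other: "?h (shift2 \<alpha> w T) y = ?h T y" if "y \<in> K - {z}" for w T y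
    using \<alpha>out[OF that] by (simp add: simple_tab_shift2)
  \<comment> \<open>Only \<open>z\<close> reads the entry \<alpha> among the keys of
    \<open>K\<close>. Shifting it exchanges the shift \<open>w\<close> for the hash value of
    \<open>z\<close>: every value \<open>v\<close> is reached from every table, and the other keys
    of \<open>K\<close> keep their hash values.\<close>
  have "bij_betw (\<lambda>(w, T). (?h T z, shift2 \<alpha> w T)) ({..<2 ^ r} \<times> ?F) ({v. v < 2 ^ r \<and> G z v} \<times> ?E)"
  proof (rule bij_betwI[where g = "\<lambda>(v, T). (xor (?h T z) v, shift2 \<alpha> (xor (?h T z) v) T)"])
    show "(\<lambda>(w, T). (?h T z, shift2 \<alpha> w T)) \<in> {..<2 ^ r} \<times> ?F \<rightarrow> {v. v < 2 ^ r \<and> G z v} \<times> ?E"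
    proof (rule Pi_I)
      fix q assume "q \<in> {..<2 ^ r :: nat} \<times> ?F"
      then obtain w T where q: "q = (w, T)" and w: "w < 2 ^ r" and T: "T \<in> ?\<Omega>" "\<forall>y\<in>K. G y (?h T y)"
        by blast
      show "(\<lambda>(w, T). (?h T z, shift2 \<alpha> w T)) q \<in> {v. v < 2 ^ r \<and> G z v} \<times> ?E" unfolding q
        using z(1) T(2) hless[OF T(1)] shift2_in_tables[OF T(1) \<alpha>\<Omega> w] by (simp add: other)
    qed
    show "(\<lambda>(v, T). (xor (?h T z) v, shift2 \<alpha> (xor (?h T z) v) T)) \<in>
        {v. v < 2 ^ r \<and> G z v} \<times> ?E \<rightarrow> {..<2 ^ r} \<times> ?F"
    proof (rule Pi_I)
      fix q assume "q \<in> {v. v < 2 ^ r \<and> G z v} \<times> ?E"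
      then obtain v T where q: "q = (v, T)" and v: "v < 2 ^ r" "G z v"
        and T: "T \<in> ?\<Omega>" "\<forall>y\<in>K - {z}. G y (?h T y)" by blast
      have x: "xor (?h T z) v < 2 ^ r" using xor_less_two_power[OF hless[OF T(1)] v(1)] .
      have "G y (?h (shift2 \<alpha> (xor (?h T z) v) T) y)" if "y \<in> K" for y
      proof (cases "y = z")
        case True
        then show ?thesis using v(2) by (simp add: h_shift xor_cancel)
      next
        case False
        then show ?thesis using that T(2) other[of y] by simp
      qed
      then show "(\<lambda>(v, T). (xor (?h T z) v, shift2 \<alpha> (xor (?h T z) v) T)) q \<in> {..<2 ^ r} \<times> ?F"
        unfolding q using x shift2_in_tables[OF T(1) \<alpha>\<Omega> x] by simp
    qed
  qed (auto simp: h_shift shift_shift xor.commute xor.left_commute)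
  then have "card ({..<2 ^ r :: nat} \<times> ?F) = card ({v. v < 2 ^ r \<and> G z v} \<times> ?E)"
    by (rule bij_betw_same_card)
  then have "2 ^ r * card ?F = card {v. v < 2 ^ r \<and> G z v} * card ?E"
    by (simp add: card_cartesian_product)
  then have "real (2 ^ r * card ?F) = real (card {v. v < 2 ^ r \<and> G z v} * card ?E)"
    by (rule arg_cong)
  then have "2 ^ r * real (card ?F) = real (card {v. v < 2 ^ r \<and> G z v}) * real (card ?E)"
    unfolding of_nat_mult of_nat_power of_nat_numeral .
  moreover have "real (card ?E) = real (card ?\<Omega>) *
      (\<Prod>z\<in>K - {z}. real (card {v. v < 2 ^ r \<and> G z v}) / 2 ^ r)"
  proof (rule Suc.hyps(1))
    show "n = card (K - {z})" using Suc.hyps(2) Suc.prems(1) z(1) by simp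
  qed (use Suc.prems in auto)
  ultimately have "2 ^ r * real (card ?F) = real (card ?\<Omega>) * (real (card {v. v < 2 ^ r \<and> G z v}) *
      (\<Prod>z\<in>K - {z}. real (card {v. v < 2 ^ r \<and> G z v}) / 2 ^ r))"
    by simp
  then show ?case unfolding prod.remove[OF Suc.prems(1) z(1)] by (simp add: field_simps)
qed

section \<open>Derived keys and obstructions to peeling\<close>

definition extend_key :: "nat \<Rightarrow> (nat \<times> nat \<Rightarrow> nat list) \<Rightarrow> nat list \<Rightarrow> nat list" where
  "extend_key d T z = z @ simple_tab (map2 xor) (replicate d 0) T z"

lemma extend_key_words:
  assumes "\<sigma> = 2 ^ s" "T \<in> tables \<sigma> c (words \<sigma> d)" "z \<in> words \<sigma> c"
  shows "extend_key d T z \<in> words \<sigma> (c + d)"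
    and "i < c \<Longrightarrow> extend_key d T z ! i = z ! i"
    and "t < d \<Longrightarrow> extend_key d T z ! (c + t) = h1_char T t z"
proof -
  have pos: "(i, z ! i) \<in> {..<c} \<times> {..<\<sigma>}" if "i < c" for i
    using assms(3) that by (simp add: nth_words)
  have T: "T (i, z ! i) \<in> words \<sigma> d" if "i < c" for i
    using tables_app[OF assms(2) pos[OF that]] .
  have lz: "length z = c" using assms(3) by (rule length_words)
  have len: "length (T (i, z ! i)) = d" if "i \<in> set [0..<c]" for i
    using T[of i] that by (auto simp: length_words)
  note f = foldr_map2_xor[of "[0..<c]" "\<lambda>i. T (i, z ! i)" d, OF len]
  have st: "length (simple_tab (map2 xor) (replicate d 0) T z) = d"
    and nth: "t < d \<Longrightarrow> simple_tab (map2 xor) (replicate d 0) T z ! t = h1_char T t z" for t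
    using f unfolding simple_tab_def h1_char_def lz by auto
  have less: "h1_char T t z < \<sigma>" if "t < d" for t
    unfolding h1_char_def assms(1)
  proof (rule simple_tab_less)
    fix \<alpha> assume "\<alpha> \<in> position_chars z"
    then have "\<alpha> \<in> {..<c} \<times> {..<\<sigma>}" using position_chars_words[OF assms(3)] by blast
    then have "T \<alpha> \<in> words \<sigma> d" by (rule tables_app[OF assms(2)])
    then show "T \<alpha> ! t < 2 ^ s" using nth_words that assms(1) by blast
  qed
  show 2: "extend_key d T z ! i = z ! i" if "i < c" for i
    using that lz by (simp add: extend_key_def nth_append)
  show 3: "extend_key d T z ! (c + t) = h1_char T t z" if "t < d" for t
    using that lz nth by (simp add: extend_key_def nth_append)
  show "extend_key d T z \<in> words \<sigma> (c + d)"
  proof (rule words_nthI)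
    show "length (extend_key d T z) = c + d" using lz st by (simp add: extend_key_def)
    fix i assume i: "i < c + d"
    show "extend_key d T z ! i < \<sigma>"
    proof (cases "i < c")
      case True
      then show ?thesis using 2 nth_words[OF assms(3)] by simp
    next
      case False
      then obtain t where "i = c + t" "t < d" using i by (metis add_less_cancel_left le_iff_add not_less)
      then show ?thesis using 3 less by simp
    qed
  qed
qed

text \<open>This is \<open>all_shared\<close> for the derived keys, expressed through the input
  keys. It depends on the first tables only, so it can be fixed before the second tables are
  drawn.\<close>

definition blocked :: "nat \<Rightarrow> nat \<Rightarrow> (nat \<times> nat \<Rightarrow> nat list) \<Rightarrow> nat list set \<Rightarrow> bool" where
  "blocked c d T A \<longleftrightarrow> A \<noteq> {} \<and>
    (\<forall>z\<in>A. \<forall>i<c. \<exists>w\<in>A. w \<noteq> z \<and> w ! i = z ! i) \<and>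
    (\<forall>z\<in>A. \<forall>t<d. \<exists>w\<in>A. w \<noteq> z \<and> h1_char T t w = h1_char T t z)"

lemma inj_on_extend_key: "A \<subseteq> words \<sigma> c \<Longrightarrow> inj_on (extend_key d T) A"
  by (rule inj_onI) (metis append_eq_append_conv extend_key_def length_words subsetD)

lemma all_shared_extend_key:
  assumes "\<sigma> = 2 ^ s" "T \<in> tables \<sigma> c (words \<sigma> d)" "A \<subseteq> words \<sigma> c" "A \<noteq> {}"
  shows "all_shared (c + d) (extend_key d T ` A) \<longleftrightarrow> blocked c d T A"
proof -
  have inj: "extend_key d T w = extend_key d T z \<longleftrightarrow> w = z" if "w \<in> A" "z \<in> A" for w z
    using inj_on_extend_key[OF assms(3)] that by (metis inj_on_def)
  have 1: "extend_key d T w ! i = w ! i" if "w \<in> A" "i < c" for w i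
    using extend_key_words(2)[OF assms(1,2)] assms(3) that by blast
  have 2: "extend_key d T w ! (c + t) = h1_char T t w" if "w \<in> A" "t < d" for w t
    using extend_key_words(3)[OF assms(1,2)] assms(3) that by blast
  have split: "(\<forall>i<c + d. P i) \<longleftrightarrow> (\<forall>i<c. P i) \<and> (\<forall>t<d. P (c + t))" for P :: "nat \<Rightarrow> bool"
    by (metis add_less_cancel_left le_Suc_ex not_le trans_less_add1)
  have "all_shared (c + d) (extend_key d T ` A) \<longleftrightarrow>
      (\<forall>z\<in>A. \<forall>i<c + d. \<exists>w\<in>A. w \<noteq> z \<and> extend_key d T w ! i = extend_key d T z ! i)"
    unfolding all_shared_def using inj by (simp add: bex_simps cong: bex_cong conj_cong)
  also have "\<dots> \<longleftrightarrow> blocked c d T A"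
    unfolding blocked_def split using 1 2 assms(4) by (simp add: ball_conj_distrib cong: bex_cong)
  finally show ?thesis .
qed

section \<open>Joint probability of collisions and selections\<close>

locale mixed_tabulation =
  fixes s c d r \<sigma> :: nat and W :: "nat list set" and g :: "nat list \<Rightarrow> nat \<Rightarrow> bool"
  assumes \<sigma>_def: "\<sigma> = 2 ^ s" and W_words: "W \<subseteq> words \<sigma> c"
begin

abbreviation "\<Omega>1 \<equiv> tables \<sigma> c (words \<sigma> d)"
abbreviation "\<Omega>2 \<equiv> tables \<sigma> (c + d) {..<2 ^ r :: nat}"

definition p :: "nat list \<Rightarrow> real" where
  "p z = real (card {v. v < 2 ^ r \<and> g z v}) / 2 ^ r"

definition Y :: "mixed_tables \<Rightarrow> nat list set" where
  "Y T = {z \<in> W. g z (hash2 T (extend_key d (fst T) z))}"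

abbreviation Pr :: "mixed_tables set \<Rightarrow> real" where
  "Pr \<equiv> measure_pmf.prob (mixed_pmf \<sigma> c d r)"

lemma \<sigma>_pos: "\<sigma> > 0" by (simp add: \<sigma>_def)

lemma finite_W [simp]: "finite W"
  using W_words by (rule finite_subset) simp

lemma p_nonneg: "p z \<ge> 0" by (simp add: p_def)

lemma p_le_1: "p z \<le> 1"
proof -
  have "card {v. v < 2 ^ r \<and> g z v} \<le> card {..<2 ^ r :: nat}" by (intro card_mono) auto
  then have "card {v. v < 2 ^ r \<and> g z v} \<le> 2 ^ r" by simp
  then have "real (card {v. v < 2 ^ r \<and> g z v}) \<le> real (2 ^ r)" by (rule of_nat_mono)
  then show ?thesis by (simp add: p_def)
qed

lemma \<Omega>_props: "finite \<Omega>1" "finite \<Omega>2" "\<Omega>1 \<noteq> {}" "\<Omega>2 \<noteq> {}"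
  using \<sigma>_pos by (auto intro!: tables_nonempty words_nonempty simp: lessThan_empty_iff)

lemma mixed_pmf_eq: "mixed_pmf \<sigma> c d r = pmf_of_set (\<Omega>1 \<times> \<Omega>2)"
proof -
  have "{..<2 ^ r :: nat} \<noteq> {}" by (simp add: lessThan_empty_iff)
  then show ?thesis
    unfolding mixed_pmf_def using \<Omega>_props words_nonempty[OF \<sigma>_pos]
    by (simp add: random_tables_eq pair_pmf_of_set)
qed

lemma Pr_eq: "Pr E = real (card (\<Omega>1 \<times> \<Omega>2 \<inter> E)) / (real (card \<Omega>1) * real (card \<Omega>2))"
proof -
  have "finite (\<Omega>1 \<times> \<Omega>2)" "\<Omega>1 \<times> \<Omega>2 \<noteq> {}" using \<Omega>_props by auto
  then show ?thesis unfolding mixed_pmf_eq by (simp add: measure_pmf_of_set card_cartesian_product)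
qed

text \<open>With the first tables fixed, no set of derived keys of \<open>K\<close> obstructs
  peeling, so \<open>card_tables_unshared\<close> applies. Since that lemma speaks about derived
  keys, \<open>G\<close> carries the selection predicate over to them.\<close>

lemma card_selected_second:
  assumes "T1 \<in> \<Omega>1" "K \<subseteq> W" "\<And>A. A \<subseteq> K \<Longrightarrow> \<not> blocked c d T1 A"
  shows "real (card {T2 \<in> \<Omega>2. K \<subseteq> Y (T1, T2)}) = real (card \<Omega>2) * (\<Prod>z\<in>K. p z)"
proof -
  let ?e = "extend_key d T1"
  define G where "G y = g (the_inv_into K ?e y)" for y
  have KW: "K \<subseteq> words \<sigma> c" using assms(2) W_words by blast
  have inj: "inj_on ?e K" by (rule inj_on_extend_key[OF KW])
  have G: "G (?e z) = g z" if "z \<in> K" for z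
    using the_inv_into_f_f[OF inj that] by (simp add: G_def)
  have "{T2 \<in> \<Omega>2. K \<subseteq> Y (T1, T2)} = {T2 \<in> \<Omega>2. \<forall>y\<in>?e ` K. G y (simple_tab xor 0 T2 y)}"
    using assms(2) G by (auto simp: Y_def hash2_def subset_iff)
  then have "real (card {T2 \<in> \<Omega>2. K \<subseteq> Y (T1, T2)}) =
      real (card {T2 \<in> \<Omega>2. \<forall>y\<in>?e ` K. G y (simple_tab xor 0 T2 y)})" by simp
  also have "\<dots> = real (card \<Omega>2) * (\<Prod>y\<in>?e ` K. real (card {v. v < 2 ^ r \<and> G y v}) / 2 ^ r)"
  proof (rule card_tables_unshared)
    show "finite (?e ` K)" using assms(2) finite_W finite_subset by blast
    show "?e ` K \<subseteq> words \<sigma> (c + d)" using extend_key_words(1)[OF \<sigma>_def assms(1)] KW by blast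
    fix B assume "B \<subseteq> ?e ` K" "B \<noteq> {}"
    then obtain A where A: "A \<subseteq> K" "B = ?e ` A" "A \<noteq> {}" by (metis image_is_empty subset_image_iff)
    then show "\<not> all_shared (c + d) B"
      using all_shared_extend_key[OF \<sigma>_def assms(1), of A] assms(3) KW by blast
  qed
  also have "(\<Prod>y\<in>?e ` K. real (card {v. v < 2 ^ r \<and> G y v}) / 2 ^ r) = (\<Prod>z\<in>K. p z)"
    unfolding prod.reindex[OF inj] by (intro prod.cong) (auto simp: G p_def)
  finally show ?thesis .
qed

text \<open>The event demands that \<open>K\<close> contain no blocked set because the second tables
  then contribute exactly the product of the selection probabilities. Once this has been used, the
  demand is dropped, and the first tables are counted by their collisions alone.\<close>

lemma Pr_satisfies_selected:
  assumes "gf2_indep (map constraint_set cs)"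
    and "\<forall>(t, u, v) \<in> set cs. t < d \<and> u \<in> words \<sigma> c \<and> v \<in> words \<sigma> c"
    and "K \<subseteq> W"
  shows "Pr {T. satisfies cs (fst T) \<and> (\<forall>A\<subseteq>K. \<not> blocked c d (fst T) A) \<and> K \<subseteq> Y T}
    \<le> (\<Prod>z\<in>K. p z) / real \<sigma> ^ length cs"
proof -
  let ?E = "{T. satisfies cs (fst T) \<and> (\<forall>A\<subseteq>K. \<not> blocked c d (fst T) A) \<and> K \<subseteq> Y T}"
  let ?S = "{T1 \<in> \<Omega>1. satisfies cs T1 \<and> (\<forall>A\<subseteq>K. \<not> blocked c d T1 A)}"
  let ?S' = "{T1 \<in> \<Omega>1. satisfies cs T1}"
  have "\<Omega>1 \<times> \<Omega>2 \<inter> ?E = (SIGMA T1:?S. {T2 \<in> \<Omega>2. K \<subseteq> Y (T1, T2)})" by auto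
  then have "real (card (\<Omega>1 \<times> \<Omega>2 \<inter> ?E)) = (\<Sum>T1\<in>?S. real (card {T2 \<in> \<Omega>2. K \<subseteq> Y (T1, T2)}))"
    using \<Omega>_props by (simp add: card_SigmaI)
  also have "\<dots> = (\<Sum>T1\<in>?S. real (card \<Omega>2) * (\<Prod>z\<in>K. p z))"
    by (intro sum.cong card_selected_second assms(3)) auto
  also have "\<dots> = real (card ?S) * (real (card \<Omega>2) * (\<Prod>z\<in>K. p z))" by simp
  also have "\<dots> \<le> real (card ?S') * (real (card \<Omega>2) * (\<Prod>z\<in>K. p z))"
  proof (intro mult_right_mono)
    show "real (card ?S) \<le> real (card ?S')" using \<Omega>_props by (auto intro!: card_mono)
  qed (simp add: prod_nonneg p_nonneg)
  finally have 1: "real (card (\<Omega>1 \<times> \<Omega>2 \<inter> ?E)) \<le> real (card ?S') * (real (card \<Omega>2) * (\<Prod>z\<in>K. p z))" .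
  have "card ?S' * \<sigma> ^ length cs \<le> card \<Omega>1" using card_satisfies[OF \<sigma>_def assms(1,2)] .
  then have "real (card ?S' * \<sigma> ^ length cs) \<le> real (card \<Omega>1)" by (rule of_nat_mono)
  then have "real (card ?S') * real \<sigma> ^ length cs \<le> real (card \<Omega>1)" by simp
  then have 2: "real (card ?S') \<le> real (card \<Omega>1) / real \<sigma> ^ length cs"
    using \<sigma>_pos by (simp add: pos_le_divide_eq)
  have nn: "0 \<le> real (card \<Omega>2) * (\<Prod>z\<in>K. p z)" by (simp add: prod_nonneg p_nonneg)
  have c: "real (card \<Omega>1) > 0" "real (card \<Omega>2) > 0" using \<Omega>_props by (auto simp: card_gt_0_iff)
  have "Pr ?E \<le> (real (card \<Omega>1) / real \<sigma> ^ length cs) * (real (card \<Omega>2) * (\<Prod>z\<in>K. p z)) /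
      (real (card \<Omega>1) * real (card \<Omega>2))"
    unfolding Pr_eq using order.trans[OF 1 mult_right_mono[OF 2 nn]] c by (intro divide_right_mono) auto
  also have "\<dots> = (\<Prod>z\<in>K. p z) / real \<sigma> ^ length cs"
  proof -
    have "a / k * (b * q) / (a * b) = q / k" if "a > 0" "b > 0" for a b k q :: real
      using that by simp
    then show ?thesis using c by blast
  qed
  finally show ?thesis .
qed

end

section \<open>Zero-sum quadruples of keys\<close>

text \<open>The sum of the four singletons consists of the characters occurring an odd number of
  times; with \<open>P\<close> empty the four characters therefore agree in pairs.\<close>

definition even_outside :: "'a set \<Rightarrow> 'a \<Rightarrow> 'a \<Rightarrow> 'a \<Rightarrow> 'a \<Rightarrow> bool" where
  "even_outside P \<alpha> \<beta> \<gamma> \<delta> \<longleftrightarrow> sdiff (sdiff {\<alpha>} {\<beta>}) (sdiff {\<gamma>} {\<delta>}) \<subseteq> P"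

definition matched :: "'a set \<Rightarrow> 'a \<Rightarrow> 'a \<Rightarrow> bool" where
  "matched P \<alpha> \<beta> \<longleftrightarrow> \<alpha> = \<beta> \<or> (\<alpha> \<in> P \<and> \<beta> \<in> P)"

text \<open>Characters in \<open>P\<close> are pinned by other keys; among the four characters, those that are not pinned cancel in pairs.\<close>

lemma even_outside_matched:
  assumes "even_outside P \<alpha> \<beta> \<gamma> \<delta>"
  shows "matched P \<alpha> \<beta> \<and> matched P \<gamma> \<delta> \<or> matched P \<alpha> \<gamma> \<and> matched P \<beta> \<delta> \<or> matched P \<alpha> \<delta> \<and> matched P \<beta> \<gamma>"
proof -
  have *: "v \<in> P" if "((v = \<alpha>) \<noteq> (v = \<beta>)) \<noteq> ((v = \<gamma>) \<noteq> (v = \<delta>))" for v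
    using assms that unfolding even_outside_def by auto
  show ?thesis unfolding matched_def using *[of \<alpha>] *[of \<beta>] *[of \<gamma>] *[of \<delta>] by metis
qed

text \<open>Matched pairs lie on the diagonal, where Cauchy--Schwarz gives the product of the norms,
  or in \<open>P \<times> P\<close>, where the double sum factors and each factor, a sum over at
  most \<open>card P\<close> points, is at most \<open>sqrt (card P)\<close> times the norm.\<close>

lemma sum_matched_le:
  fixes f g :: "'a \<Rightarrow> real"
  assumes A: "finite A" and P: "finite P" and f: "\<And>x. f x \<ge> 0" and g: "\<And>x. g x \<ge> 0"
  shows "(\<Sum>\<alpha>\<in>A. \<Sum>\<beta>\<in>A. of_bool (matched P \<alpha> \<beta>) * (f \<alpha> * g \<beta>))
    \<le> (1 + real (card P)) * (L2_set f A * L2_set g A)"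
proof -
  have L2_P: "(\<Sum>\<alpha>\<in>A \<inter> P. h \<alpha>) \<le> sqrt (real (card P)) * L2_set h A"
    if h: "\<And>x. h x \<ge> 0" for h :: "'a \<Rightarrow> real"
  proof -
    have "(\<Sum>\<alpha>\<in>A \<inter> P. h \<alpha>) = (\<Sum>\<alpha>\<in>A \<inter> P. \<bar>1\<bar> * \<bar>h \<alpha>\<bar>)" using h by simp
    also have "\<dots> \<le> L2_set (\<lambda>_. 1) (A \<inter> P) * L2_set h (A \<inter> P)" by (rule L2_set_mult_ineq)
    also have "\<dots> \<le> sqrt (real (card P)) * L2_set h A"
    proof (intro mult_mono)
      show "L2_set (\<lambda>_. 1 :: real) (A \<inter> P) \<le> sqrt (real (card P))"
        unfolding L2_set_def using P by (simp add: card_mono)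
      show "L2_set h (A \<inter> P) \<le> L2_set h A"
        unfolding L2_set_def using A by (intro real_sqrt_le_mono sum_mono2) auto
    qed (auto simp: L2_set_nonneg)
    finally show ?thesis .
  qed
  have "(\<Sum>\<alpha>\<in>A. \<Sum>\<beta>\<in>A. of_bool (matched P \<alpha> \<beta>) * (f \<alpha> * g \<beta>))
    \<le> (\<Sum>\<alpha>\<in>A. \<Sum>\<beta>\<in>A. of_bool (\<beta> = \<alpha>) * (f \<alpha> * g \<beta>) + of_bool (\<alpha> \<in> P) * f \<alpha> * (of_bool (\<beta> \<in> P) * g \<beta>))"
    by (intro sum_mono) (auto simp: matched_def f g)
  also have "\<dots> = (\<Sum>\<alpha>\<in>A. f \<alpha> * g \<alpha>) + (\<Sum>\<alpha>\<in>A. of_bool (\<alpha> \<in> P) * f \<alpha>) * (\<Sum>\<beta>\<in>A. of_bool (\<beta> \<in> P) * g \<beta>)"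
  proof -
    have "(\<Sum>\<beta>\<in>A. of_bool (\<beta> = \<alpha>) * (f \<alpha> * g \<beta>)) = f \<alpha> * g \<alpha>" if "\<alpha> \<in> A" for \<alpha>
      using A that by (simp add: of_bool_def if_distrib[of "\<lambda>x. x * _"] cong: if_cong)
    then show ?thesis by (simp add: sum.distrib sum_product)
  qed
  also have "(\<Sum>\<alpha>\<in>A. of_bool (\<alpha> \<in> P) * f \<alpha>) = (\<Sum>\<alpha>\<in>A \<inter> P. f \<alpha>)"
    using A by (simp add: sum.inter_restrict of_bool_def if_distrib[of "\<lambda>x. x * _"] cong: if_cong)
  also have "(\<Sum>\<alpha>\<in>A. of_bool (\<alpha> \<in> P) * g \<alpha>) = (\<Sum>\<alpha>\<in>A \<inter> P. g \<alpha>)"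
    using A by (simp add: sum.inter_restrict of_bool_def if_distrib[of "\<lambda>x. x * _"] cong: if_cong)
  also have "(\<Sum>\<alpha>\<in>A. f \<alpha> * g \<alpha>) \<le> L2_set f A * L2_set g A"
    using L2_set_mult_ineq[where f=f and g=g and A=A] f g by simp
  also have "(\<Sum>\<alpha>\<in>A \<inter> P. f \<alpha>) * (\<Sum>\<alpha>\<in>A \<inter> P. g \<alpha>)
      \<le> (sqrt (real (card P)) * L2_set f A) * (sqrt (real (card P)) * L2_set g A)"
    by (intro mult_mono L2_P f g sum_nonneg mult_nonneg_nonneg L2_set_nonneg) auto
  also have "\<dots> = real (card P) * (L2_set f A * L2_set g A)"
    by (simp add: algebra_simps flip: power2_eq_square)
  finally show ?thesis by (simp add: algebra_simps)
qed

lemma sum_4_factor: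
  fixes F G :: "'a \<Rightarrow> 'a \<Rightarrow> real"
  shows "(\<Sum>\<alpha>\<in>A. \<Sum>\<beta>\<in>A. \<Sum>\<gamma>\<in>A. \<Sum>\<delta>\<in>A. F \<alpha> \<beta> * G \<gamma> \<delta>) =
    (\<Sum>\<alpha>\<in>A. \<Sum>\<beta>\<in>A. F \<alpha> \<beta>) * (\<Sum>\<gamma>\<in>A. \<Sum>\<delta>\<in>A. G \<gamma> \<delta>)"
  by (simp only: sum_distrib_left[symmetric] sum_distrib_right[symmetric])

text \<open>The factor 3 counts the ways to split four characters into two pairs. For each of them
  the sum is a product of two sums over matched pairs, and each of these costs
  \<open>1 + k\<close>.\<close>

lemma sum_even_outside_le:
  fixes f1 f2 f3 f4 :: "'a \<Rightarrow> real"
  assumes A: "finite A" and P: "finite P" "card P \<le> k"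
    and nn: "\<And>x. f1 x \<ge> 0" "\<And>x. f2 x \<ge> 0" "\<And>x. f3 x \<ge> 0" "\<And>x. f4 x \<ge> 0"
  shows "(\<Sum>(\<alpha>, \<beta>, \<gamma>, \<delta>)\<in>A \<times> A \<times> A \<times> A. of_bool (even_outside P \<alpha> \<beta> \<gamma> \<delta>) * (f1 \<alpha> * f2 \<beta> * f3 \<gamma> * f4 \<delta>))
    \<le> 3 * (1 + real k)\<^sup>2 * (L2_set f1 A * L2_set f2 A * L2_set f3 A * L2_set f4 A)"
proof -
  let ?M = "\<lambda>f g. \<Sum>\<alpha>\<in>A. \<Sum>\<beta>\<in>A. of_bool (matched P \<alpha> \<beta>) * (f \<alpha> * g \<beta>)"
  let ?L = "\<lambda>f. L2_set f A"
  have M: "0 \<le> ?M f g" "?M f g \<le> (1 + real k) * (?L f * ?L g)"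
    if "\<And>x. f x \<ge> 0" "\<And>x. g x \<ge> 0" for f g :: "'a \<Rightarrow> real"
  proof -
    have "?M f g \<le> (1 + real (card P)) * (?L f * ?L g)"
      by (rule sum_matched_le) (use A P that in auto)
    also have "\<dots> \<le> (1 + real k) * (?L f * ?L g)"
      using P(2) by (intro mult_right_mono mult_nonneg_nonneg L2_set_nonneg) auto
    finally show "?M f g \<le> (1 + real k) * (?L f * ?L g)" .
  qed (use that in \<open>auto intro!: sum_nonneg\<close>)
  have MM: "?M f g * ?M f' g' \<le> (1 + real k)\<^sup>2 * (?L f * ?L g * ?L f' * ?L g')"
    if "\<And>x. f x \<ge> 0" "\<And>x. g x \<ge> 0" "\<And>x. f' x \<ge> 0" "\<And>x. g' x \<ge> 0" for f g f' g' :: "'a \<Rightarrow> real"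
  proof -
    have "?M f g * ?M f' g' \<le> ((1 + real k) * (?L f * ?L g)) * ((1 + real k) * (?L f' * ?L g'))"
      by (intro mult_mono M that mult_nonneg_nonneg L2_set_nonneg) auto
    then show ?thesis by (simp add: power2_eq_square algebra_simps)
  qed
  let ?t = "\<lambda>\<alpha> \<beta> \<gamma> \<delta>. f1 \<alpha> * f2 \<beta> * f3 \<gamma> * f4 \<delta>"
  let ?m = "\<lambda>\<alpha> \<beta>. of_bool (matched P \<alpha> \<beta>) :: real"
  have t: "0 \<le> ?t \<alpha> \<beta> \<gamma> \<delta>" for \<alpha> \<beta> \<gamma> \<delta> using nn by simp
  have "(\<Sum>(\<alpha>, \<beta>, \<gamma>, \<delta>)\<in>A \<times> A \<times> A \<times> A. of_bool (even_outside P \<alpha> \<beta> \<gamma> \<delta>) * ?t \<alpha> \<beta> \<gamma> \<delta>) =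
      (\<Sum>\<alpha>\<in>A. \<Sum>\<beta>\<in>A. \<Sum>\<gamma>\<in>A. \<Sum>\<delta>\<in>A. of_bool (even_outside P \<alpha> \<beta> \<gamma> \<delta>) * ?t \<alpha> \<beta> \<gamma> \<delta>)"
    by (simp add: sum.cartesian_product)
  also have "\<dots> \<le> (\<Sum>\<alpha>\<in>A. \<Sum>\<beta>\<in>A. \<Sum>\<gamma>\<in>A. \<Sum>\<delta>\<in>A. ?m \<alpha> \<beta> * ?m \<gamma> \<delta> * ?t \<alpha> \<beta> \<gamma> \<delta>
      + ?m \<alpha> \<gamma> * ?m \<beta> \<delta> * ?t \<alpha> \<beta> \<gamma> \<delta> + ?m \<alpha> \<delta> * ?m \<beta> \<gamma> * ?t \<alpha> \<beta> \<gamma> \<delta>)"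
  proof (intro sum_mono)
    fix \<alpha> \<beta> \<gamma> \<delta>
    have "of_bool (even_outside P \<alpha> \<beta> \<gamma> \<delta>) \<le> ?m \<alpha> \<beta> * ?m \<gamma> \<delta> + ?m \<alpha> \<gamma> * ?m \<beta> \<delta> + ?m \<alpha> \<delta> * ?m \<beta> \<gamma>"
      using even_outside_matched[of P \<alpha> \<beta> \<gamma> \<delta>] by (auto simp: of_bool_def)
    from mult_right_mono[OF this t[of \<alpha> \<beta> \<gamma> \<delta>]]
    show "of_bool (even_outside P \<alpha> \<beta> \<gamma> \<delta>) * ?t \<alpha> \<beta> \<gamma> \<delta> \<le> ?m \<alpha> \<beta> * ?m \<gamma> \<delta> * ?t \<alpha> \<beta> \<gamma> \<delta>
      + ?m \<alpha> \<gamma> * ?m \<beta> \<delta> * ?t \<alpha> \<beta> \<gamma> \<delta> + ?m \<alpha> \<delta> * ?m \<beta> \<gamma> * ?t \<alpha> \<beta> \<gamma> \<delta>"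
      by (simp only: distrib_right)
  qed
  also have "\<dots> = (\<Sum>\<alpha>\<in>A. \<Sum>\<beta>\<in>A. \<Sum>\<gamma>\<in>A. \<Sum>\<delta>\<in>A. ?m \<alpha> \<beta> * ?m \<gamma> \<delta> * ?t \<alpha> \<beta> \<gamma> \<delta>)
      + (\<Sum>\<alpha>\<in>A. \<Sum>\<beta>\<in>A. \<Sum>\<gamma>\<in>A. \<Sum>\<delta>\<in>A. ?m \<alpha> \<gamma> * ?m \<beta> \<delta> * ?t \<alpha> \<beta> \<gamma> \<delta>)
      + (\<Sum>\<alpha>\<in>A. \<Sum>\<beta>\<in>A. \<Sum>\<gamma>\<in>A. \<Sum>\<delta>\<in>A. ?m \<alpha> \<delta> * ?m \<beta> \<gamma> * ?t \<alpha> \<beta> \<gamma> \<delta>)"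
    by (simp only: sum.distrib)
  also have "(\<Sum>\<alpha>\<in>A. \<Sum>\<beta>\<in>A. \<Sum>\<gamma>\<in>A. \<Sum>\<delta>\<in>A. ?m \<alpha> \<beta> * ?m \<gamma> \<delta> * ?t \<alpha> \<beta> \<gamma> \<delta>) = ?M f1 f2 * ?M f3 f4"
    unfolding sum_4_factor[symmetric] by (simp add: mult_ac)
  also have "(\<Sum>\<alpha>\<in>A. \<Sum>\<beta>\<in>A. \<Sum>\<gamma>\<in>A. \<Sum>\<delta>\<in>A. ?m \<alpha> \<gamma> * ?m \<beta> \<delta> * ?t \<alpha> \<beta> \<gamma> \<delta>)
      = (\<Sum>\<alpha>\<in>A. \<Sum>\<gamma>\<in>A. \<Sum>\<beta>\<in>A. \<Sum>\<delta>\<in>A. ?m \<alpha> \<gamma> * ?m \<beta> \<delta> * ?t \<alpha> \<beta> \<gamma> \<delta>)"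
    by (intro sum.cong refl sum.swap)
  also have "\<dots> = ?M f1 f3 * ?M f2 f4"
    unfolding sum_4_factor[symmetric] by (simp add: mult_ac)
  also have "(\<Sum>\<alpha>\<in>A. \<Sum>\<beta>\<in>A. \<Sum>\<gamma>\<in>A. \<Sum>\<delta>\<in>A. ?m \<alpha> \<delta> * ?m \<beta> \<gamma> * ?t \<alpha> \<beta> \<gamma> \<delta>)
      = (\<Sum>\<alpha>\<in>A. \<Sum>\<beta>\<in>A. \<Sum>\<delta>\<in>A. \<Sum>\<gamma>\<in>A. ?m \<alpha> \<delta> * ?m \<beta> \<gamma> * ?t \<alpha> \<beta> \<gamma> \<delta>)"
    by (intro sum.cong refl sum.swap)
  also have "\<dots> = (\<Sum>\<alpha>\<in>A. \<Sum>\<delta>\<in>A. \<Sum>\<beta>\<in>A. \<Sum>\<gamma>\<in>A. ?m \<alpha> \<delta> * ?m \<beta> \<gamma> * ?t \<alpha> \<beta> \<gamma> \<delta>)"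
    by (intro sum.cong refl sum.swap)
  also have "\<dots> = ?M f1 f4 * ?M f2 f3"
    unfolding sum_4_factor[symmetric] by (simp add: mult_ac)
  also have "?M f1 f2 * ?M f3 f4 + ?M f1 f3 * ?M f2 f4 + ?M f1 f4 * ?M f2 f3 \<le>
      (1 + real k)\<^sup>2 * (?L f1 * ?L f2 * ?L f3 * ?L f4) + (1 + real k)\<^sup>2 * (?L f1 * ?L f3 * ?L f2 * ?L f4)
      + (1 + real k)\<^sup>2 * (?L f1 * ?L f4 * ?L f2 * ?L f3)"
    by (intro add_mono MM nn)
  also have "\<dots> = 3 * (1 + real k)\<^sup>2 * (?L f1 * ?L f2 * ?L f3 * ?L f4)" by (simp add: algebra_simps)
  finally show ?thesis .
qed

lemma words_Suc: "words \<sigma> (Suc c) = (\<lambda>(\<alpha>, z). \<alpha> # z) ` ({..<\<sigma>} \<times> words \<sigma> c)"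
proof (intro equalityI subsetI)
  fix y assume "y \<in> words \<sigma> (Suc c)"
  then show "y \<in> (\<lambda>(\<alpha>, z). \<alpha> # z) ` ({..<\<sigma>} \<times> words \<sigma> c)"
    by (cases y) (auto simp: words_def)
qed (auto simp: words_def)

lemma sum_words_Suc:
  fixes F :: "nat list \<Rightarrow> real"
  shows "sum F (words \<sigma> (Suc c)) = (\<Sum>z\<in>words \<sigma> c. \<Sum>\<alpha><\<sigma>. F (\<alpha> # z))"
proof -
  have "sum F (words \<sigma> (Suc c)) = (\<Sum>(\<alpha>, z)\<in>{..<\<sigma>} \<times> words \<sigma> c. F (\<alpha> # z))"
    unfolding words_Suc by (subst sum.reindex) (auto simp: inj_on_def case_prod_beta)
  also have "\<dots> = (\<Sum>\<alpha><\<sigma>. \<Sum>z\<in>words \<sigma> c. F (\<alpha> # z))" by (simp add: sum.cartesian_product)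
  also have "\<dots> = (\<Sum>z\<in>words \<sigma> c. \<Sum>\<alpha><\<sigma>. F (\<alpha> # z))" by (rule sum.swap)
  finally show ?thesis .
qed

lemma sum_words_Suc_4:
  fixes F :: "nat list \<Rightarrow> nat list \<Rightarrow> nat list \<Rightarrow> nat list \<Rightarrow> real"
  shows "(\<Sum>(a, b, u, v)\<in>words \<sigma> (Suc c) \<times> words \<sigma> (Suc c) \<times> words \<sigma> (Suc c) \<times> words \<sigma> (Suc c). F a b u v) =
    (\<Sum>(a, b, u, v)\<in>words \<sigma> c \<times> words \<sigma> c \<times> words \<sigma> c \<times> words \<sigma> c.
      \<Sum>(\<alpha>, \<beta>, \<gamma>, \<delta>)\<in>{..<\<sigma>} \<times> {..<\<sigma>} \<times> {..<\<sigma>} \<times> {..<\<sigma>}. F (\<alpha> # a) (\<beta> # b) (\<gamma> # u) (\<delta> # v))"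
  (is "sum _ (?W' \<times> _) = sum _ (?W \<times> _)")
proof -
  let ?A = "{..<\<sigma>}"
  have "(\<Sum>(a, b, u, v)\<in>?W' \<times> ?W' \<times> ?W' \<times> ?W'. F a b u v) =
    (\<Sum>((a, b, u, v), (\<alpha>, \<beta>, \<gamma>, \<delta>))\<in>(?W \<times> ?W \<times> ?W \<times> ?W) \<times> (?A \<times> ?A \<times> ?A \<times> ?A).
      F (\<alpha> # a) (\<beta> # b) (\<gamma> # u) (\<delta> # v))"
    by (rule sum.reindex_bij_witness[where
          j = "\<lambda>(a, b, u, v). ((tl a, tl b, tl u, tl v), (hd a, hd b, hd u, hd v))" and
          i = "\<lambda>((a, b, u, v), (\<alpha>, \<beta>, \<gamma>, \<delta>)). (\<alpha> # a, \<beta> # b, \<gamma> # u, \<delta> # v)"])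
      (auto simp: words_Suc)
  then show ?thesis by (simp add: sum.cartesian_product case_prod_beta)
qed

text \<open>The inequality tensorizes over the positions. Leading characters are summed first; their
  norms are nonnegative functions of the tails, to which the induction hypothesis applies, and
  Euclidean norms taken in two stages compose.\<close>

lemma sum_words_even_outside_le:
  fixes f1 f2 f3 f4 :: "nat list \<Rightarrow> real"
  assumes P: "\<And>i. finite (P i)" "\<And>i. card (P i) \<le> k"
    and nn: "\<And>x. f1 x \<ge> 0" "\<And>x. f2 x \<ge> 0" "\<And>x. f3 x \<ge> 0" "\<And>x. f4 x \<ge> 0"
  shows "(\<Sum>(a, b, u, v)\<in>words \<sigma> c \<times> words \<sigma> c \<times> words \<sigma> c \<times> words \<sigma> c.
      of_bool (\<forall>i<c. even_outside (P i) (a ! i) (b ! i) (u ! i) (v ! i)) * (f1 a * f2 b * f3 u * f4 v))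
    \<le> (3 * (1 + real k)\<^sup>2) ^ c *
      (L2_set f1 (words \<sigma> c) * L2_set f2 (words \<sigma> c) * L2_set f3 (words \<sigma> c) * L2_set f4 (words \<sigma> c))"
  using assms
proof (induction c arbitrary: P f1 f2 f3 f4)
  case 0
  have "words \<sigma> 0 = {[]}" by (auto simp: words_def)
  then show ?case using "0.prems" by (simp add: L2_set_def)
next
  case (Suc c)
  let ?W = "words \<sigma> c" and ?A = "{..<\<sigma>}"
  let ?K = "3 * (1 + real k)\<^sup>2"
  let ?F = "\<lambda>f z. L2_set (\<lambda>\<alpha>. f (\<alpha> # z)) ?A"
  let ?g = "\<lambda>a b u v. of_bool (\<forall>i<c. even_outside (P (Suc i)) (a ! i) (b ! i) (u ! i) (v ! i)) :: real"
  have L2: "L2_set (?F f) ?W = L2_set f (words \<sigma> (Suc c))" for f :: "nat list \<Rightarrow> real"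
  proof -
    have "(?F f z)\<^sup>2 = (\<Sum>\<alpha><\<sigma>. (f (\<alpha> # z))\<^sup>2)" for z
      unfolding L2_set_def by (simp add: sum_nonneg)
    then show ?thesis unfolding L2_set_def[of _ ?W] L2_set_def[of f] sum_words_Suc by simp
  qed
  have all: "(\<forall>i<Suc c. Q i) \<longleftrightarrow> Q 0 \<and> (\<forall>i<c. Q (Suc i))" for Q by (auto simp: less_Suc_eq_0_disj)
  have "(\<Sum>(a, b, u, v)\<in>words \<sigma> (Suc c) \<times> words \<sigma> (Suc c) \<times> words \<sigma> (Suc c) \<times> words \<sigma> (Suc c).
      of_bool (\<forall>i<Suc c. even_outside (P i) (a ! i) (b ! i) (u ! i) (v ! i)) * (f1 a * f2 b * f3 u * f4 v)) =
    (\<Sum>(a, b, u, v)\<in>?W \<times> ?W \<times> ?W \<times> ?W. ?g a b u v *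
      (\<Sum>(\<alpha>, \<beta>, \<gamma>, \<delta>)\<in>?A \<times> ?A \<times> ?A \<times> ?A. of_bool (even_outside (P 0) \<alpha> \<beta> \<gamma> \<delta>) *
        (f1 (\<alpha> # a) * f2 (\<beta> # b) * f3 (\<gamma> # u) * f4 (\<delta> # v))))"
    unfolding sum_words_Suc_4
  proof (intro sum.cong refl, clarify)
    fix a b u v
    show "(\<Sum>(\<alpha>, \<beta>, \<gamma>, \<delta>)\<in>?A \<times> ?A \<times> ?A \<times> ?A.
        of_bool (\<forall>i<Suc c. even_outside (P i) ((\<alpha> # a) ! i) ((\<beta> # b) ! i) ((\<gamma> # u) ! i) ((\<delta> # v) ! i)) *
        (f1 (\<alpha> # a) * f2 (\<beta> # b) * f3 (\<gamma> # u) * f4 (\<delta> # v))) =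
      ?g a b u v * (\<Sum>(\<alpha>, \<beta>, \<gamma>, \<delta>)\<in>?A \<times> ?A \<times> ?A \<times> ?A. of_bool (even_outside (P 0) \<alpha> \<beta> \<gamma> \<delta>) *
        (f1 (\<alpha> # a) * f2 (\<beta> # b) * f3 (\<gamma> # u) * f4 (\<delta> # v)))"
      unfolding all sum_distrib_left by (intro sum.cong refl) (auto simp: case_prod_beta)
  qed
  also have "\<dots> \<le> (\<Sum>(a, b, u, v)\<in>?W \<times> ?W \<times> ?W \<times> ?W. ?g a b u v * (?K * (?F f1 a * ?F f2 b * ?F f3 u * ?F f4 v)))"
  proof (intro sum_mono, clarify)
    fix a b u v
    show "?g a b u v *
      (\<Sum>(\<alpha>, \<beta>, \<gamma>, \<delta>)\<in>?A \<times> ?A \<times> ?A \<times> ?A. of_bool (even_outside (P 0) \<alpha> \<beta> \<gamma> \<delta>) *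
        (f1 (\<alpha> # a) * f2 (\<beta> # b) * f3 (\<gamma> # u) * f4 (\<delta> # v)))
      \<le> ?g a b u v * (?K * (?F f1 a * ?F f2 b * ?F f3 u * ?F f4 v))"
      by (intro mult_left_mono sum_even_outside_le) (use Suc.prems in auto)
  qed
  also have "\<dots> = ?K * (\<Sum>(a, b, u, v)\<in>?W \<times> ?W \<times> ?W \<times> ?W. ?g a b u v * (?F f1 a * ?F f2 b * ?F f3 u * ?F f4 v))"
    by (simp add: sum_distrib_left case_prod_beta mult_ac)
  also have "\<dots> \<le> ?K * (?K ^ c * (L2_set (?F f1) ?W * L2_set (?F f2) ?W * L2_set (?F f3) ?W * L2_set (?F f4) ?W))"
    by (intro mult_left_mono Suc.IH) (use Suc.prems L2_set_nonneg in auto)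
  finally show ?case unfolding L2 by simp
qed

text \<open>The sum of four keys as vectors of position characters; it is empty for a zero-sum
  quadruple.\<close>

definition sdiff4 :: "nat list \<Rightarrow> nat list \<Rightarrow> nat list \<Rightarrow> nat list \<Rightarrow> (nat \<times> nat) set" where
  "sdiff4 a b u v = sdiff (sdiff (position_chars a) (position_chars b)) (sdiff (position_chars u) (position_chars v))"

context mixed_tabulation
begin

text \<open>Each key contributes the Euclidean norm of \<open>p\<close>, whose square is at most
  \<open>sum p A\<close> because \<open>p\<close> is at most 1. Four keys thus cost the second power
  of the mean, whereas three freely chosen ones would cost the third. \<open>F\<close> holds other
  keys of an exploration, which may supply the characters that do not cancel.\<close>

lemma sum_quadruples_le:
  assumes A: "A \<subseteq> W" and F: "finite F" "F \<subseteq> words \<sigma> c"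
  shows "(\<Sum>(a, b, u, v)\<in>A \<times> A \<times> A \<times> A.
      of_bool (sdiff4 a b u v \<subseteq> (\<Union>w\<in>F. position_chars w)) * (p a * p b * p u * p v))
    \<le> (3 * (1 + real (card F))\<^sup>2) ^ c * (sum p A)\<^sup>2"
proof -
  let ?W = "words \<sigma> c"
  define P where "P i = (\<lambda>w. w ! i) ` F" for i
  \<comment> \<open>Cutting \<open>p\<close> off outside \<open>A\<close> lets the sum range over
    all words, as the induction over positions requires.\<close>
  define f where "f z = (if z \<in> A then p z else 0)" for z
  have AW: "A \<subseteq> ?W" using A W_words by blast
  have fA: "finite A" using A finite_W finite_subset by blast
  have even: "even_outside (P i) (a ! i) (b ! i) (u ! i) (v ! i)"
    if in_W: "a \<in> ?W" "b \<in> ?W" "u \<in> ?W" "v \<in> ?W" and i: "i < c"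
      and sub: "sdiff4 a b u v \<subseteq> (\<Union>w\<in>F. position_chars w)" for a b u v i
    unfolding even_outside_def
  proof
    fix x assume "x \<in> sdiff (sdiff {a ! i} {b ! i}) (sdiff {u ! i} {v ! i})"
    then have "(i, x) \<in> sdiff4 a b u v" using in_W i by (simp add: sdiff4_def length_words)
    then show "x \<in> P i" using sub unfolding P_def by auto
  qed
  have "(\<Sum>(a, b, u, v)\<in>A \<times> A \<times> A \<times> A.
      of_bool (sdiff4 a b u v \<subseteq> (\<Union>w\<in>F. position_chars w)) * (p a * p b * p u * p v))
    \<le> (\<Sum>(a, b, u, v)\<in>A \<times> A \<times> A \<times> A.
      of_bool (\<forall>i<c. even_outside (P i) (a ! i) (b ! i) (u ! i) (v ! i)) * (f a * f b * f u * f v))"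
  proof (intro sum_mono, clarify)
    fix a b u v assume m: "a \<in> A" "b \<in> A" "u \<in> A" "v \<in> A"
    have "of_bool (sdiff4 a b u v \<subseteq> (\<Union>w\<in>F. position_chars w))
        \<le> (of_bool (\<forall>i<c. even_outside (P i) (a ! i) (b ! i) (u ! i) (v ! i)) :: real)"
      using even[of a b u v] m AW by (auto simp: of_bool_def)
    then show "of_bool (sdiff4 a b u v \<subseteq> (\<Union>w\<in>F. position_chars w)) * (p a * p b * p u * p v)
      \<le> of_bool (\<forall>i<c. even_outside (P i) (a ! i) (b ! i) (u ! i) (v ! i)) * (f a * f b * f u * f v)"
      using m p_nonneg by (simp add: f_def mult_right_mono)
  qed
  also have "\<dots> \<le> (\<Sum>(a, b, u, v)\<in>?W \<times> ?W \<times> ?W \<times> ?W.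
      of_bool (\<forall>i<c. even_outside (P i) (a ! i) (b ! i) (u ! i) (v ! i)) * (f a * f b * f u * f v))"
    using AW by (intro sum_mono2) (auto simp: f_def p_nonneg)
  also have "\<dots> \<le> (3 * (1 + real (card F))\<^sup>2) ^ c * (L2_set f ?W * L2_set f ?W * L2_set f ?W * L2_set f ?W)"
    by (rule sum_words_even_outside_le) (use F in \<open>auto simp: P_def f_def p_nonneg intro: card_image_le\<close>)
  also have "L2_set f ?W * L2_set f ?W * L2_set f ?W * L2_set f ?W = (\<Sum>z\<in>?W. (f z)\<^sup>2)\<^sup>2"
  proof -
    have "0 \<le> (\<Sum>z\<in>?W. (f z)\<^sup>2)" by (intro sum_nonneg) auto
    then show ?thesis unfolding L2_set_def by (simp add: power2_eq_square mult.assoc)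
  qed
  also have "(\<Sum>z\<in>?W. (f z)\<^sup>2) = (\<Sum>z\<in>A. (p z)\<^sup>2)"
    using AW by (intro sum.mono_neutral_cong_right) (auto simp: f_def)
  also have "((\<Sum>z\<in>A. (p z)\<^sup>2))\<^sup>2 \<le> (sum p A)\<^sup>2"
  proof (intro power_mono sum_mono)
    show "(p z)\<^sup>2 \<le> p z" for z
      using mult_left_le[OF p_le_1 p_nonneg] by (simp add: power2_eq_square)
  qed (auto intro!: sum_nonneg)
  finally show ?thesis by (simp add: mult_left_mono)
qed

definition zero_degree :: "nat list set \<Rightarrow> nat list \<Rightarrow> real" where
  "zero_degree A x = (\<Sum>(a, u, v)\<in>A \<times> A \<times> A. of_bool (sdiff4 x a u v = {}) * (p a * p u * p v))"

text \<open>An averaging argument: if all keys of \<open>A\<close> exceeded the bound, weighting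
  them by \<open>p\<close> would contradict \<open>sum_quadruples_le\<close> without pinned keys,
  where the constant is \<open>3 ^ c\<close>. Keys with \<open>p x = 0\<close> are invisible to this
  average and are therefore excepted.\<close>

lemma exists_small_zero_degree:
  assumes A: "A \<subseteq> W" "A \<noteq> {}"
  shows "\<exists>x\<in>A. p x = 0 \<or> zero_degree A x \<le> 3 ^ c * sum p W"
proof (rule ccontr)
  assume neg: "\<not> ?thesis"
  have fA: "finite A" using A finite_W finite_subset by blast
  have le: "sum p A \<le> sum p W" using A by (intro sum_mono2) (auto simp: p_nonneg)
  have pos: "p x > 0" and big: "3 ^ c * sum p A < zero_degree A x" if "x \<in> A" for x
  proof -
    show "p x > 0" using neg that p_nonneg[of x] by (metis order_le_less)
    have "3 ^ c * sum p A \<le> 3 ^ c * sum p W" using le by simp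
    also have "\<dots> < zero_degree A x" using neg that by auto
    finally show "3 ^ c * sum p A < zero_degree A x" .
  qed
  have "3 ^ c * (sum p A)\<^sup>2 = (\<Sum>x\<in>A. p x * (3 ^ c * sum p A))"
    by (simp add: power2_eq_square mult_ac flip: sum_distrib_right)
  also have "\<dots> < (\<Sum>x\<in>A. p x * zero_degree A x)"
    using fA A(2) pos big by (intro sum_strict_mono) auto
  also have "\<dots> = (\<Sum>(a, b, u, v)\<in>A \<times> A \<times> A \<times> A.
      of_bool (sdiff4 a b u v \<subseteq> (\<Union>w\<in>{}. position_chars w)) * (p a * p b * p u * p v))"
    by (simp add: zero_degree_def sum_distrib_left sum.cartesian_product case_prod_beta mult_ac)
  also have "\<dots> \<le> (3 * (1 + real (card ({} :: nat list set)))\<^sup>2) ^ c * (sum p A)\<^sup>2"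
    by (rule sum_quadruples_le) (use A in auto)
  finally show False by simp
qed

end

text \<open>Repeatedly remove an element that is good for what remains. \<open>\<rho>\<close> is the
  time of removal, so the elements not before \<open>x\<close> form the set from which
  \<open>x\<close> was chosen.\<close>

lemma degeneracy_order:
  assumes "finite W" "\<And>A. A \<subseteq> W \<Longrightarrow> A \<noteq> {} \<Longrightarrow> \<exists>x\<in>A. P x A"
  shows "\<exists>\<rho> :: 'a \<Rightarrow> nat. \<forall>x\<in>W. P x {y \<in> W. \<rho> x \<le> \<rho> y}"
  using assms
proof (induction "card W" arbitrary: W)
  case 0
  then show ?case by simp
next
  case (Suc n)
  have "W \<noteq> {}" using Suc.hyps(2) by auto
  then obtain x where x: "x \<in> W" "P x W" using Suc.prems(2)[of W] by auto
  have "\<exists>\<rho> :: 'a \<Rightarrow> nat. \<forall>y\<in>W - {x}. P y {z \<in> W - {x}. \<rho> y \<le> \<rho> z}"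
  proof (rule Suc.hyps(1))
    show "n = card (W - {x})" using Suc.hyps(2) Suc.prems(1) x(1) by simp
  qed (use Suc.prems in auto)
  then obtain \<rho> :: "'a \<Rightarrow> nat" where \<rho>: "P y {z \<in> W - {x}. \<rho> y \<le> \<rho> z}" if "y \<in> W - {x}" for y by blast
  define \<rho>' where "\<rho>' y = (if y = x then 0 else Suc (\<rho> y))" for y
  have "P y {z \<in> W. \<rho>' y \<le> \<rho>' z}" if "y \<in> W" for y
  proof (cases "y = x")
    case True
    then show ?thesis using x(2) by (simp add: \<rho>'_def)
  next
    case False
    then have "{z \<in> W. \<rho>' y \<le> \<rho>' z} = {z \<in> W - {x}. \<rho> y \<le> \<rho> z}" by (auto simp: \<rho>'_def)
    then show ?thesis using \<rho>[of y] False that by simp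
  qed
  then show ?case by blast
qed

section \<open>Walks of collisions\<close>

text \<open>The keys that can be assembled from characters seen in \<open>S\<close>. Only
  polynomially many have length \<open>c\<close>, so a walk that enters this set pays with a number
  of choices instead of a selection probability.\<close>

definition char_closure :: "nat \<Rightarrow> nat list set \<Rightarrow> nat list set" where
  "char_closure c S = {z. \<forall>i<c. \<exists>w\<in>S. w ! i = z ! i}"

text \<open>A key outside the closure has a new position character, so its hash value is independent of those of \<open>S\<close>.\<close>

fun fresh :: "nat \<Rightarrow> nat list set \<Rightarrow> nat list list \<Rightarrow> bool" where
  "fresh c S [] \<longleftrightarrow> True"
| "fresh c S (z # zs) \<longleftrightarrow> z \<notin> char_closure c S \<and> fresh c (insert z S) zs"

text \<open>The walk alternates between the two positions of a pair, that is, between the sides of a bipartite graph.\<close>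

fun walk :: "nat \<Rightarrow> nat \<Rightarrow> nat list \<Rightarrow> nat list list \<Rightarrow> (nat \<times> nat list \<times> nat list) list" where
  "walk q q' x [] = []"
| "walk q q' x (z # zs) = (q, x, z) # walk q' q z zs"

lemma subset_char_closure: "S \<subseteq> char_closure c S"
  by (auto simp: char_closure_def)

lemma fresh_append: "fresh c S (ys @ zs) \<longleftrightarrow> fresh c S ys \<and> fresh c (S \<union> set ys) zs"
  by (induction ys arbitrary: S) auto

lemma fresh_distinct: "fresh c S zs \<Longrightarrow> distinct zs \<and> set zs \<inter> S = {}"
proof (induction zs arbitrary: S)
  case (Cons z zs)
  then show ?case using subset_char_closure[of S c] by auto
qed simp

lemma fresh_char:
  assumes "z \<notin> char_closure c S" "S \<subseteq> words \<sigma> c" "z \<in> words \<sigma> c"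
  obtains \<alpha> where "\<alpha> \<in> position_chars z" "\<And>w. w \<in> S \<Longrightarrow> \<alpha> \<notin> position_chars w"
proof -
  obtain i where "i < c" "\<And>w. w \<in> S \<Longrightarrow> w ! i \<noteq> z ! i"
    using assms(1) unfolding char_closure_def by blast
  moreover have "length z = c" using assms(3) by (rule length_words)
  ultimately show thesis by (intro that[of "(i, z ! i)"]) force+
qed

lemma length_walk [simp]: "length (walk q q' x zs) = length zs"
  by (induction zs arbitrary: q q' x) auto

lemma walk_keys:
  "(t, a, b) \<in> set (walk q q' x zs) \<Longrightarrow> t \<in> {q, q'} \<and> a \<in> insert x (set zs) \<and> b \<in> set zs"
  by (induction zs arbitrary: q q' x) auto

lemma nth_walk: "l < length zs \<Longrightarrow>
    walk q q' x zs ! l = (if even l then q else q', (x # zs) ! l, (x # zs) ! Suc l)"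
proof (induction zs arbitrary: q q' x l)
  case (Cons z zs)
  then show ?case by (cases l) auto
qed simp

lemma walk_snoc: "walk q q' x (zs @ [z]) =
    walk q q' x zs @ [(if even (length zs) then q else q', last (x # zs), z)]"
  by (induction zs arbitrary: q q' x) auto

text \<open>In a blocked set every key has a collision partner at either position. As long as the
  partner is fresh the walk moves on to it and the known part of the finite set \<open>A\<close>
  grows. Exchanging \<open>q\<close> and \<open>q'\<close> in the induction produces the
  alternation.\<close>

lemma exists_walk:
  assumes "blocked c d T A" "finite A" "S \<subseteq> A" "x \<in> S" "q < d" "q' < d"
  shows "\<exists>zs z. fresh c S zs \<and> set zs \<subseteq> A \<and> z \<in> A \<and> z \<in> char_closure c (S \<union> set zs) \<and>
    satisfies (walk q q' x (zs @ [z])) T \<and> z \<noteq> last (x # zs)"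
  using assms(3-6)
proof (induction "card (A - S)" arbitrary: S x q q' rule: less_induct)
  case less
  have "x \<in> A" using less.prems by blast
  then obtain z where z: "z \<in> A" "z \<noteq> x" "h1_char T q z = h1_char T q x"
    using assms(1) less.prems unfolding blocked_def by blast
  show ?case
  proof (cases "z \<in> char_closure c S")
    case True
    then show ?thesis using z by (intro exI[of _ "[]"] exI[of _ z]) (auto simp: satisfies_def)
  next
    case False
    then have zS: "z \<notin> S" using subset_char_closure by blast
    then have "card (A - insert z S) < card (A - S)"
      using z(1) assms(2) by (intro psubset_card_mono) auto
    from less.hyps[OF this, of z q' q] less.prems z(1)
    obtain zs y where ih: "fresh c (insert z S) zs" "set zs \<subseteq> A" "y \<in> A"
      "y \<in> char_closure c (insert z S \<union> set zs)" "satisfies (walk q' q z (zs @ [y])) T" "y \<noteq> last (z # zs)"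
      by blast
    show ?thesis
    proof (intro exI conjI)
      show "fresh c S (z # zs)" using ih(1) False by simp
      show "set (z # zs) \<subseteq> A" using ih(2) z(1) by simp
      show "y \<in> char_closure c (S \<union> set (z # zs))" using ih(4) by simp
      show "satisfies (walk q q' x ((z # zs) @ [y])) T" using ih(5) z(3) by (simp add: satisfies_Cons)
      show "y \<noteq> last (x # z # zs)" using ih(6) by simp
    qed (fact ih(3))
  qed
qed

text \<open>The step into a fresh key involves a character that no earlier known key has, so its
  constraint is outside the span of the earlier ones. The walk is reversed because the newest
  constraint stands first.\<close>

lemma gf2_indep_walk:
  assumes "fresh c S zs" "x \<in> S" "S \<subseteq> words \<sigma> c" "set zs \<subseteq> words \<sigma> c"
    and "gf2_indep (map constraint_set cs)" "\<forall>(t, u, v)\<in>set cs. u \<in> S \<and> v \<in> S"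
  shows "gf2_indep (map constraint_set (rev (walk q q' x zs) @ cs))"
  using assms
proof (induction zs arbitrary: S x q q' cs)
  case (Cons z zs)
  have zw: "z \<in> words \<sigma> c" using Cons.prems by simp
  obtain \<alpha> where \<alpha>: "\<alpha> \<in> position_chars z" "\<And>w. w \<in> S \<Longrightarrow> \<alpha> \<notin> position_chars w"
    using fresh_char[of z c S \<sigma>] Cons.prems by auto
  have "(q, \<alpha>) \<in> constraint_set (q, x, z)" using \<alpha> Cons.prems(2) by (cases \<alpha>) simp
  moreover have "(q, \<alpha>) \<notin> constraint_set (t, u, v)" if "(t, u, v) \<in> set cs" for t u v
  proof -
    have "u \<in> S" "v \<in> S" using Cons.prems(6) that by auto
    from \<alpha>(2)[OF this(1)] \<alpha>(2)[OF this(2)] show ?thesis by (cases \<alpha>) simp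
  qed
  then have "(q, \<alpha>) \<notin> \<Union> (set (map constraint_set cs))" by auto
  ultimately have "constraint_set (q, x, z) \<notin> gf2_span (map constraint_set cs)"
    using gf2_span_subset by blast
  then have 1: "gf2_indep (map constraint_set ((q, x, z) # cs))" using Cons.prems(5) by simp
  have "gf2_indep (map constraint_set (rev (walk q' q z zs) @ ((q, x, z) # cs)))"
    by (rule Cons.IH[of "insert z S" z "(q, x, z) # cs"]) (use Cons.prems 1 in auto)
  then show ?case by simp
qed simp

lemma odd_card_Int_singleton [simp]: "odd (card (A \<inter> {e})) \<longleftrightarrow> e \<in> A"
  by (cases "e \<in> A") auto

text \<open>A parity functional on the position characters of the known keys extends to the fresh keys with
  any prescribed values, in particular with a constant one.\<close>

lemma extend_functional:
  assumes "fresh c S zs" "x \<in> S" "S \<subseteq> words \<sigma> c" "set zs \<subseteq> words \<sigma> c"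
  shows "\<exists>D. (\<forall>w\<in>S. odd (card (position_chars w \<inter> D)) \<longleftrightarrow> odd (card (position_chars w \<inter> D0))) \<and>
    (\<forall>z\<in>set zs. odd (card (position_chars z \<inter> D)) \<longleftrightarrow> odd (card (position_chars x \<inter> D0)))"
  using assms
proof (induction zs arbitrary: S D0)
  case (Cons z zs)
  let ?l = "\<lambda>D w. odd (card (position_chars w \<inter> D))"
  have zw: "z \<in> words \<sigma> c" using Cons.prems by simp
  obtain \<alpha> where \<alpha>: "\<alpha> \<in> position_chars z" "\<And>w. w \<in> S \<Longrightarrow> \<alpha> \<notin> position_chars w"
    using fresh_char[of z c S \<sigma>] Cons.prems by auto
  define D1 where "D1 = (if ?l D0 z = ?l D0 x then D0 else sdiff D0 {\<alpha>})"
  have 1: "?l (sdiff D0 {\<alpha>}) w \<longleftrightarrow> ?l D0 w \<noteq> (\<alpha> \<in> position_chars w)" for w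
    using odd_card_Int_sdiff[of "position_chars w" D0 "{\<alpha>}"] odd_card_Int_singleton[of "position_chars w" \<alpha>]
    by simp
  have D1S: "?l D1 w = ?l D0 w" if "w \<in> S" for w
    using 1[of w] \<alpha>(2)[OF that] by (simp add: D1_def)
  have D1z: "?l D1 z = ?l D0 x"
    using 1[of z] \<alpha>(1) by (auto simp: D1_def)
  have fr: "fresh c (insert z S) zs" and sub: "insert z S \<subseteq> words \<sigma> c" "set zs \<subseteq> words \<sigma> c"
    using Cons.prems by auto
  obtain D where D: "\<forall>w\<in>insert z S. ?l D w = ?l D1 w" "\<forall>y\<in>set zs. ?l D y = ?l D1 x"
    using Cons.IH[of "insert z S" D1, OF fr _ sub] Cons.prems(2) by blast
  have "\<forall>w\<in>S. ?l D w = ?l D0 w" using D(1) D1S by blast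
  moreover have "\<forall>y\<in>set (z # zs). ?l D y = ?l D0 x"
    using D D1z D1S[OF Cons.prems(2)] by simp
  ultimately show ?case by (intro exI[of _ D] conjI)
next
  case Nil
  show ?case by (intro exI[of _ D0]) simp
qed

text \<open>Constraints at different derived positions are disjoint, so only walk steps at position
  \<open>t\<close> take part in the combination. Since positions alternate, these are the steps
  whose index has the parity of the closing step.\<close>

lemma walk_span_parity:
  assumes "constraint_set (t, u, v) \<in> gf2_span (map constraint_set (rev (walk q q' x zs) @ cs))"
    and "q \<noteq> q'" and "\<forall>(t', u', v')\<in>set cs. t' \<noteq> t"
    and t: "t = (if even (length zs) then q else q')"
  shows "\<exists>L. (\<forall>l\<in>L. Suc l < length zs \<and> (even l \<longleftrightarrow> even (length zs))) \<and>
    (\<forall>\<alpha>. (\<alpha> \<in> position_chars u) \<noteq> (\<alpha> \<in> position_chars v) \<longleftrightarrow>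
      odd (card {l \<in> L. (\<alpha> \<in> position_chars ((x # zs) ! l)) \<noteq> (\<alpha> \<in> position_chars ((x # zs) ! Suc l))}))"
proof -
  let ?m = "length zs"
  let ?g = "\<lambda>l. constraint_set (if even l then q else q', (x # zs) ! l, (x # zs) ! Suc l)"
  have "walk q q' x zs = map (\<lambda>l. (if even l then q else q', (x # zs) ! l, (x # zs) ! Suc l)) [0..<?m]"
    by (rule nth_equalityI) (auto simp: nth_walk)
  then have "map constraint_set (rev (walk q q' x zs)) = map ?g (rev [0..<?m])"
    by (simp add: rev_map comp_def)
  then have "constraint_set (t, u, v) \<in> gf2_span (map ?g (rev [0..<?m]) @ map constraint_set cs)"
    using assms(1) by simp
  then obtain B C where B: "B \<in> gf2_span (map ?g (rev [0..<?m]))"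
    and C: "C \<in> gf2_span (map constraint_set cs)" and eq: "constraint_set (t, u, v) = sdiff B C"
    using gf2_span_append by blast
  obtain L where L: "L \<subseteq> set (rev [0..<?m])" "\<And>e. e \<in> B \<longleftrightarrow> odd (card {l \<in> L. e \<in> ?g l})"
    using gf2_span_parity[OF B] by auto
  have notC: "(t, \<alpha>) \<notin> C" for \<alpha>
  proof
    assume "(t, \<alpha>) \<in> C"
    then obtain y where "y \<in> set cs" "(t, \<alpha>) \<in> constraint_set y" using gf2_span_subset[OF C] by auto
    then show False using assms(3) by (cases y) (auto simp: constraint_set_def)
  qed
  define L' where "L' = {l \<in> L. even l \<longleftrightarrow> even ?m}"
  have parity: "(\<alpha> \<in> position_chars u) \<noteq> (\<alpha> \<in> position_chars v) \<longleftrightarrow>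
      odd (card {l \<in> L'. (\<alpha> \<in> position_chars ((x # zs) ! l)) \<noteq> (\<alpha> \<in> position_chars ((x # zs) ! Suc l))})" for \<alpha>
  proof -
    have "(\<alpha> \<in> position_chars u) \<noteq> (\<alpha> \<in> position_chars v) \<longleftrightarrow> (t, \<alpha>) \<in> constraint_set (t, u, v)"
      by (cases \<alpha>) simp
    also have "\<dots> \<longleftrightarrow> (t, \<alpha>) \<in> B" unfolding eq using notC by simp
    also have "\<dots> \<longleftrightarrow> odd (card {l \<in> L. (t, \<alpha>) \<in> ?g l})" by (rule L(2))
    also have "{l \<in> L. (t, \<alpha>) \<in> ?g l} =
        {l \<in> L'. (\<alpha> \<in> position_chars ((x # zs) ! l)) \<noteq> (\<alpha> \<in> position_chars ((x # zs) ! Suc l))}"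
    proof (rule Collect_cong)
      fix l
      let ?P = "(\<alpha> \<in> position_chars ((x # zs) ! l)) \<noteq> (\<alpha> \<in> position_chars ((x # zs) ! Suc l))"
      have tag: "t = (if even l then q else q') \<longleftrightarrow> (even l \<longleftrightarrow> even ?m)"
        using assms(2) t by auto
      have "(t, \<alpha>) \<in> ?g l \<longleftrightarrow> t = (if even l then q else q') \<and> ?P"
        by (cases \<alpha>) (simp only: in_constraint_set)
      then show "l \<in> L \<and> (t, \<alpha>) \<in> ?g l \<longleftrightarrow> l \<in> L' \<and> ?P"
        unfolding tag L'_def mem_Collect_eq by (rule ssubst) (rule conj_assoc[symmetric])
    qed
    finally show ?thesis .
  qed
  \<comment> \<open>The last step of the walk has the other parity, so every step in the combination
    ends before the last key.\<close>
  have range: "Suc l < ?m \<and> (even l \<longleftrightarrow> even ?m)" if "l \<in> L'" for l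
  proof -
    have "l < ?m" "even l \<longleftrightarrow> even ?m" using that L(1) by (auto simp: L'_def)
    moreover from this(2) have "Suc l \<noteq> ?m" by (metis even_Suc)
    ultimately show ?thesis by simp
  qed
  show ?thesis
  proof (intro exI conjI)
    show "\<forall>l\<in>L'. Suc l < ?m \<and> (even l \<longleftrightarrow> even ?m)" using range by blast
  qed (intro allI parity)
qed

text \<open>If the closing collision follows from the earlier ones, the position characters of the last two keys and of
  some earlier pairs of consecutive keys cancel.  Either the only such pair starts at \<open>x\<close>, or one of these pairs
  and the last two keys cancel up to characters of other known keys.\<close>

lemma dependent_walk:
  assumes fr: "fresh c S zs" and x: "x \<in> S" and W: "S \<subseteq> words \<sigma> c" "set zs \<subseteq> words \<sigma> c" "z \<in> words \<sigma> c"
    and z: "z \<noteq> last (x # zs)"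
    and span: "constraint_set (if even (length zs) then q else q', last (x # zs), z)
      \<in> gf2_span (map constraint_set (rev (walk q q' x zs) @ cs))"
    and q: "q \<noteq> q'" and cs: "\<forall>(t, u, v)\<in>set cs. t \<noteq> q \<and> t \<noteq> q'"
  shows "z \<notin> S \<union> set zs \<and>
    ((\<exists>a ys u. zs = a # ys @ [u] \<and> sdiff4 x a u z = {}) \<or>
     (\<exists>ys1 a b ys2 u. zs = ys1 @ [a, b] @ ys2 @ [u] \<and>
        sdiff4 a b u z \<subseteq> (\<Union>w\<in>S \<union> set ys1 \<union> set ys2. position_chars w)))"
proof -
  let ?m = "length zs"
  let ?w = "x # zs"
  let ?g = "\<lambda>l \<alpha>. (\<alpha> \<in> position_chars (?w ! l)) \<noteq> (\<alpha> \<in> position_chars (?w ! Suc l))"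
  define u where "u = last ?w"
  have xW: "x \<in> words \<sigma> c" using x W by blast
  have "\<forall>(t', u', v')\<in>set cs. t' \<noteq> (if even ?m then q else q')" using cs by auto
  from walk_span_parity[OF span q this refl]
  obtain L where L: "\<And>l. l \<in> L \<Longrightarrow> Suc l < ?m \<and> (even l \<longleftrightarrow> even ?m)"
    and par: "\<And>\<alpha>. (\<alpha> \<in> position_chars u) \<noteq> (\<alpha> \<in> position_chars z) \<longleftrightarrow> odd (card {l \<in> L. ?g l \<alpha>})"
    unfolding u_def by blast
  have uW: "u \<in> words \<sigma> c" using W xW unfolding u_def by (metis last_ConsL last_ConsR last_in_set subsetD)
  \<comment> \<open>With nothing to combine, \<open>u\<close> and \<open>z\<close> would have the
    same position characters and be equal.\<close>
  have ne: "L \<noteq> {}"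
  proof
    assume "L = {}"
    then have "position_chars u = position_chars z" using par by auto
    then show False using position_chars_inj uW W(3) z by (metis length_words u_def)
  qed
  then have m2: "2 \<le> ?m" using L by fastforce
  then have zs: "butlast zs @ [u] = zs" unfolding u_def by auto
  have nth_butlast': "?w ! j \<in> insert x (set (butlast zs))" if "j < ?m" for j
  proof (cases j)
    case (Suc i)
    then have i: "i < length (butlast zs)" using that by simp
    have "?w ! j = butlast zs ! i" using Suc i by (simp add: nth_butlast)
    then show ?thesis using nth_mem[OF i] by simp
  qed simp
  \<comment> \<open>The fresh key \<open>u\<close> has a character that no earlier key has, and all
    steps in \<open>L\<close> end before \<open>u\<close>. If \<open>z\<close> were an earlier key,
    nothing could cancel this character.\<close>
  have "z \<notin> S \<union> set (butlast zs)"
  proof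
    assume zin: "z \<in> S \<union> set (butlast zs)"
    have "fresh c S (butlast zs @ [u])" using fr zs by simp
    then have u: "u \<notin> char_closure c (S \<union> set (butlast zs))" by (simp add: fresh_append)
    have sub: "S \<union> set (butlast zs) \<subseteq> words \<sigma> c" using W by (auto dest: in_set_butlastD)
    obtain \<alpha> where \<alpha>: "\<alpha> \<in> position_chars u" "\<And>w. w \<in> S \<union> set (butlast zs) \<Longrightarrow> \<alpha> \<notin> position_chars w"
      using fresh_char[OF u sub uW] by blast
    have "(\<alpha> \<in> position_chars u) \<noteq> (\<alpha> \<in> position_chars z)" using \<alpha>(1) \<alpha>(2)[OF zin] by simp
    from iffD1[OF par this] have "odd (card {l \<in> L. ?g l \<alpha>})" .
    then have "{l \<in> L. ?g l \<alpha>} \<noteq> {}" by (metis card.empty even_zero)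
    then obtain l where "l \<in> L" "?g l \<alpha>" by blast
    have lm: "l < ?m" "Suc l < ?m" using L[OF \<open>l \<in> L\<close>] by auto
    have "?w ! l \<in> S \<union> set (butlast zs)" "?w ! Suc l \<in> S \<union> set (butlast zs)"
      using nth_butlast'[OF lm(1)] nth_butlast'[OF lm(2)] x by auto
    then show False using \<alpha>(2) \<open>?g l \<alpha>\<close> by blast
  qed
  moreover have "z \<noteq> u" using z by (simp add: u_def)
  ultimately have znew: "z \<notin> S \<union> set zs"
  proof -
    have "set zs = insert u (set (butlast zs))" using arg_cong[OF zs, of set] by simp
    with \<open>z \<notin> S \<union> set (butlast zs)\<close> \<open>z \<noteq> u\<close> show ?thesis by simp
  qed
  show ?thesis
  proof (cases "\<exists>l\<in>L. l \<ge> 1")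
    case True
    then obtain l0 where "l0 \<in> L" "l0 \<ge> 1" by blast
    \<comment> \<open>The list of walk keys starts with \<open>x\<close>, so step
      \<open>Suc k\<close> joins \<open>zs ! k\<close> to \<open>zs ! Suc k\<close>.\<close>
    then obtain k where k: "Suc k \<in> L" by (cases l0) auto
    have k2: "Suc (Suc k) < ?m" "even (Suc k) \<longleftrightarrow> even ?m" using L[OF k] by auto
    define ys1 a b ys2 where "ys1 = take k zs" and "a = zs ! k" and "b = zs ! Suc k"
      and "ys2 = drop (Suc (Suc k)) (butlast zs)"
    have "butlast zs = take k (butlast zs) @ butlast zs ! k # butlast zs ! Suc k # drop (Suc (Suc k)) (butlast zs)"
      using k2 by (simp add: Cons_nth_drop_Suc)
    moreover have "take k (butlast zs) = ys1" using k2 by (simp add: take_butlast ys1_def)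
    moreover have "butlast zs ! k = a" "butlast zs ! Suc k = b" using k2 by (simp_all add: nth_butlast a_def b_def)
    ultimately have bl: "butlast zs = ys1 @ a # b # ys2" unfolding ys2_def by simp
    have zs_eq: "zs = ys1 @ [a, b] @ ys2 @ [u]" using zs unfolding bl by simp
    have "sdiff4 a b u z \<subseteq> (\<Union>w\<in>S \<union> set ys1 \<union> set ys2. position_chars w)"
    proof
      fix \<alpha> assume "\<alpha> \<in> sdiff4 a b u z"
      then have mem: "((\<alpha> \<in> position_chars a) \<noteq> (\<alpha> \<in> position_chars b)) \<noteq>
          ((\<alpha> \<in> position_chars u) \<noteq> (\<alpha> \<in> position_chars z))"
        unfolding sdiff4_def in_sdiff .
      define G where "G l \<longleftrightarrow> ?g l \<alpha>" for l
      have Gk: "G (Suc k) \<longleftrightarrow> (\<alpha> \<in> position_chars a) \<noteq> (\<alpha> \<in> position_chars b)"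
        by (simp add: G_def a_def b_def)
      have parG: "(\<alpha> \<in> position_chars u) \<noteq> (\<alpha> \<in> position_chars z) \<longleftrightarrow> odd (card {l \<in> L. G l})"
        using par[of \<alpha>] unfolding G_def .
      have "\<exists>l\<in>L - {Suc k}. G l"
      proof (rule ccontr)
        assume "\<not> ?thesis"
        then have "{l \<in> L. G l} = (if G (Suc k) then {Suc k} else {})" using k by auto
        then have "odd (card {l \<in> L. G l}) \<longleftrightarrow> G (Suc k)" by simp
        moreover have "G (Suc k) \<noteq> odd (card {l \<in> L. G l})" using mem unfolding Gk parG .
        ultimately show False by simp
      qed
      then have "\<exists>l\<in>L - {Suc k}. ?g l \<alpha>" unfolding G_def .
      then obtain l where l: "l \<in> L" "l \<noteq> Suc k" "?g l \<alpha>" by blast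
      have l2: "Suc l < ?m" "even l \<longleftrightarrow> even (Suc k)" using L[OF l(1)] k2 by auto
      have other: "?w ! j \<in> S \<union> set ys1 \<union> set ys2" if j: "j < ?m" "j \<noteq> Suc k" "j \<noteq> Suc (Suc k)" for j
      proof (cases j)
        case (Suc i)
        have i: "i < length (butlast zs)" "i \<noteq> k" "i \<noteq> Suc k" using j Suc by auto
        have wi: "?w ! j = butlast zs ! i" using Suc i(1) by (simp add: nth_butlast)
        have len: "length ys1 = k" using k2 by (simp add: ys1_def)
        show ?thesis
        proof (cases "i < k")
          case True
          then have "butlast zs ! i = ys1 ! i" unfolding bl by (simp add: nth_append len)
          moreover have "ys1 ! i \<in> set ys1" using True len by simp
          ultimately show ?thesis using wi by simp
        next
          case False
          then obtain e where e: "i = Suc (Suc (k + e))" using i(2,3)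
            by (intro that[of "i - Suc (Suc k)"]) simp
          then have "butlast zs ! i = ys2 ! e" unfolding bl by (simp add: nth_append len)
          moreover have "e < length ys2" using i(1) e unfolding bl by (simp add: len)
          then have "ys2 ! e \<in> set ys2" by simp
          ultimately show ?thesis using wi by simp
        qed
      qed (use x in simp)
      \<comment> \<open>Indices in \<open>L\<close> have equal parity, so the steps are disjoint
        pairs of places in the walk. Another step that contains the character therefore avoids the
        places of \<open>a\<close> and \<open>b\<close>.\<close>
      have "l \<noteq> Suc (Suc k)" "Suc l \<noteq> Suc k" "Suc l \<noteq> Suc (Suc k)" using l2(2) l(2) by auto
      then have "?w ! l \<in> S \<union> set ys1 \<union> set ys2" "?w ! Suc l \<in> S \<union> set ys1 \<union> set ys2"
        using other[of l] other[of "Suc l"] l2(1) l(2) by auto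
      then show "\<alpha> \<in> (\<Union>w\<in>S \<union> set ys1 \<union> set ys2. position_chars w)" using l(3) by blast
    qed
    then show ?thesis using znew zs_eq by blast
  next
    case False
    have "l = 0" if "l \<in> L" for l using False that by (cases l) auto
    then have L0: "L = {0}" using ne by blast
    have eq: "(\<alpha> \<in> position_chars u) \<noteq> (\<alpha> \<in> position_chars z) \<longleftrightarrow> ?g 0 \<alpha>" for \<alpha>
    proof -
      define G where "G l \<longleftrightarrow> ?g l \<alpha>" for l
      have "{l \<in> {0}. G l} = (if G 0 then {0} else {})" by auto
      then have "odd (card {l \<in> {0}. G l}) \<longleftrightarrow> G 0" by simp
      with par[of \<alpha>] show ?thesis unfolding L0 G_def by (rule trans)
    qed
    obtain a ys where bl: "butlast zs = a # ys" 
    proof (cases "butlast zs")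
      case Nil
      then have "length (butlast zs) = 0" by simp
      then show ?thesis using m2 by simp
    qed
    have zs_eq: "zs = a # ys @ [u]" using zs unfolding bl by simp
    have "?w ! Suc 0 = a" by (simp add: zs_eq)
    then have "\<alpha> \<notin> sdiff4 x a u z" for \<alpha> using eq[of \<alpha>] by (simp add: sdiff4_def)
    then have "sdiff4 x a u z = {}" by blast
    then show ?thesis using znew zs_eq by blast
  qed
qed

text \<open>Here the functional is constant along the walk but separates two known keys.\<close>

lemma span_misses_known_key:
  assumes fr: "fresh c S zs" and x: "x \<in> S" "y \<in> S" "y \<noteq> x"
    and W: "S \<subseteq> words \<sigma> c" "set zs \<subseteq> words \<sigma> c"
    and cs: "\<forall>(t', u, v)\<in>set cs. t' \<noteq> t"
    and y': "y' \<in> S \<union> set zs \<union> {z}" "y' \<noteq> y"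
    and span: "constraint_set (t, y, y') \<in> gf2_span (map constraint_set (rev (walk q q' x zs) @ cs))"
      "constraint_set (t, last (x # zs), z) \<in> gf2_span (map constraint_set (rev (walk q q' x zs) @ cs))"
  shows False
proof -
  let ?l = "\<lambda>D w. odd (card (position_chars w \<inter> D))"
  \<comment> \<open>The functional will be constant along the walk, and the second span hypothesis
    extends this to \<open>z\<close>. If \<open>y'\<close> is not in \<open>S\<close>, its value is
    therefore the one at \<open>x\<close>.\<close>
  define y0 where "y0 = (if y' \<in> S then y' else x)"
  have y0: "y0 \<in> S" "y0 \<noteq> y" using x y' by (auto simp: y0_def)
  have "position_chars y \<noteq> position_chars y0"
    using position_chars_inj[of y y0] y0 x W by (metis length_words subsetD)
  then obtain e where e: "(e \<in> position_chars y) \<noteq> (e \<in> position_chars y0)" by blast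
  have l0: "?l {e} w \<longleftrightarrow> e \<in> position_chars w" for w
    by (rule odd_card_Int_singleton)
  obtain D where D: "\<And>w. w \<in> S \<Longrightarrow> ?l D w = ?l {e} w" "\<And>w. w \<in> set zs \<Longrightarrow> ?l D w = ?l {e} x"
    using extend_functional[OF fr x(1) W, of "{e}"] by blast
  have walkl: "?l D w = ?l {e} x" if "w \<in> insert x (set zs)" for w
    using that D x(1) by auto
  \<comment> \<open>Supported on position \<open>t\<close> alone, this vector is even on the
    constraints at all other positions, in particular on those of \<open>cs\<close>.\<close>
  let ?D = "{t} \<times> D"
  have even: "even (card (B \<inter> ?D))" if "B \<in> set (map constraint_set (rev (walk q q' x zs) @ cs))" for B
  proof -
    from that have "B \<in> constraint_set ` (set (walk q q' x zs) \<union> set cs)"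
      unfolding set_map set_append set_rev .
    then obtain y where y: "B = constraint_set y" "y \<in> set (walk q q' x zs) \<union> set cs" by (rule imageE)
    obtain t' u v where "y = (t', u, v)" by (cases y)
    with y have tuv: "B = constraint_set (t', u, v)" "(t', u, v) \<in> set (walk q q' x zs) \<union> set cs" by auto
    show ?thesis
    proof (cases "t' = t")
      case True
      then have "(t', u, v) \<in> set (walk q q' x zs)" using tuv(2) cs by auto
      then have "u \<in> insert x (set zs)" "v \<in> insert x (set zs)" using walk_keys by blast+
      then have "?l D u = ?l D v" using walkl by blast
      then show ?thesis using odd_card_constraint_set[of t u v ?D] tuv(1) True by simp
    next
      case False
      then show ?thesis using odd_card_constraint_set[of t' u v ?D] tuv(1) by simp
    qed
  qed
  have eq: "?l D u = ?l D v"
    if "constraint_set (t, u, v) \<in> gf2_span (map constraint_set (rev (walk q q' x zs) @ cs))" for u v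
  proof -
    have fin: "\<forall>B\<in>set (map constraint_set (rev (walk q q' x zs) @ cs)). finite B" by auto
    have "even (card (constraint_set (t, u, v) \<inter> ?D))" using gf2_span_even[OF that fin] even by blast
    then show ?thesis using odd_card_constraint_set[of t u v ?D] by simp
  qed
  have "last (x # zs) \<in> insert x (set zs)" by (metis last_in_set list.discI list.set(2))
  then have "?l D z = ?l {e} x" using eq[OF span(2)] walkl by metis
  then have "?l D y' = ?l {e} y0" using y' D walkl unfolding y0_def by auto
  moreover have "?l D y = ?l {e} y" using D x by blast
  ultimately show False using eq[OF span(1)] e l0 by metis
qed

text \<open>The alternatives differ in what saves the factor: a collision independent of those used,
  a last key completing a quadruple with cancelling characters, or the exhaustion of
  \<open>A\<close>. In the last case a second known key would also have a collision partner among
  the found keys; that collision would be dependent as well, which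
  \<open>span_misses_known_key\<close> excludes. This forces \<open>S = {x}\<close>.\<close>

lemma walk_outcome:
  assumes A: "blocked c d T A" "finite A" "A \<subseteq> words \<sigma> c"
    and S: "S \<subseteq> A" "x \<in> S" and q: "q < d" "q' < d" "q \<noteq> q'"
    and cs: "\<forall>(t, u, v)\<in>set cs. t \<noteq> q \<and> t \<noteq> q'"
  obtains zs z where "fresh c S zs" "set zs \<subseteq> A" "z \<in> A" "z \<in> char_closure c (S \<union> set zs)"
    "satisfies (walk q q' x zs) T"
    "(\<exists>t\<in>{q, q'}. \<exists>u\<in>S \<union> set zs \<union> {z}. \<exists>v\<in>S \<union> set zs \<union> {z}. h1_char T t u = h1_char T t v \<and>
        constraint_set (t, u, v) \<notin> gf2_span (map constraint_set (rev (walk q q' x zs) @ cs))) \<or>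
     (z \<notin> S \<union> set zs \<and> A \<noteq> S \<union> set zs \<union> {z} \<and>
        ((\<exists>a ys u. zs = a # ys @ [u] \<and> sdiff4 x a u z = {}) \<or>
         (\<exists>ys1 a b ys2 u. zs = ys1 @ [a, b] @ ys2 @ [u] \<and>
            sdiff4 a b u z \<subseteq> (\<Union>w\<in>S \<union> set ys1 \<union> set ys2. position_chars w)))) \<or>
     (A = S \<union> set zs \<union> {z} \<and> S = {x})"
proof -
  from exists_walk[OF A(1,2) S q(1,2)]
  obtain zs z where w: "fresh c S zs" "set zs \<subseteq> A" "z \<in> A" "z \<in> char_closure c (S \<union> set zs)"
    "satisfies (walk q q' x (zs @ [z])) T" "z \<noteq> last (x # zs)" by blast
  let ?sp = "gf2_span (map constraint_set (rev (walk q q' x zs) @ cs))"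
  let ?t = "if even (length zs) then q else q'"
  have sat: "satisfies (walk q q' x zs) T" "h1_char T ?t (last (x # zs)) = h1_char T ?t z"
    using w(5) unfolding walk_snoc satisfies_append by (auto simp: satisfies_Cons)
  have last: "last (x # zs) \<in> S \<union> set zs" using S(2) by (metis UnCI last_ConsL last_ConsR last_in_set)
  have Sw: "S \<subseteq> words \<sigma> c" "set zs \<subseteq> words \<sigma> c" "z \<in> words \<sigma> c" using S w A by auto
  show thesis
  proof (rule that[OF w(1-4) sat(1)])
    let ?dep = "(\<exists>a ys u. zs = a # ys @ [u] \<and> sdiff4 x a u z = {}) \<or>
         (\<exists>ys1 a b ys2 u. zs = ys1 @ [a, b] @ ys2 @ [u] \<and>
            sdiff4 a b u z \<subseteq> (\<Union>w\<in>S \<union> set ys1 \<union> set ys2. position_chars w))"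
    let ?gain = "\<exists>t\<in>{q, q'}. \<exists>u\<in>S \<union> set zs \<union> {z}. \<exists>v\<in>S \<union> set zs \<union> {z}. h1_char T t u = h1_char T t v \<and>
        constraint_set (t, u, v) \<notin> ?sp"
    show "?gain \<or> (z \<notin> S \<union> set zs \<and> A \<noteq> S \<union> set zs \<union> {z} \<and> ?dep) \<or> (A = S \<union> set zs \<union> {z} \<and> S = {x})"
    proof (cases ?gain)
      case False
      then have implied: "constraint_set (?t, u, v) \<in> ?sp"
        if "u \<in> S \<union> set zs \<union> {z}" "v \<in> S \<union> set zs \<union> {z}" "h1_char T ?t u = h1_char T ?t v" for u v
        using that by auto
      have close: "constraint_set (?t, last (x # zs), z) \<in> ?sp"
        using last sat(2) by (intro implied) auto
      have dep: "z \<notin> S \<union> set zs \<and> ?dep"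
        by (rule dependent_walk[OF w(1) S(2) Sw w(6) close q(3) cs])
      show ?thesis
      proof (cases "A = S \<union> set zs \<union> {z}")
        case True
        have "S = {x}"
        proof (rule ccontr)
          assume "S \<noteq> {x}"
          then obtain y where y: "y \<in> S" "y \<noteq> x" using S(2) by blast
          have "?t < d" using q by simp
          moreover have "y \<in> A" using y S by blast
          ultimately obtain y' where y': "y' \<in> A" "y' \<noteq> y" "h1_char T ?t y' = h1_char T ?t y"
            using A(1) unfolding blocked_def by blast
          have "constraint_set (?t, y, y') \<in> ?sp"
            using y y' True by (intro implied) auto
          moreover have "\<forall>(t', u, v)\<in>set cs. t' \<noteq> ?t" using cs by auto
          moreover have "y' \<in> S \<union> set zs \<union> {z}" using y'(1) True by blast
          ultimately show False
            using span_misses_known_key[OF w(1) S(2) y Sw(1,2) _ _ y'(2) _ close] by blast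
        qed
        then show ?thesis using True by blast
      qed (use dep in blast)
    qed blast
  qed
qed

section \<open>Exploring a minimal obstruction\<close>

text \<open>A key of the closure is determined by naming, for each of the \<open>c\<close>
  positions, a list entry that supplies its character.\<close>

lemma card_char_closure_le: "card {z \<in> words \<sigma> c. z \<in> char_closure c (set L)} \<le> length L ^ c"
proof -
  let ?I = "{is. set is \<subseteq> {..<length L} \<and> length is = c}"
  let ?f = "\<lambda>is. map (\<lambda>i. (L ! (is ! i)) ! i) [0..<c]"
  have "{z \<in> words \<sigma> c. z \<in> char_closure c (set L)} \<subseteq> ?f ` ?I"
  proof
    fix z assume z: "z \<in> {z \<in> words \<sigma> c. z \<in> char_closure c (set L)}"
    have "\<exists>j<length L. (L ! j) ! i = z ! i" if ic: "i < c" for i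
    proof -
      obtain w where "w \<in> set L" "w ! i = z ! i" using z ic unfolding char_closure_def by blast
      then show ?thesis by (metis in_set_conv_nth)
    qed
    then obtain j where j: "\<And>i. i < c \<Longrightarrow> j i < length L \<and> (L ! j i) ! i = z ! i" by metis
    have "z = ?f (map j [0..<c])"
      using z j by (intro nth_equalityI) (auto simp: length_words)
    moreover have "map j [0..<c] \<in> ?I" using j by auto
    ultimately show "z \<in> ?f ` ?I" by blast
  qed
  then have "card {z \<in> words \<sigma> c. z \<in> char_closure c (set L)} \<le> card (?f ` ?I)"
    by (intro card_mono finite_imageI finite_lists_length_eq) auto
  also have "\<dots> \<le> card ?I" by (intro card_image_le finite_lists_length_eq) auto
  also have "\<dots> = length L ^ c" by (simp add: card_lists_length_eq)
  finally show ?thesis .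
qed

text \<open>The last fresh key has a character that neither \<open>S\<close> nor the earlier walk
  contains. In a blocked set this character is shared, so \<open>A\<close> has yet another key.
  Hence charging all fresh keys leaves the charged set proper.\<close>

lemma fresh_psubset:
  assumes "blocked c d T A" "fresh c S zs" "K \<subset> A" "K \<subseteq> S" "set zs \<subseteq> A"
  shows "set zs \<union> K \<subset> A"
proof (cases zs rule: rev_cases)
  case Nil
  then show ?thesis using assms(3) by simp
next
  case (snoc ys u)
  have u: "u \<notin> char_closure c (S \<union> set ys)" using assms(2) unfolding snoc fresh_append by simp
  have "set zs \<union> K \<noteq> A"
  proof
    assume eq: "set zs \<union> K = A"
    have "u \<in> A" using assms(5) snoc by simp
    have "u \<in> char_closure c (S \<union> set ys)"
      unfolding char_closure_def
    proof (intro CollectI allI impI)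
      fix i assume "i < c"
      then obtain w where "w \<in> A" "w \<noteq> u" "w ! i = u ! i"
        using assms(1) \<open>u \<in> A\<close> unfolding blocked_def by blast
      moreover from this(1,2) have "w \<in> S \<union> set ys" using eq snoc assms(4) by auto
      ultimately show "\<exists>w\<in>S \<union> set ys. w ! i = u ! i" by blast
    qed
    then show False using u by blast
  qed
  then show ?thesis using assms(3,5) by blast
qed

definition lists_of :: "'a set \<Rightarrow> nat \<Rightarrow> 'a list set" where
  "lists_of W m = {zs. set zs \<subseteq> W \<and> length zs = m}"

lemma finite_lists_of [simp]: "finite W \<Longrightarrow> finite (lists_of W m)"
  unfolding lists_of_def by (rule finite_lists_length_eq)

lemma sum_lists_of:
  fixes p :: "'a \<Rightarrow> real"
  assumes "finite W"
  shows "(\<Sum>zs\<in>lists_of W m. prod_list (map p zs)) = sum p W ^ m"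
proof (induction m)
  case 0
  have "lists_of W 0 = {[]}" by (auto simp: lists_of_def)
  then show ?case by simp
next
  case (Suc m)
  have "lists_of W (Suc m) = (\<lambda>(z, zs). z # zs) ` (W \<times> lists_of W m)"
  proof (intro equalityI subsetI)
    fix ys assume "ys \<in> lists_of W (Suc m)"
    then show "ys \<in> (\<lambda>(z, zs). z # zs) ` (W \<times> lists_of W m)"
      by (cases ys) (auto simp: lists_of_def)
  qed (auto simp: lists_of_def)
  then have "(\<Sum>zs\<in>lists_of W (Suc m). prod_list (map p zs)) =
      (\<Sum>(z, zs)\<in>W \<times> lists_of W m. p z * prod_list (map p zs))"
    by (simp add: sum.reindex inj_on_def case_prod_beta)
  also have "\<dots> = sum p W * (\<Sum>zs\<in>lists_of W m. prod_list (map p zs))"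
    by (simp add: sum.cartesian_product[symmetric] sum_product)
  finally show ?case using Suc by simp
qed

context mixed_tabulation
begin

definition min_blocked :: "(nat \<times> nat \<Rightarrow> nat list) \<Rightarrow> nat list set \<Rightarrow> bool" where
  "min_blocked T A \<longleftrightarrow> blocked c d T A \<and> (\<forall>A'. A' \<subset> A \<longrightarrow> \<not> blocked c d T A')"

lemma Pr_UN_le: "finite I \<Longrightarrow> Pr (\<Union>i\<in>I. F i) \<le> (\<Sum>i\<in>I. Pr (F i))"
  by (rule measure_pmf.finite_measure_subadditive_finite) auto

lemma Pr_mono: "E \<subseteq> F \<Longrightarrow> Pr E \<le> Pr F"
  by (rule measure_pmf.finite_measure_mono) auto

lemma Pr_Un_le: "Pr (E \<union> F) \<le> Pr E + Pr F"
  by (rule measure_Un_le) auto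

lemma Pr_UN_const:
  assumes "finite I" "card I \<le> k" "\<And>i. i \<in> I \<Longrightarrow> Pr (F i) \<le> b" "0 \<le> b"
  shows "Pr (\<Union>i\<in>I. F i) \<le> real k * b"
proof -
  have "Pr (\<Union>i\<in>I. F i) \<le> (\<Sum>i\<in>I. b)"
    using Pr_UN_le[OF assms(1)] sum_mono[OF assms(3)] by (rule order.trans)
  also have "\<dots> = real (card I) * b" by simp
  also have "\<dots> \<le> real k * b" using assms(2,4) by (intro mult_right_mono) auto
  finally show ?thesis .
qed

end

text \<open>\<open>B\<close> will be the set of keys that do not precede the root \<open>x\<close>
  in the degeneracy order. The degree of \<open>x\<close> is controlled only within
  \<open>B\<close>, so obstructions are sought there.\<close>

locale rooted_tabulation = mixed_tabulation +
  fixes \<theta> :: real and x :: "nat list" and B :: "nat list set"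
  assumes \<theta>: "0 < \<theta>" "\<theta> < 1" and mean: "sum p W \<le> \<theta> * real \<sigma>"
    and B_W: "B \<subseteq> W" and x_B: "x \<in> B" and degree: "zero_degree B x \<le> 3 ^ c * sum p W"
begin

text \<open>The keys of \<open>S\<close> have been found in the obstruction \<open>A\<close>; \<open>K\<close> collects those that are charged with
  their selection probability, and \<open>cs\<close> the collisions that have been found.\<close>

definition explored :: "nat list list \<Rightarrow> nat list list \<Rightarrow> (nat \<times> nat list \<times> nat list) list \<Rightarrow> mixed_tables set" where
  "explored S K cs = {T. satisfies cs (fst T) \<and>
     (\<exists>A. min_blocked (fst T) A \<and> A \<subseteq> Y T \<and> A \<subseteq> B \<and> set S \<subseteq> A \<and> set K \<subset> A)}"

text \<open>The constraints in \<open>cs\<close> use positions below \<open>2 * i\<close> and leave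
  the \<open>i\<close>-th pair to the next walk. They mention only keys of \<open>S\<close>, so the
  new character of a fresh key is new to them as well.\<close>

definition state :: "nat \<Rightarrow> nat list list \<Rightarrow> nat list list \<Rightarrow> (nat \<times> nat list \<times> nat list) list \<Rightarrow> bool" where
  "state i S K cs \<longleftrightarrow> x \<in> set S \<and> set S \<subseteq> W \<and> distinct K \<and> set K \<subseteq> set S \<and>
     gf2_indep (map constraint_set cs) \<and> (\<forall>(t, u, v)\<in>set cs. t < 2 * i \<and> u \<in> set S \<and> v \<in> set S)"

abbreviation weight :: "nat list list \<Rightarrow> real" where
  "weight K \<equiv> prod_list (map p K)"

lemma weight_nonneg: "weight K \<ge> 0"
  by (induction K) (auto simp: p_nonneg)

lemma \<sigma>_gt_0: "real \<sigma> > 0" using \<sigma>_pos by simp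

lemma mean_power: "sum p W ^ m \<le> \<theta> ^ m * real \<sigma> ^ m"
  unfolding power_mult_distrib[symmetric] using mean by (intro power_mono sum_nonneg p_nonneg)

text \<open>\<open>K\<close> lies properly inside a minimal blocked set, so none of its subsets is
  blocked and \<open>Pr_satisfies_selected\<close> applies.\<close>

lemma Pr_explored:
  assumes "state i S K cs" "2 * i \<le> d"
  shows "Pr (explored S K cs) \<le> weight K / real \<sigma> ^ length cs"
proof -
  have KW: "set K \<subseteq> W" and SW: "set S \<subseteq> words \<sigma> c" using assms(1) W_words by (auto simp: state_def)
  have "explored S K cs \<subseteq>
      {T. satisfies cs (fst T) \<and> (\<forall>A\<subseteq>set K. \<not> blocked c d (fst T) A) \<and> set K \<subseteq> Y T}"
    unfolding explored_def min_blocked_def by blast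
  then have "Pr (explored S K cs) \<le>
      Pr {T. satisfies cs (fst T) \<and> (\<forall>A\<subseteq>set K. \<not> blocked c d (fst T) A) \<and> set K \<subseteq> Y T}"
    by (rule Pr_mono)
  also have "\<dots> \<le> (\<Prod>z\<in>set K. p z) / real \<sigma> ^ length cs"
  proof (rule Pr_satisfies_selected)
    show "\<forall>(t, u, v)\<in>set cs. t < d \<and> u \<in> words \<sigma> c \<and> v \<in> words \<sigma> c"
      using assms SW unfolding state_def by fastforce
  qed (use assms KW in \<open>auto simp: state_def\<close>)
  also have "(\<Prod>z\<in>set K. p z) = weight K"
    using assms(1) by (simp add: state_def prod.distinct_set_conv_list)
  finally show ?thesis .
qed

definition walk_cs :: "nat \<Rightarrow> nat list list \<Rightarrow> (nat \<times> nat list \<times> nat list) list \<Rightarrow> (nat \<times> nat list \<times> nat list) list" where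
  "walk_cs i zs cs = rev (walk (2 * i) (Suc (2 * i)) x zs) @ cs"

lemma length_walk_cs [simp]: "length (walk_cs i zs cs) = length zs + length cs"
  by (simp add: walk_cs_def)

lemma state_walk:
  assumes st: "state i S K cs" and fr: "fresh c (set S) zs" and zs: "set zs \<subseteq> W" and z: "z \<in> W"
  shows "state (Suc i) (zs @ [z] @ S) (zs @ K) (walk_cs i zs cs)"
    and "z \<notin> set S \<union> set zs \<Longrightarrow> state (Suc i) (zs @ [z] @ S) (zs @ [z] @ K) (walk_cs i zs cs)"
    and "t \<in> {2 * i, Suc (2 * i)} \<Longrightarrow> u \<in> set S \<union> set zs \<union> {z} \<Longrightarrow> v \<in> set S \<union> set zs \<union> {z} \<Longrightarrow>
      constraint_set (t, u, v) \<notin> gf2_span (map constraint_set (walk_cs i zs cs)) \<Longrightarrow>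
      state (Suc i) (zs @ [z] @ S) (zs @ K) ((t, u, v) # walk_cs i zs cs)"
proof -
  have S: "x \<in> set S" "set S \<subseteq> W" "distinct K" "set K \<subseteq> set S" "gf2_indep (map constraint_set cs)"
    and cs: "\<And>t u v. (t, u, v) \<in> set cs \<Longrightarrow> t < 2 * i \<and> u \<in> set S \<and> v \<in> set S"
    using st unfolding state_def by auto
  have indep: "gf2_indep (map constraint_set (walk_cs i zs cs))"
    unfolding walk_cs_def using cs S zs W_words by (intro gf2_indep_walk[OF fr S(1)]) auto
  have keys: "t < 2 * Suc i \<and> u \<in> set S \<union> set zs \<and> v \<in> set S \<union> set zs"
    if tuv: "(t, u, v) \<in> set (walk_cs i zs cs)" for t u v
  proof (cases "(t, u, v) \<in> set cs")
    case True
    then show ?thesis using cs[OF True] by auto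
  next
    case False
    then have "(t, u, v) \<in> set (walk (2 * i) (Suc (2 * i)) x zs)" using tuv by (simp add: walk_cs_def)
    from walk_keys[OF this] show ?thesis using S(1) by auto
  qed
  have dis: "distinct zs" "set zs \<inter> set S = {}" using fresh_distinct[OF fr] by auto
  have dK: "distinct (zs @ K)" using dis S by auto
  have keys': "\<forall>(t, u, v)\<in>set (walk_cs i zs cs).
      t < 2 * Suc i \<and> u \<in> set (zs @ [z] @ S) \<and> v \<in> set (zs @ [z] @ S)"
  proof clarify
    fix t u v assume "(t, u, v) \<in> set (walk_cs i zs cs)"
    from keys[OF this]
    show "t < 2 * Suc i \<and> u \<in> set (zs @ [z] @ S) \<and> v \<in> set (zs @ [z] @ S)" by auto
  qed
  have SW': "x \<in> set (zs @ [z] @ S)" "set (zs @ [z] @ S) \<subseteq> W" "set (zs @ K) \<subseteq> set (zs @ [z] @ S)"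
    "set (zs @ [z] @ K) \<subseteq> set (zs @ [z] @ S)" using S zs z by auto
  show "state (Suc i) (zs @ [z] @ S) (zs @ K) (walk_cs i zs cs)"
    unfolding state_def by (intro conjI SW' dK indep keys')
  show "state (Suc i) (zs @ [z] @ S) (zs @ [z] @ K) (walk_cs i zs cs)" if "z \<notin> set S \<union> set zs"
  proof -
    have "distinct (zs @ [z] @ K)" using dK that S(4) by auto
    then show ?thesis unfolding state_def by (intro conjI SW' indep keys')
  qed
  show "state (Suc i) (zs @ [z] @ S) (zs @ K) ((t, u, v) # walk_cs i zs cs)"
    if tuv: "t \<in> {2 * i, Suc (2 * i)}" "u \<in> set S \<union> set zs \<union> {z}" "v \<in> set S \<union> set zs \<union> {z}"
      "constraint_set (t, u, v) \<notin> gf2_span (map constraint_set (walk_cs i zs cs))"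
  proof -
    have indep': "gf2_indep (map constraint_set ((t, u, v) # walk_cs i zs cs))" using indep tuv(4) by simp
    have new: "t < 2 * Suc i \<and> u \<in> set (zs @ [z] @ S) \<and> v \<in> set (zs @ [z] @ S)" using tuv(1-3) by auto
    have "\<forall>y\<in>set ((t, u, v) # walk_cs i zs cs). case y of (t', u', v') \<Rightarrow>
        t' < 2 * Suc i \<and> u' \<in> set (zs @ [z] @ S) \<and> v' \<in> set (zs @ [z] @ S)"
    proof
      fix y assume "y \<in> set ((t, u, v) # walk_cs i zs cs)"
      then consider "y = (t, u, v)" | "y \<in> set (walk_cs i zs cs)" by auto
      then show "case y of (t', u', v') \<Rightarrow>
        t' < 2 * Suc i \<and> u' \<in> set (zs @ [z] @ S) \<and> v' \<in> set (zs @ [z] @ S)"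
      proof cases
        case 1
        show ?thesis unfolding 1 prod.case by (rule new)
      next
        case 2
        then show ?thesis using keys' by blast
      qed
    qed
    then show ?thesis unfolding state_def by (intro conjI SW' dK indep')
  qed
qed

text \<open>The four outcomes of a walk for the \<open>i\<close>-th pair of positions.  In \<open>gain_event\<close> the last key \<open>z\<close> has only
  polynomially many possible values and is not charged, which also keeps the charged keys a proper subset of \<open>A\<close>.
  The closing collision of the cycle events follows from the others and is dropped.  In \<open>full_event\<close> the first
  walk exhausts \<open>A\<close>; there every further pair of positions contributes two collisions of \<open>x\<close>.\<close>

definition gain_event :: "nat \<Rightarrow> nat list list \<Rightarrow> nat list list \<Rightarrow> (nat \<times> nat list \<times> nat list) list \<Rightarrow> mixed_tables set" where
  "gain_event i S K cs = (\<Union>m\<in>{..card W}. \<Union>zs\<in>{zs \<in> lists_of W m. fresh c (set S) zs}.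
     \<Union>z\<in>{z \<in> W. z \<in> char_closure c (set (zs @ S))}.
     \<Union>(t, u, v)\<in>{(t, u, v). t \<in> {2 * i, Suc (2 * i)} \<and> u \<in> set (zs @ [z] @ S) \<and> v \<in> set (zs @ [z] @ S) \<and>
        constraint_set (t, u, v) \<notin> gf2_span (map constraint_set (walk_cs i zs cs))}.
     explored (zs @ [z] @ S) (zs @ K) ((t, u, v) # walk_cs i zs cs))"

definition root_cycle_event :: "nat \<Rightarrow> nat list list \<Rightarrow> nat list list \<Rightarrow> (nat \<times> nat list \<times> nat list) list \<Rightarrow> mixed_tables set" where
  "root_cycle_event i S K cs = (\<Union>m\<in>{..card W}. \<Union>ys\<in>lists_of W m.
     \<Union>(a, u, z)\<in>{(a, u, z) \<in> B \<times> B \<times> B. sdiff4 x a u z = {} \<and>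
        fresh c (set S) (a # ys @ [u]) \<and> z \<notin> set S \<union> set (a # ys @ [u])}.
     explored ((a # ys @ [u]) @ [z] @ S) ((a # ys @ [u]) @ [z] @ K) (walk_cs i (a # ys @ [u]) cs))"

definition cycle_event :: "nat \<Rightarrow> nat list list \<Rightarrow> nat list list \<Rightarrow> (nat \<times> nat list \<times> nat list) list \<Rightarrow> mixed_tables set" where
  "cycle_event i S K cs = (\<Union>m1\<in>{..card W}. \<Union>m2\<in>{..card W}. \<Union>ys1\<in>lists_of W m1. \<Union>ys2\<in>lists_of W m2.
     \<Union>(a, b, u, z)\<in>{(a, b, u, z) \<in> W \<times> W \<times> W \<times> W.
        sdiff4 a b u z \<subseteq> (\<Union>w\<in>set S \<union> set ys1 \<union> set ys2. position_chars w) \<and>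
        fresh c (set S) (ys1 @ [a, b] @ ys2 @ [u]) \<and> z \<notin> set S \<union> set (ys1 @ [a, b] @ ys2 @ [u])}.
     explored ((ys1 @ [a, b] @ ys2 @ [u]) @ [z] @ S) ((ys1 @ [a, b] @ ys2 @ [u]) @ [z] @ K)
       (walk_cs i (ys1 @ [a, b] @ ys2 @ [u]) cs))"

definition full_event :: "nat \<Rightarrow> nat list list \<Rightarrow> nat list list \<Rightarrow> (nat \<times> nat list \<times> nat list) list \<Rightarrow> mixed_tables set" where
  "full_event i S K cs = {T. set S = {x} \<and> (\<exists>zs z. fresh c (set S) zs \<and> set zs \<subseteq> W \<and> z \<in> W \<and>
     z \<in> char_closure c (set (zs @ S)) \<and>
     satisfies (walk_cs i zs cs) (fst T) \<and> min_blocked (fst T) (set (zs @ [z] @ S)) \<and>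
     set (zs @ [z] @ S) \<subseteq> Y T \<and> set (zs @ [z] @ S) \<subseteq> B \<and> set (zs @ K) \<subset> set (zs @ [z] @ S))}"

text \<open>The outcome of one walk inside the obstruction \<open>A\<close> is recorded by an event.
  The charged keys stay a proper subset of \<open>A\<close>: by \<open>fresh_psubset\<close> if
  \<open>z\<close> is not charged, and because an unknown key remains if it is. Fresh keys are
  distinct, so lengths up to \<open>card W\<close> suffice and the unions are finite.\<close>

lemma explored_subset:
  assumes st: "state i S K cs" and i: "Suc (2 * i) < d"
  shows "explored S K cs \<subseteq> gain_event i S K cs \<union> root_cycle_event i S K cs \<union> cycle_event i S K cs \<union> full_event i S K cs"
proof
  fix T assume "T \<in> explored S K cs"
  then obtain A where sat: "satisfies cs (fst T)" and A: "min_blocked (fst T) A" "A \<subseteq> Y T" "A \<subseteq> B" "set S \<subseteq> A" "set K \<subset> A"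
    unfolding explored_def by blast
  have S: "x \<in> set S" "set S \<subseteq> W" "distinct K" "set K \<subseteq> set S"
    and cs: "\<And>t u v. (t, u, v) \<in> set cs \<Longrightarrow> t < 2 * i" using st unfolding state_def by auto
  have bl: "blocked c d (fst T) A" using A(1) by (simp add: min_blocked_def)
  have AW: "A \<subseteq> W" using A(3) B_W by blast
  have fA: "finite A" using AW finite_W finite_subset by blast
  have AWd: "A \<subseteq> words \<sigma> c" using AW W_words by blast
  have tags: "\<forall>(t, u, v)\<in>set cs. t \<noteq> 2 * i \<and> t \<noteq> Suc (2 * i)" using cs by fastforce
  have i': "2 * i < d" "2 * i \<noteq> Suc (2 * i)" using i by auto
  obtain zs z where fr: "fresh c (set S) zs" and zs: "set zs \<subseteq> A" and z: "z \<in> A"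
    and cl: "z \<in> char_closure c (set S \<union> set zs)" and sat': "satisfies (walk (2 * i) (Suc (2 * i)) x zs) (fst T)"
    and out: "(\<exists>t\<in>{2 * i, Suc (2 * i)}. \<exists>u\<in>set S \<union> set zs \<union> {z}. \<exists>v\<in>set S \<union> set zs \<union> {z}.
        h1_char (fst T) t u = h1_char (fst T) t v \<and>
        constraint_set (t, u, v) \<notin> gf2_span (map constraint_set (rev (walk (2 * i) (Suc (2 * i)) x zs) @ cs))) \<or>
     (z \<notin> set S \<union> set zs \<and> A \<noteq> set S \<union> set zs \<union> {z} \<and>
        ((\<exists>a ys u. zs = a # ys @ [u] \<and> sdiff4 x a u z = {}) \<or>
         (\<exists>ys1 a b ys2 u. zs = ys1 @ [a, b] @ ys2 @ [u] \<and>
            sdiff4 a b u z \<subseteq> (\<Union>w\<in>set S \<union> set ys1 \<union> set ys2. position_chars w)))) \<or>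
     (A = set S \<union> set zs \<union> {z} \<and> set S = {x})"
    by (rule walk_outcome[OF bl fA AWd A(4) S(1) i'(1) i i'(2) tags]) (rule that, assumption+)
  have sw: "satisfies (walk_cs i zs cs) (fst T)"
    using sat sat' by (simp add: walk_cs_def satisfies_append satisfies_rev)
  have zsW: "set zs \<subseteq> W" and zW: "z \<in> W" using zs z AW by auto
  have len: "length zs \<le> card W"
    using fresh_distinct[OF fr] card_mono[OF finite_W zsW] by (metis distinct_card)
  have ps: "set zs \<union> set K \<subset> A" using fresh_psubset[OF bl fr A(5) S(4) zs] .
  have S'A: "set (zs @ [z] @ S) \<subseteq> A" using zs z A(4) by auto
  have elem: "T \<in> E1 \<union> E2 \<union> E3 \<union> E4" if "T \<in> E1 \<or> T \<in> E2 \<or> T \<in> E3 \<or> T \<in> E4" for E1 E2 E3 E4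
    using that by simp
  from out[folded walk_cs_def]
  show "T \<in> gain_event i S K cs \<union> root_cycle_event i S K cs \<union> cycle_event i S K cs \<union> full_event i S K cs"
  proof (elim disjE)
    assume "\<exists>t\<in>{2 * i, Suc (2 * i)}. \<exists>u\<in>set S \<union> set zs \<union> {z}. \<exists>v\<in>set S \<union> set zs \<union> {z}.
        h1_char (fst T) t u = h1_char (fst T) t v \<and>
        constraint_set (t, u, v) \<notin> gf2_span (map constraint_set (walk_cs i zs cs))"
    then obtain t u v where gain: "t \<in> {2 * i, Suc (2 * i)}" "u \<in> set S \<union> set zs \<union> {z}"
        "v \<in> set S \<union> set zs \<union> {z}" "h1_char (fst T) t u = h1_char (fst T) t v"
        "constraint_set (t, u, v) \<notin> gf2_span (map constraint_set (walk_cs i zs cs))" by blast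
    have "satisfies ((t, u, v) # walk_cs i zs cs) (fst T)" using gain(4) sw by (simp add: satisfies_Cons)
    moreover have "set (zs @ K) \<subset> A" using ps by simp
    ultimately have ex: "T \<in> explored (zs @ [z] @ S) (zs @ K) ((t, u, v) # walk_cs i zs cs)"
      unfolding explored_def using A S'A by blast
    have 1: "zs \<in> {ys \<in> lists_of W (length zs). fresh c (set S) ys}" using fr zsW by (simp add: lists_of_def)
    have 2: "z \<in> {z \<in> W. z \<in> char_closure c (set (zs @ S))}" using cl zW by (simp add: Un_commute)
    have 3: "(t, u, v) \<in> {(t, u, v). t \<in> {2 * i, Suc (2 * i)} \<and> u \<in> set (zs @ [z] @ S) \<and> v \<in> set (zs @ [z] @ S) \<and>
        constraint_set (t, u, v) \<notin> gf2_span (map constraint_set (walk_cs i zs cs))}" using gain by auto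
    have 4: "length zs \<in> {..card W}" using len by simp
    have "T \<in> gain_event i S K cs"
      unfolding gain_event_def
      by (rule UN_I[OF 4], rule UN_I[OF 1], rule UN_I[OF 2], rule UN_I[OF 3]) (unfold prod.case, rule ex)
    then show ?thesis by (intro elem) simp
  next
    assume new: "z \<notin> set S \<union> set zs \<and> A \<noteq> set S \<union> set zs \<union> {z} \<and>
        ((\<exists>a ys u. zs = a # ys @ [u] \<and> sdiff4 x a u z = {}) \<or>
         (\<exists>ys1 a b ys2 u. zs = ys1 @ [a, b] @ ys2 @ [u] \<and>
            sdiff4 a b u z \<subseteq> (\<Union>w\<in>set S \<union> set ys1 \<union> set ys2. position_chars w)))"
    have "set (zs @ [z] @ K) \<subset> A" using new S'A S(4) by auto
    then have ex: "T \<in> explored (zs @ [z] @ S) (zs @ [z] @ K) (walk_cs i zs cs)"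
      unfolding explored_def using A S'A sw by blast
    from new consider (root) "\<exists>a ys u. zs = a # ys @ [u] \<and> sdiff4 x a u z = {}"
      | (cyc) "\<exists>ys1 a b ys2 u. zs = ys1 @ [a, b] @ ys2 @ [u] \<and>
            sdiff4 a b u z \<subseteq> (\<Union>w\<in>set S \<union> set ys1 \<union> set ys2. position_chars w)" by argo
    then show ?thesis
    proof cases
      case root
      then obtain a ys u where zs_eq: "zs = a # ys @ [u]" and zero: "sdiff4 x a u z = {}" by blast
      have y: "ys \<in> lists_of W (length ys)" using zsW zs_eq by (simp add: lists_of_def)
      have m: "length ys \<in> {..card W}" using len zs_eq by simp
      have tri: "(a, u, z) \<in> {(a, u, z) \<in> B \<times> B \<times> B. sdiff4 x a u z = {} \<and>
          fresh c (set S) (a # ys @ [u]) \<and> z \<notin> set S \<union> set (a # ys @ [u])}"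
        using zero new fr zs z A(3) unfolding zs_eq by auto
      have "T \<in> root_cycle_event i S K cs"
        unfolding root_cycle_event_def
        by (rule UN_I[OF m], rule UN_I[OF y], rule UN_I[OF tri]) (unfold prod.case, rule ex[unfolded zs_eq])
      then show ?thesis by (intro elem) simp
    next
      case cyc
      then obtain ys1 a b ys2 u where zs_eq: "zs = ys1 @ [a, b] @ ys2 @ [u]"
        and cover: "sdiff4 a b u z \<subseteq> (\<Union>w\<in>set S \<union> set ys1 \<union> set ys2. position_chars w)" by blast
      have y: "ys1 \<in> lists_of W (length ys1)" "ys2 \<in> lists_of W (length ys2)"
        using zsW zs_eq by (simp_all add: lists_of_def)
      have m: "length ys1 \<in> {..card W}" "length ys2 \<in> {..card W}" using len zs_eq by simp_all
      have quad: "(a, b, u, z) \<in> {(a, b, u, z) \<in> W \<times> W \<times> W \<times> W.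
          sdiff4 a b u z \<subseteq> (\<Union>w\<in>set S \<union> set ys1 \<union> set ys2. position_chars w) \<and>
          fresh c (set S) (ys1 @ [a, b] @ ys2 @ [u]) \<and> z \<notin> set S \<union> set (ys1 @ [a, b] @ ys2 @ [u])}"
        using cover new fr zsW zW unfolding zs_eq by simp
      have "T \<in> cycle_event i S K cs"
        unfolding cycle_event_def
        by (rule UN_I[OF m(1)], rule UN_I[OF m(2)], rule UN_I[OF y(1)], rule UN_I[OF y(2)], rule UN_I[OF quad])
          (unfold prod.case, rule ex[unfolded zs_eq])
      then show ?thesis by (intro elem) simp
    qed
  next
    assume full: "A = set S \<union> set zs \<union> {z} \<and> set S = {x}"
    have eq: "A = set (zs @ [z] @ S)" using full by auto
    have "set S = {x}" using full by (rule conjunct2)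
    moreover have "z \<in> char_closure c (set (zs @ S))" using cl by (simp add: Un_commute)
    moreover have "set (zs @ K) \<subset> set (zs @ [z] @ S)" using ps unfolding eq by simp
    moreover have "min_blocked (fst T) (set (zs @ [z] @ S))" "set (zs @ [z] @ S) \<subseteq> Y T" "set (zs @ [z] @ S) \<subseteq> B"
      using A(1-3) unfolding eq .
    ultimately have "T \<in> full_event i S K cs"
      unfolding full_event_def using fr zsW zW sw
      by (intro CollectI conjI exI[of _ zs] exI[of _ z])
    then show ?thesis by (intro elem) simp
  qed
qed

lemma full_event_empty: "y \<in> set S \<Longrightarrow> y \<noteq> x \<Longrightarrow> full_event i S K cs = {}"
  unfolding full_event_def by blast

end

section \<open>Geometric series with polynomial factors\<close>

lemma summable_geometric_poly:
  fixes \<theta> :: real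
  assumes "0 < \<theta>" "\<theta> < 1"
  shows "summable (\<lambda>m. \<theta> ^ m * (real m + 4) ^ e)"
proof -
  have "(\<lambda>m. (real m + 5) / (real m + 4)) \<longlonglongrightarrow> 1" by real_asymp
  then have "(\<lambda>m. \<theta> * ((real m + 5) / (real m + 4)) ^ e) \<longlonglongrightarrow> \<theta> * 1 ^ e"
    by (intro tendsto_intros)
  moreover have "\<theta> * 1 ^ e < (1 + \<theta>) / 2" using assms by simp
  ultimately have "eventually (\<lambda>m. \<theta> * ((real m + 5) / (real m + 4)) ^ e < (1 + \<theta>) / 2) sequentially"
    by (rule order_tendstoD(2))
  then obtain N where N: "\<And>m. m \<ge> N \<Longrightarrow> \<theta> * ((real m + 5) / (real m + 4)) ^ e < (1 + \<theta>) / 2"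
    unfolding eventually_sequentially by blast
  show ?thesis
  proof (rule summable_ratio_test[of "(1 + \<theta>) / 2" N])
    fix m assume "m \<ge> N"
    have "\<theta> ^ Suc m * (real (Suc m) + 4) ^ e =
        (\<theta> * ((real m + 5) / (real m + 4)) ^ e) * (\<theta> ^ m * (real m + 4) ^ e)"
      by (simp add: power_divide add.commute)
    also have "\<dots> \<le> (1 + \<theta>) / 2 * (\<theta> ^ m * (real m + 4) ^ e)"
      using N[OF \<open>m \<ge> N\<close>] assms by (intro mult_right_mono) auto
    finally show "norm (\<theta> ^ Suc m * (real (Suc m) + 4) ^ e) \<le> (1 + \<theta>) / 2 * norm (\<theta> ^ m * (real m + 4) ^ e)"
      using assms by simp
  qed (use assms in auto)
qed

text \<open>The shift by 4 fits \<open>add_le_times_1\<close> and \<open>add_le_times_2\<close>.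
  Besides the freely summed keys, the cycle events add three or four keys to the known ones;
  bounding the new length by a product leaves one such series per free segment of the walk.\<close>

definition poly_geom :: "real \<Rightarrow> nat \<Rightarrow> real" where
  "poly_geom \<theta> e = (\<Sum>m. \<theta> ^ m * (real m + 4) ^ e)"

lemma poly_geom_nonneg: "0 < \<theta> \<Longrightarrow> \<theta> < 1 \<Longrightarrow> poly_geom \<theta> e \<ge> 0"
  unfolding poly_geom_def by (intro suminf_nonneg summable_geometric_poly) auto

lemma sum_le_poly_geom:
  "0 < \<theta> \<Longrightarrow> \<theta> < 1 \<Longrightarrow> (\<Sum>m\<le>N. \<theta> ^ m * (real m + 4) ^ e) \<le> poly_geom \<theta> e"
  unfolding poly_geom_def by (intro sum_le_suminf summable_geometric_poly) auto

lemma add_le_times_1: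
  fixes k m :: real
  assumes "1 \<le> k" "0 \<le> m"
  shows "k + m + 3 \<le> k * (m + 4)"
proof -
  have "0 \<le> (k - 1) * (m + 3)" using assms by (intro mult_nonneg_nonneg) auto
  then show ?thesis by (simp add: algebra_simps)
qed

lemma add_le_times_2:
  fixes k m m' :: real
  assumes "1 \<le> k" "0 \<le> m" "0 \<le> m'"
  shows "k + m + m' + 4 \<le> k * ((m + 4) * (m' + 4))"
proof -
  have "0 \<le> m * m'" using assms by simp
  have "k + m + m' + 4 \<le> (k + m + 3) * (m' + 4)"
  proof -
    have "0 \<le> (k + m + 2) * (m' + 3) - 1 * 1"
      using assms mult_mono[of 1 "k + m + 2" 1 "m' + 3"] by simp
    then show ?thesis using assms by (simp add: algebra_simps)
  qed
  also have "\<dots> \<le> (k * (m + 4)) * (m' + 4)"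
    using add_le_times_1[OF assms(1,2)] assms(3) by (intro mult_right_mono) auto
  finally show ?thesis by (simp add: mult.assoc)
qed

lemma sum_factor_1:
  fixes w :: "'a \<Rightarrow> real"
  shows "(\<Sum>i\<in>I. a * (b * (w i * q))) = a * b * (sum w I * q)"
  by (simp add: sum_distrib_left sum_distrib_right mult_ac)

lemma sum_factor_2:
  fixes w :: "'a \<Rightarrow> real" and w' :: "'b \<Rightarrow> real"
  shows "(\<Sum>i\<in>I. \<Sum>j\<in>J. a * (b * (w i * w' j * q))) = a * b * (sum w I * sum w' J * q)"
proof -
  have "(\<Sum>j\<in>J. a * (b * (w i * w' j * q))) = a * (b * (w i * (sum w' J * q)))" for i
    by (simp add: sum_distrib_left sum_distrib_right mult_ac)
  then show ?thesis by (simp only: sum_factor_1 mult.assoc)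
qed

section \<open>Probabilities of the outcomes of a walk\<close>

context rooted_tabulation
begin

abbreviation "N \<equiv> card W"

text \<open>\<open>n\<close> counts the factors \<open>1 / \<sigma>\<close> still to be saved, and
  the power of \<open>length S\<close> is the price of choices among known keys. The second known
  key rules out \<open>full_event\<close>.\<close>

definition bounded_by :: "real \<Rightarrow> nat \<Rightarrow> nat \<Rightarrow> nat \<Rightarrow> bool" where
  "bounded_by C e n i \<longleftrightarrow> (\<forall>S K cs. state i S K cs \<longrightarrow> (\<exists>y\<in>set S. y \<noteq> x) \<longrightarrow>
     Pr (explored S K cs) \<le> C * real (length S) ^ e * (weight K / real \<sigma> ^ (length cs + n)))"

lemma bounded_by_0: "2 * i \<le> d \<Longrightarrow> bounded_by 1 0 0 i"
  unfolding bounded_by_def using Pr_explored by simp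

lemma mean_power_div: "sum p W ^ m * (w / real \<sigma> ^ (m + j)) \<le> \<theta> ^ m * (w / real \<sigma> ^ j)"
  if "w \<ge> 0"
proof -
  have "sum p W ^ m * (w / real \<sigma> ^ (m + j)) \<le> (\<theta> ^ m * real \<sigma> ^ m) * (w / real \<sigma> ^ (m + j))"
    using mean_power that \<sigma>_gt_0 by (intro mult_right_mono) auto
  also have "\<dots> = \<theta> ^ m * (w / real \<sigma> ^ j)" using \<sigma>_gt_0 by (simp add: power_add)
  finally show ?thesis .
qed

text \<open>With \<open>k = length S\<close> and a walk of length \<open>m\<close> there are at most
  \<open>(k + m) ^ c\<close> last keys and \<open>2 * (k + m + 1) ^ 2\<close> extra collisions; the
  extra collision saves the factor. This raises the exponent by \<open>c + 2\<close>, and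
  \<open>2 * c + 2\<close> serves as a common increment for all outcomes.\<close>

lemma Pr_gain_event:
  assumes bd: "bounded_by C e n (Suc i)" and C: "C \<ge> 0" and st: "state i S K cs" and e': "e + 2 * c + 2 \<le> e'"
  shows "Pr (gain_event i S K cs) \<le>
    2 * C * poly_geom \<theta> e' * (real (length S) ^ e' * (weight K / real \<sigma> ^ (length cs + Suc n)))"
proof -
  let ?k = "length S"
  let ?w = "weight K"
  let ?base = "?w / real \<sigma> ^ (length cs + Suc n)"
  have k1: "1 \<le> ?k" using st by (cases S) (auto simp: state_def)
  have w0: "?w \<ge> 0" by (rule weight_nonneg)
  define TUV where "TUV zs z = {(t, u, v). t \<in> {2 * i, Suc (2 * i)} \<and> u \<in> set (zs @ [z] @ S) \<and> v \<in> set (zs @ [z] @ S) \<and>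
        constraint_set (t, u, v) \<notin> gf2_span (map constraint_set (walk_cs i zs cs))}" for zs z
  define E where "E zs z = (\<lambda>(t, u, v). explored (zs @ [z] @ S) (zs @ K) ((t, u, v) # walk_cs i zs cs))" for zs z
  define \<beta> where "\<beta> m zs = C * real (?k + m + 1) ^ e * (weight zs * (?w / real \<sigma> ^ (m + (length cs + Suc n))))" for m zs
  have \<beta>0: "\<beta> m zs \<ge> 0" for m zs unfolding \<beta>_def using C w0 weight_nonneg by simp
  have one: "Pr (E zs z tuv) \<le> \<beta> m zs"
    if zs: "zs \<in> lists_of W m" "fresh c (set S) zs" and z: "z \<in> W" and tuv: "tuv \<in> TUV zs z" for m zs z tuv
  proof -
    obtain t u v where tuv_eq: "tuv = (t, u, v)" by (cases tuv)
    have mem: "t \<in> {2 * i, Suc (2 * i)}" "u \<in> set (zs @ [z] @ S)" "v \<in> set (zs @ [z] @ S)"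
      "constraint_set (t, u, v) \<notin> gf2_span (map constraint_set (walk_cs i zs cs))"
      using tuv unfolding TUV_def tuv_eq by auto
    \<comment> \<open>The zero vector lies in every span, so the extra collision joins two different
      keys and one of them is not \<open>x\<close>. This is the second known key that
      \<open>bounded_by\<close> asks for.\<close>
    have "constraint_set (t, u, u) = {}" by (auto simp: constraint_set_def)
    then have "u \<noteq> v" using mem(4) empty_in_gf2_span by metis
    then have y: "\<exists>y\<in>set (zs @ [z] @ S). y \<noteq> x" using mem(2,3) by metis
    have "state (Suc i) (zs @ [z] @ S) (zs @ K) ((t, u, v) # walk_cs i zs cs)"
      using state_walk(3)[OF st zs(2) _ z mem(1) _ _ mem(4)] mem(2,3) zs(1) by (auto simp: lists_of_def)
    from bd[unfolded bounded_by_def, rule_format, OF this y]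
    show ?thesis using zs(1)
      by (simp add: E_def tuv_eq \<beta>_def lists_of_def add_ac)
  qed
  have cardT: "finite (TUV zs z)" "card (TUV zs z) \<le> 2 * (?k + m + 1) ^ 2" if "length zs = m" for zs z m
  proof -
    let ?U = "set (zs @ [z] @ S)"
    have sub: "TUV zs z \<subseteq> {2 * i, Suc (2 * i)} \<times> ?U \<times> ?U" unfolding TUV_def by auto
    then show "finite (TUV zs z)" by (rule finite_subset) auto
    have "card (TUV zs z) \<le> card ({2 * i, Suc (2 * i)} \<times> ?U \<times> ?U)" using sub by (rule card_mono[rotated]) auto
    also have "\<dots> = 2 * (card ?U * card ?U)" unfolding card_cartesian_product by simp
    also have "\<dots> \<le> 2 * ((?k + m + 1) * (?k + m + 1))"
      using card_length[of "zs @ [z] @ S"] that by (intro mult_le_mono) (auto simp: add_ac)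
    finally show "card (TUV zs z) \<le> 2 * (?k + m + 1) ^ 2" by (simp add: power2_eq_square)
  qed
  have cardZ: "card {z \<in> W. z \<in> char_closure c (set (zs @ S))} \<le> (?k + m) ^ c" if "length zs = m" for zs m
  proof -
    have "card {z \<in> W. z \<in> char_closure c (set (zs @ S))} \<le> card {z \<in> words \<sigma> c. z \<in> char_closure c (set (zs @ S))}"
      using W_words by (intro card_mono) auto
    also have "\<dots> \<le> length (zs @ S) ^ c" by (rule card_char_closure_le)
    finally show ?thesis using that by (simp add: add.commute)
  qed
  have per_m: "Pr (\<Union>zs\<in>{zs \<in> lists_of W m. fresh c (set S) zs}. \<Union>z\<in>{z \<in> W. z \<in> char_closure c (set (zs @ S))}. \<Union>tuv\<in>TUV zs z. E zs z tuv)
      \<le> 2 * C * (real ?k ^ e' * ?base) * (\<theta> ^ m * (real m + 4) ^ e')" for m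
  proof -
    let ?f = "real ((?k + m) ^ c) * real (2 * (?k + m + 1) ^ 2)"
    have "Pr (\<Union>zs\<in>{zs \<in> lists_of W m. fresh c (set S) zs}. \<Union>z\<in>{z \<in> W. z \<in> char_closure c (set (zs @ S))}. \<Union>tuv\<in>TUV zs z. E zs z tuv)
      \<le> (\<Sum>zs\<in>{zs \<in> lists_of W m. fresh c (set S) zs}. ?f * \<beta> m zs)"
    proof (rule order.trans[OF Pr_UN_le sum_mono])
      fix zs assume zs: "zs \<in> {zs \<in> lists_of W m. fresh c (set S) zs}"
      then have len: "length zs = m" by (simp add: lists_of_def)
      have "Pr (\<Union>z\<in>{z \<in> W. z \<in> char_closure c (set (zs @ S))}. \<Union>tuv\<in>TUV zs z. E zs z tuv)
          \<le> real ((?k + m) ^ c) * (real (2 * (?k + m + 1) ^ 2) * \<beta> m zs)"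
      proof (rule Pr_UN_const)
        fix z assume z: "z \<in> {z \<in> W. z \<in> char_closure c (set (zs @ S))}"
        show "Pr (\<Union>tuv\<in>TUV zs z. E zs z tuv) \<le> real (2 * (?k + m + 1) ^ 2) * \<beta> m zs"
          using one[of zs m z] zs z by (intro Pr_UN_const cardT[OF len] \<beta>0) auto
      qed (use cardZ[OF len] \<beta>0 in auto)
      then show "Pr (\<Union>z\<in>{z \<in> W. z \<in> char_closure c (set (zs @ S))}. \<Union>tuv\<in>TUV zs z. E zs z tuv) \<le> ?f * \<beta> m zs"
        by (simp add: mult.assoc)
    qed simp
    also have "\<dots> \<le> (\<Sum>zs\<in>lists_of W m. ?f * \<beta> m zs)"
      using \<beta>0 by (intro sum_mono2) (auto intro!: mult_nonneg_nonneg)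
    also have "\<dots> = ?f * (C * real (?k + m + 1) ^ e) * (sum p W ^ m * (?w / real \<sigma> ^ (m + (length cs + Suc n))))"
      unfolding \<beta>_def sum_lists_of[OF finite_W, symmetric] by (rule sum_factor_1)
    also have "\<dots> \<le> ?f * (C * real (?k + m + 1) ^ e) * (\<theta> ^ m * ?base)"
      using C by (intro mult_left_mono mean_power_div w0) auto
    also have "\<dots> \<le> (2 * C * (real ?k * (real m + 4)) ^ e') * (\<theta> ^ m * ?base)"
    proof (intro mult_right_mono)
      let ?x = "real ?k * (real m + 4)"
      have kx: "real (?k + m + 1) \<le> ?x" "real (?k + m) \<le> ?x"
        using add_le_times_1[of "real ?k" "real m"] k1 by auto
      have x1: "1 \<le> ?x" using kx k1 by linarith
      have "?f * (C * real (?k + m + 1) ^ e) = 2 * C * (real (?k + m) ^ c * (real (?k + m + 1) ^ 2 * real (?k + m + 1) ^ e))"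
        by (simp add: mult_ac)
      also have "\<dots> \<le> 2 * C * (?x ^ c * (?x ^ 2 * ?x ^ e))"
        using C kx x1 by (intro mult_left_mono mult_mono power_mono mult_nonneg_nonneg) auto
      also have "\<dots> = 2 * C * ?x ^ (c + (2 + e))" by (simp only: power_add)
      also have "\<dots> \<le> 2 * C * ?x ^ e'"
        using C e' x1 by (intro mult_left_mono power_increasing) auto
      finally show "?f * (C * real (?k + m + 1) ^ e) \<le> 2 * C * ?x ^ e'" .
    qed (use w0 \<theta> in auto)
    finally show ?thesis by (simp add: power_mult_distrib mult_ac)
  qed
  have "gain_event i S K cs = (\<Union>m\<in>{..N}. \<Union>zs\<in>{zs \<in> lists_of W m. fresh c (set S) zs}.
      \<Union>z\<in>{z \<in> W. z \<in> char_closure c (set (zs @ S))}. \<Union>tuv\<in>TUV zs z. E zs z tuv)"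
    unfolding gain_event_def TUV_def E_def by (simp only: case_prod_eta)
  then have "Pr (gain_event i S K cs) \<le> (\<Sum>m\<le>N. 2 * C * (real ?k ^ e' * ?base) * (\<theta> ^ m * (real m + 4) ^ e'))"
    by (simp only:) (intro order.trans[OF Pr_UN_le sum_mono] per_m finite_atMost)
  also have "\<dots> = 2 * C * (real ?k ^ e' * ?base) * (\<Sum>m\<le>N. \<theta> ^ m * (real m + 4) ^ e')"
    by (simp only: sum_distrib_left)
  also have "\<dots> \<le> 2 * C * (real ?k ^ e' * ?base) * poly_geom \<theta> e'"
    using C w0 \<theta> by (intro mult_left_mono sum_le_poly_geom) auto
  finally show ?thesis by (simp only: mult_ac)
qed

text \<open>The charges of \<open>a\<close>, \<open>u\<close>, \<open>z\<close> sum to at most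
  \<open>3 ^ c * sum p W\<close> by the degree of \<open>x\<close> within \<open>B\<close>. One
  power of the mean thus stands against the two collisions that lead to \<open>a\<close> and
  \<open>u\<close>, and a factor \<open>1 / \<sigma>\<close> is left over.\<close>

lemma Pr_root_cycle_event:
  assumes bd: "bounded_by C e n (Suc i)" and C: "C \<ge> 0" and st: "state i S K cs" and e': "e + 2 * c + 2 \<le> e'"
  shows "Pr (root_cycle_event i S K cs) \<le>
    3 ^ c * C * poly_geom \<theta> e' * (real (length S) ^ e' * (weight K / real \<sigma> ^ (length cs + Suc n)))"
proof -
  let ?k = "length S"
  let ?w = "weight K"
  let ?base = "?w / real \<sigma> ^ (length cs + Suc n)"
  have k1: "1 \<le> ?k" using st by (cases S) (auto simp: state_def)
  have w0: "?w \<ge> 0" by (rule weight_nonneg)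
  define I where "I ys = {(a, u, z) \<in> B \<times> B \<times> B. sdiff4 x a u z = {} \<and>
        fresh c (set S) (a # ys @ [u]) \<and> z \<notin> set S \<union> set (a # ys @ [u])}" for ys
  define E where "E ys = (\<lambda>(a, u, z). explored ((a # ys @ [u]) @ [z] @ S) ((a # ys @ [u]) @ [z] @ K)
      (walk_cs i (a # ys @ [u]) cs))" for ys
  define \<beta> where "\<beta> m ys = C * real (?k + m + 3) ^ e * (weight ys * (?w / real \<sigma> ^ (Suc m + (length cs + Suc n))))" for m ys
  have \<beta>0: "\<beta> m ys \<ge> 0" for m ys unfolding \<beta>_def using C w0 weight_nonneg by simp
  have finB: "finite B" using B_W finite_W finite_subset by blast
  have one: "Pr (E ys (a, u, z)) \<le> (p a * p u * p z) * \<beta> m ys"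
    if ys: "ys \<in> lists_of W m" and mem: "(a, u, z) \<in> I ys" for m ys a u z
  proof -
    have m: "a \<in> W" "u \<in> W" "z \<in> W" "fresh c (set S) (a # ys @ [u])" "z \<notin> set S \<union> set (a # ys @ [u])"
      using mem B_W unfolding I_def by auto
    have sub: "set (a # ys @ [u]) \<subseteq> W" using m ys by (auto simp: lists_of_def)
    have "a \<noteq> x" using fresh_distinct[OF m(4)] st by (auto simp: state_def)
    then have y: "\<exists>y\<in>set ((a # ys @ [u]) @ [z] @ S). y \<noteq> x" by auto
    from bd[unfolded bounded_by_def, rule_format, OF state_walk(2)[OF st m(4) sub m(3,5)] y]
    show ?thesis using ys
      by (simp add: E_def \<beta>_def lists_of_def add_ac mult_ac)
  qed
  have per_m: "Pr (\<Union>ys\<in>lists_of W m. \<Union>q\<in>I ys. E ys q)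
      \<le> 3 ^ c * C * (real ?k ^ e' * ?base) * (\<theta> ^ m * (real m + 4) ^ e')" for m
  proof -
    have "Pr (\<Union>ys\<in>lists_of W m. \<Union>q\<in>I ys. E ys q) \<le> (\<Sum>ys\<in>lists_of W m. (3 ^ c * sum p W) * \<beta> m ys)"
    proof (rule order.trans[OF Pr_UN_le sum_mono])
      fix ys assume ys: "ys \<in> lists_of W m"
      have finI: "finite (I ys)" unfolding I_def using finB by (auto intro: finite_subset[of _ "B \<times> B \<times> B"])
      have "Pr (\<Union>q\<in>I ys. E ys q) \<le> (\<Sum>(a, u, z)\<in>I ys. (p a * p u * p z) * \<beta> m ys)"
        using one[OF ys] by (intro order.trans[OF Pr_UN_le[OF finI] sum_mono]) auto
      also have "\<dots> = (\<Sum>(a, u, z)\<in>I ys. of_bool (sdiff4 x a u z = {}) * (p a * p u * p z) * \<beta> m ys)"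
        by (intro sum.cong) (auto simp: I_def)
      also have "\<dots> \<le> (\<Sum>(a, u, z)\<in>B \<times> B \<times> B. of_bool (sdiff4 x a u z = {}) * (p a * p u * p z) * \<beta> m ys)"
      proof (rule sum_mono2)
        show "I ys \<subseteq> B \<times> B \<times> B" unfolding I_def by auto
      qed (use finB \<beta>0 p_nonneg in auto)
      also have "\<dots> = zero_degree B x * \<beta> m ys"
        unfolding zero_degree_def sum_distrib_right by (simp add: case_prod_beta)
      also have "\<dots> \<le> (3 ^ c * sum p W) * \<beta> m ys" using degree \<beta>0 by (intro mult_right_mono)
      finally show "Pr (\<Union>q\<in>I ys. E ys q) \<le> (3 ^ c * sum p W) * \<beta> m ys" .
    qed simp
    also have "\<dots> = 3 ^ c * (C * real (?k + m + 3) ^ e) * (sum p W ^ Suc m * (?w / real \<sigma> ^ (Suc m + (length cs + Suc n))))"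
      unfolding \<beta>_def sum_factor_1 sum_lists_of[OF finite_W] by (simp add: mult_ac)
    also have "\<dots> \<le> 3 ^ c * (C * real (?k + m + 3) ^ e) * (\<theta> ^ Suc m * ?base)"
      using C by (intro mult_left_mono mean_power_div w0) auto
    also have "\<dots> \<le> 3 ^ c * (C * (real ?k * (real m + 4)) ^ e') * (\<theta> ^ m * ?base)"
    proof (intro mult_mono)
      let ?x = "real ?k * (real m + 4)"
      have kx: "real (?k + m + 3) \<le> ?x" using add_le_times_1[of "real ?k" "real m"] k1 by auto
      have "real (?k + m + 3) ^ e \<le> ?x ^ e" using kx by (intro power_mono) auto
      also have "\<dots> \<le> ?x ^ e'" using kx k1 e' by (intro power_increasing) auto
      finally show "real (?k + m + 3) ^ e \<le> ?x ^ e'" .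
      show "\<theta> ^ Suc m \<le> \<theta> ^ m" using \<theta> by (intro power_decreasing) auto
    qed (use C w0 \<theta> in auto)
    finally show ?thesis by (simp add: power_mult_distrib mult_ac)
  qed
  have "root_cycle_event i S K cs = (\<Union>m\<in>{..N}. \<Union>ys\<in>lists_of W m. \<Union>q\<in>I ys. E ys q)"
    unfolding root_cycle_event_def I_def E_def by (simp only: case_prod_eta)
  then have "Pr (root_cycle_event i S K cs) \<le> (\<Sum>m\<le>N. 3 ^ c * C * (real ?k ^ e' * ?base) * (\<theta> ^ m * (real m + 4) ^ e'))"
    by (simp only:) (intro order.trans[OF Pr_UN_le sum_mono] per_m finite_atMost)
  also have "\<dots> = 3 ^ c * C * (real ?k ^ e' * ?base) * (\<Sum>m\<le>N. \<theta> ^ m * (real m + 4) ^ e')"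
    by (simp only: sum_distrib_left)
  also have "\<dots> \<le> 3 ^ c * C * (real ?k ^ e' * ?base) * poly_geom \<theta> e'"
    using C w0 \<theta> by (intro mult_left_mono sum_le_poly_geom) auto
  finally show ?thesis by (simp only: mult_ac)
qed

text \<open>The charges of \<open>a\<close>, \<open>b\<close>, \<open>u\<close>, \<open>z\<close>
  sum to a multiple of \<open>(sum p W)\<^sup>2\<close> against three collisions, which leaves a
  factor \<open>1 / \<sigma>\<close>; keys of \<open>ys1\<close> and \<open>ys2\<close> pay one mean
  for one collision each. At most \<open>k + m1 + m2\<close> keys pin characters, where
  \<open>k = length S\<close>, and this causes the increment \<open>2 * c\<close> of the
  exponent.\<close>

lemma Pr_cycle_event:
  assumes bd: "bounded_by C e n (Suc i)" and C: "C \<ge> 0" and st: "state i S K cs" and e': "e + 2 * c + 2 \<le> e'"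
  shows "Pr (cycle_event i S K cs) \<le>
    3 ^ c * C * (poly_geom \<theta> e')\<^sup>2 * (real (length S) ^ e' * (weight K / real \<sigma> ^ (length cs + Suc n)))"
proof -
  let ?k = "length S"
  let ?w = "weight K"
  let ?base = "?w / real \<sigma> ^ (length cs + Suc n)"
  have k1: "1 \<le> ?k" using st by (cases S) (auto simp: state_def)
  have w0: "?w \<ge> 0" by (rule weight_nonneg)
  have SW: "set S \<subseteq> W" using st by (simp add: state_def)
  define F where "F ys1 ys2 = set S \<union> set ys1 \<union> set ys2" for ys1 ys2
  define I where "I ys1 ys2 = {(a, b, u, z) \<in> W \<times> W \<times> W \<times> W.
        sdiff4 a b u z \<subseteq> (\<Union>w\<in>F ys1 ys2. position_chars w) \<and>
        fresh c (set S) (ys1 @ [a, b] @ ys2 @ [u]) \<and> z \<notin> set S \<union> set (ys1 @ [a, b] @ ys2 @ [u])}" for ys1 ys2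
  define E where "E ys1 ys2 = (\<lambda>(a, b, u, z). explored ((ys1 @ [a, b] @ ys2 @ [u]) @ [z] @ S)
       ((ys1 @ [a, b] @ ys2 @ [u]) @ [z] @ K) (walk_cs i (ys1 @ [a, b] @ ys2 @ [u]) cs))" for ys1 ys2
  define \<beta> where "\<beta> m1 m2 ys1 ys2 = C * real (?k + m1 + m2 + 4) ^ e *
      (weight ys1 * weight ys2 * (?w / real \<sigma> ^ ((m1 + m2 + 2) + (length cs + Suc n))))" for m1 m2 ys1 ys2
  have \<beta>0: "\<beta> m1 m2 ys1 ys2 \<ge> 0" for m1 m2 ys1 ys2 unfolding \<beta>_def using C w0 weight_nonneg by simp
  have one: "Pr (E ys1 ys2 (a, b, u, z)) \<le> (p a * p b * p u * p z) * \<beta> m1 m2 ys1 ys2"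
    if ys: "ys1 \<in> lists_of W m1" "ys2 \<in> lists_of W m2" and mem: "(a, b, u, z) \<in> I ys1 ys2" for m1 m2 ys1 ys2 a b u z
  proof -
    let ?zs = "ys1 @ [a, b] @ ys2 @ [u]"
    have m: "a \<in> W" "b \<in> W" "u \<in> W" "z \<in> W" "fresh c (set S) ?zs" "z \<notin> set S \<union> set ?zs"
      using mem unfolding I_def by auto
    have sub: "set ?zs \<subseteq> W" using m ys by (auto simp: lists_of_def)
    have "a \<noteq> x" using fresh_distinct[OF m(5)] st by (auto simp: state_def)
    then have y: "\<exists>y\<in>set (?zs @ [z] @ S). y \<noteq> x" by auto
    from bd[unfolded bounded_by_def, rule_format, OF state_walk(2)[OF st m(5) sub m(4,6)] y]
    show ?thesis using ys
      by (simp add: E_def \<beta>_def lists_of_def add_ac mult_ac)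
  qed
  have per_m: "Pr (\<Union>ys1\<in>lists_of W m1. \<Union>ys2\<in>lists_of W m2. \<Union>q\<in>I ys1 ys2. E ys1 ys2 q)
      \<le> 3 ^ c * C * (real ?k ^ e' * ?base) * ((\<theta> ^ m1 * (real m1 + 4) ^ e') * (\<theta> ^ m2 * (real m2 + 4) ^ e'))" for m1 m2
  proof -
    let ?L1 = "lists_of W m1" and ?L2 = "lists_of W m2"
    let ?f = "(3 * (1 + real (?k + m1 + m2))\<^sup>2) ^ c"
    have inner: "Pr (\<Union>q\<in>I ys1 ys2. E ys1 ys2 q) \<le> ?f * (sum p W)\<^sup>2 * \<beta> m1 m2 ys1 ys2"
      if ys: "ys1 \<in> ?L1" "ys2 \<in> ?L2" for ys1 ys2
    proof -
      have finI: "finite (I ys1 ys2)" unfolding I_def by (auto intro: finite_subset[of _ "W \<times> W \<times> W \<times> W"])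
      have F: "finite (F ys1 ys2)" "F ys1 ys2 \<subseteq> words \<sigma> c" using ys SW W_words by (auto simp: F_def lists_of_def)
      have "F ys1 ys2 = set (S @ ys1 @ ys2)" by (auto simp: F_def)
      then have cF: "card (F ys1 ys2) \<le> ?k + m1 + m2"
        using card_length[of "S @ ys1 @ ys2"] ys by (simp add: lists_of_def)
      let ?t = "\<lambda>a b u z. of_bool (sdiff4 a b u z \<subseteq> (\<Union>w\<in>F ys1 ys2. position_chars w)) * (p a * p b * p u * p z)"
      have "Pr (\<Union>q\<in>I ys1 ys2. E ys1 ys2 q) \<le> (\<Sum>(a, b, u, z)\<in>I ys1 ys2. (p a * p b * p u * p z) * \<beta> m1 m2 ys1 ys2)"
        using one[OF ys] by (intro order.trans[OF Pr_UN_le[OF finI] sum_mono]) auto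
      also have "\<dots> = (\<Sum>(a, b, u, z)\<in>I ys1 ys2. ?t a b u z * \<beta> m1 m2 ys1 ys2)"
        by (intro sum.cong) (auto simp: I_def)
      also have "\<dots> \<le> (\<Sum>(a, b, u, z)\<in>W \<times> W \<times> W \<times> W. ?t a b u z * \<beta> m1 m2 ys1 ys2)"
      proof (rule sum_mono2)
        show "I ys1 ys2 \<subseteq> W \<times> W \<times> W \<times> W" unfolding I_def by auto
      qed (use \<beta>0 p_nonneg in auto)
      also have "\<dots> = (\<Sum>(a, b, u, z)\<in>W \<times> W \<times> W \<times> W. ?t a b u z) * \<beta> m1 m2 ys1 ys2"
        unfolding sum_distrib_right by (simp add: case_prod_beta)
      also have "\<dots> \<le> ((3 * (1 + real (card (F ys1 ys2)))\<^sup>2) ^ c * (sum p W)\<^sup>2) * \<beta> m1 m2 ys1 ys2"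
        using \<beta>0 F by (intro mult_right_mono sum_quadruples_le) auto
      also have "\<dots> \<le> (?f * (sum p W)\<^sup>2) * \<beta> m1 m2 ys1 ys2"
        using \<beta>0 cF by (intro mult_right_mono power_mono mult_left_mono) auto
      finally show ?thesis .
    qed
    have "Pr (\<Union>ys1\<in>?L1. \<Union>ys2\<in>?L2. \<Union>q\<in>I ys1 ys2. E ys1 ys2 q)
        \<le> (\<Sum>ys1\<in>?L1. \<Sum>ys2\<in>?L2. ?f * (sum p W)\<^sup>2 * \<beta> m1 m2 ys1 ys2)"
      by (intro order.trans[OF Pr_UN_le sum_mono] inner) auto
    also have "\<dots> = ?f * (C * real (?k + m1 + m2 + 4) ^ e) *
        (((sum p W)\<^sup>2 * ((\<Sum>ys1\<in>?L1. weight ys1) * (\<Sum>ys2\<in>?L2. weight ys2))) *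
          (?w / real \<sigma> ^ ((m1 + m2 + 2) + (length cs + Suc n))))"
      unfolding \<beta>_def sum_factor_2 by (simp only: mult_ac)
    also have "(sum p W)\<^sup>2 * ((\<Sum>ys1\<in>?L1. weight ys1) * (\<Sum>ys2\<in>?L2. weight ys2)) = sum p W ^ (m1 + m2 + 2)"
      unfolding sum_lists_of[OF finite_W] by (simp add: power_add mult_ac power2_eq_square)
    also have "?f * (C * real (?k + m1 + m2 + 4) ^ e) *
        (sum p W ^ (m1 + m2 + 2) * (?w / real \<sigma> ^ ((m1 + m2 + 2) + (length cs + Suc n))))
      \<le> ?f * (C * real (?k + m1 + m2 + 4) ^ e) * (\<theta> ^ (m1 + m2 + 2) * ?base)"
      using C by (intro mult_left_mono mean_power_div w0) auto
    also have "\<dots> \<le> ?f * (C * real (?k + m1 + m2 + 4) ^ e) * (\<theta> ^ (m1 + m2) * ?base)"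
      using C w0 \<theta> by (intro mult_left_mono mult_right_mono power_decreasing) auto
    also have "\<dots> \<le> (3 ^ c * C * (real ?k * ((real m1 + 4) * (real m2 + 4))) ^ e') * (\<theta> ^ (m1 + m2) * ?base)"
    proof (intro mult_right_mono)
      let ?x = "real ?k * ((real m1 + 4) * (real m2 + 4))"
      let ?y = "real (?k + m1 + m2 + 4)"
      have kx: "?y \<le> ?x" using add_le_times_2[of "real ?k" "real m1" "real m2"] k1 by auto
      have y1: "1 \<le> ?y" using k1 by simp
      have "?f * (C * ?y ^ e) = (3 ^ c * C) * ((1 + real (?k + m1 + m2)) ^ (2 * c) * ?y ^ e)"
      proof -
        have "?f = 3 ^ c * (1 + real (?k + m1 + m2)) ^ (2 * c)" by (simp only: power_mult_distrib power_mult)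
        then show ?thesis by (simp only: mult_ac)
      qed
      also have "\<dots> \<le> (3 ^ c * C) * (?y ^ (2 * c) * ?y ^ e)"
        using C by (intro mult_left_mono mult_right_mono power_mono) auto
      also have "\<dots> = (3 ^ c * C) * ?y ^ (2 * c + e)" by (simp only: power_add)
      also have "\<dots> \<le> (3 ^ c * C) * ?y ^ e'"
        using C e' y1 by (intro mult_left_mono power_increasing) auto
      also have "\<dots> \<le> (3 ^ c * C) * ?x ^ e'"
        using C kx by (intro mult_left_mono power_mono) auto
      finally show "?f * (C * ?y ^ e) \<le> 3 ^ c * C * ?x ^ e'" .
    qed (use w0 \<theta> in auto)
    finally show ?thesis by (simp add: power_mult_distrib power_add mult_ac)
  qed
  have "cycle_event i S K cs = (\<Union>m1\<in>{..N}. \<Union>m2\<in>{..N}. \<Union>ys1\<in>lists_of W m1. \<Union>ys2\<in>lists_of W m2. \<Union>q\<in>I ys1 ys2. E ys1 ys2 q)"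
    unfolding cycle_event_def I_def E_def F_def by (simp only: case_prod_eta)
  then have "Pr (cycle_event i S K cs) \<le> (\<Sum>m1\<le>N. \<Sum>m2\<le>N. 3 ^ c * C * (real ?k ^ e' * ?base) *
      ((\<theta> ^ m1 * (real m1 + 4) ^ e') * (\<theta> ^ m2 * (real m2 + 4) ^ e')))"
    by (simp only:) (intro order.trans[OF Pr_UN_le sum_mono] per_m finite_atMost)
  also have "\<dots> = 3 ^ c * C * (real ?k ^ e' * ?base) *
      ((\<Sum>m\<le>N. \<theta> ^ m * (real m + 4) ^ e') * (\<Sum>m\<le>N. \<theta> ^ m * (real m + 4) ^ e'))"
    by (simp only: sum_distrib_left sum_distrib_right sum_product mult_ac)
  also have "\<dots> \<le> 3 ^ c * C * (real ?k ^ e' * ?base) * (poly_geom \<theta> e' * poly_geom \<theta> e')"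
    using C w0 \<theta> by (intro mult_left_mono mult_mono sum_le_poly_geom poly_geom_nonneg sum_nonneg) auto
  finally show ?thesis by (simp only: mult_ac power2_eq_square)
qed

end

section \<open>Mixed tabulation\<close>

text \<open>Each walk contributes one factor, whose three summands belong to the gain, root cycle
  and cycle events.\<close>

fun chain_const :: "real \<Rightarrow> nat \<Rightarrow> nat \<Rightarrow> real" where
  "chain_const \<theta> c 0 = 1"
| "chain_const \<theta> c (Suc n) = (let q = poly_geom \<theta> (Suc n * (2 * c + 2)) in
     chain_const \<theta> c n * (2 * q + 3 ^ c * q + 3 ^ c * q\<^sup>2))"

lemma chain_const_nonneg: "0 < \<theta> \<Longrightarrow> \<theta> < 1 \<Longrightarrow> chain_const \<theta> c n \<ge> 0"
  by (induction n) (auto simp: Let_def intro!: mult_nonneg_nonneg add_nonneg_nonneg poly_geom_nonneg)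

fun star :: "nat \<Rightarrow> nat list \<Rightarrow> nat list list \<Rightarrow> (nat \<times> nat list \<times> nat list) list" where
  "star t x [] = []"
| "star t x (y # ys) = (t, x, y) # star (Suc t) x ys"

lemma length_star [simp]: "length (star t x ys) = length ys"
  by (induction ys arbitrary: t) auto

lemma star_keys: "(t', u, v) \<in> set (star t x ys) \<Longrightarrow> t \<le> t' \<and> t' < t + length ys \<and> u = x \<and> v \<in> set ys"
  by (induction ys arbitrary: t) fastforce+

text \<open>Each collision of the star is a nonzero vector, because \<open>x\<close> differs from
  its partner, and no other constraint concerns its derived position.\<close>

lemma gf2_indep_star:
  assumes "gf2_indep (map constraint_set cs)" "\<forall>(t', u, v)\<in>set cs. t' < t"
    and "x \<in> words \<sigma> c" "set ys \<subseteq> words \<sigma> c" "x \<notin> set ys"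
  shows "gf2_indep (map constraint_set (star t x ys @ cs))"
  using assms
proof (induction ys arbitrary: t)
  case (Cons y ys)
  have "position_chars x \<noteq> position_chars y"
    using position_chars_inj[of x y] Cons.prems by (auto simp: length_words)
  then obtain \<alpha> where \<alpha>: "(\<alpha> \<in> position_chars x) \<noteq> (\<alpha> \<in> position_chars y)" by blast
  then have "(t, \<alpha>) \<in> constraint_set (t, x, y)" by (cases \<alpha>) simp
  moreover have "(t, \<alpha>) \<notin> constraint_set q" if q: "q \<in> set (star (Suc t) x ys @ cs)" for q
  proof -
    obtain t' u v where q_eq: "q = (t', u, v)" by (cases q)
    have "t' \<noteq> t" using q star_keys[of t' u v "Suc t" x ys] Cons.prems(2) unfolding q_eq by auto
    then show ?thesis by (auto simp: q_eq constraint_set_def)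
  qed
  then have "(t, \<alpha>) \<notin> \<Union> (set (map constraint_set (star (Suc t) x ys @ cs)))" by auto
  ultimately have "constraint_set (t, x, y) \<notin> gf2_span (map constraint_set (star (Suc t) x ys @ cs))"
    using gf2_span_subset by blast
  moreover have "gf2_indep (map constraint_set (star (Suc t) x ys @ cs))"
    using Cons.prems by (intro Cons.IH) (auto simp: less_Suc_eq)
  ultimately show ?case by simp
qed simp

lemma exists_star:
  assumes "blocked c d T A" "x \<in> A" "t + n \<le> d"
  shows "\<exists>ys. length ys = n \<and> set ys \<subseteq> A - {x} \<and> satisfies (star t x ys) T"
  using assms(3)
proof (induction n arbitrary: t)
  case 0
  then show ?case by auto
next
  case (Suc n)
  then have "t < d" by simp
  then obtain y where y: "y \<in> A" "y \<noteq> x" "h1_char T t y = h1_char T t x"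
    using assms(1,2) unfolding blocked_def by blast
  obtain ys where "length ys = n" "set ys \<subseteq> A - {x}" "satisfies (star (Suc t) x ys) T"
    using Suc.IH[of "Suc t"] Suc.prems by auto
  then show ?case using y by (intro exI[of _ "y # ys"]) (simp add: satisfies_Cons)
qed

context rooted_tabulation
begin

lemma Pr_step:
  assumes bd: "bounded_by C e n (Suc i)" and C: "C \<ge> 0" and st: "state i S K cs" and e': "e + 2 * c + 2 \<le> e'"
  shows "Pr (gain_event i S K cs \<union> root_cycle_event i S K cs \<union> cycle_event i S K cs) \<le>
    C * (2 * poly_geom \<theta> e' + 3 ^ c * poly_geom \<theta> e' + 3 ^ c * (poly_geom \<theta> e')\<^sup>2) *
      (real (length S) ^ e' * (weight K / real \<sigma> ^ (length cs + Suc n)))"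
proof -
  have "Pr (gain_event i S K cs \<union> root_cycle_event i S K cs \<union> cycle_event i S K cs) \<le>
      Pr (gain_event i S K cs) + Pr (root_cycle_event i S K cs) + Pr (cycle_event i S K cs)"
    by (rule order.trans[OF Pr_Un_le add_right_mono[OF Pr_Un_le]])
  also have "\<dots> \<le> 2 * C * poly_geom \<theta> e' * (real (length S) ^ e' * (weight K / real \<sigma> ^ (length cs + Suc n))) +
      3 ^ c * C * poly_geom \<theta> e' * (real (length S) ^ e' * (weight K / real \<sigma> ^ (length cs + Suc n))) +
      3 ^ c * C * (poly_geom \<theta> e')\<^sup>2 * (real (length S) ^ e' * (weight K / real \<sigma> ^ (length cs + Suc n)))"
    by (intro add_mono Pr_gain_event[OF bd C st e'] Pr_root_cycle_event[OF bd C st e'] Pr_cycle_event[OF bd C st e'])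
  finally show ?thesis by (simp only: distrib_left distrib_right mult_ac)
qed

text \<open>The second known key makes \<open>full_event\<close> empty, so the recursion runs over
  the other three outcomes, one pair of positions at a time.\<close>

lemma bounded_by_chain: "2 * (i + n) \<le> d \<Longrightarrow> bounded_by (chain_const \<theta> c n) (n * (2 * c + 2)) n i"
proof (induction n arbitrary: i)
  case 0
  then show ?case using bounded_by_0[of i] by simp
next
  case (Suc n)
  have bd: "bounded_by (chain_const \<theta> c n) (n * (2 * c + 2)) n (Suc i)" using Suc.prems by (intro Suc.IH) simp
  have i: "Suc (2 * i) < d" using Suc.prems by simp
  have e': "n * (2 * c + 2) + 2 * c + 2 \<le> Suc n * (2 * c + 2)" by simp
  show ?case unfolding bounded_by_def
  proof (intro allI impI)
    fix S K cs assume st: "state i S K cs" and y: "\<exists>y\<in>set S. y \<noteq> x"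
    have "full_event i S K cs = {}" using y full_event_empty by blast
    then have "explored S K cs \<subseteq> gain_event i S K cs \<union> root_cycle_event i S K cs \<union> cycle_event i S K cs"
      using explored_subset[OF st i] by simp
    from order.trans[OF Pr_mono[OF this] Pr_step[OF bd chain_const_nonneg[OF \<theta>] st e']]
    show "Pr (explored S K cs) \<le> chain_const \<theta> c (Suc n) * real (length S) ^ (Suc n * (2 * c + 2)) *
        (weight K / real \<sigma> ^ (length cs + Suc n))"
      unfolding chain_const.simps Let_def by (simp only: mult.assoc)
  qed
qed

lemma state_root: "state 0 [x] [x] []"
  unfolding state_def using x_B B_W by auto

text \<open>All keys of the obstruction are known, so beyond the positions 0 and 1 of the walk every
  position offers a collision of \<open>x\<close> with one of at most \<open>m + 2\<close> keys.
  This saves a factor per position instead of per pair. Only \<open>zs\<close> and \<open>x\<close>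
  are charged, which is a proper subset; \<open>z\<close> is one of at most
  \<open>(m + 1) ^ c\<close> candidates.\<close>

lemma Pr_full_event:
  assumes n: "2 + n \<le> d"
  shows "Pr (full_event 0 [x] [x] []) \<le> poly_geom \<theta> (c + n) * (p x / real \<sigma> ^ n)"
proof -
  have xW: "x \<in> W" using x_B B_W by blast
  define G where "G zs ps = {T. satisfies (star 2 x ps @ walk_cs 0 zs []) (fst T) \<and>
    (\<forall>A\<subseteq>set (zs @ [x]). \<not> blocked c d (fst T) A) \<and> set (zs @ [x]) \<subseteq> Y T}" for zs ps
  define Ps where "Ps zs z = {ps. set ps \<subseteq> set (zs @ [z, x]) \<and> length ps = n \<and> x \<notin> set ps}" for zs z
  define Z where "Z zs = {z \<in> W. z \<in> char_closure c (set (zs @ [x]))}" for zs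
  define L where "L m = {zs \<in> lists_of W m. fresh c {x} zs}" for m
  have finL: "finite (L m)" for m unfolding L_def by simp
  have finZ: "finite (Z zs)" for zs unfolding Z_def by simp
  have sub: "full_event 0 [x] [x] [] \<subseteq> (\<Union>m\<in>{..N}. \<Union>zs\<in>L m. \<Union>z\<in>Z zs. \<Union>ps\<in>Ps zs z. G zs ps)"
  proof
    fix T assume "T \<in> full_event 0 [x] [x] []"
    then obtain zs z where T: "fresh c {x} zs" "set zs \<subseteq> W" "z \<in> W" "z \<in> char_closure c (set (zs @ [x]))"
      "satisfies (walk_cs 0 zs []) (fst T)" "min_blocked (fst T) (set (zs @ [z] @ [x]))"
      "set (zs @ [z] @ [x]) \<subseteq> Y T" "set (zs @ [x]) \<subset> set (zs @ [z] @ [x])"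
      unfolding full_event_def by auto
    let ?A = "set (zs @ [z] @ [x])"
    have "blocked c d (fst T) ?A" using T(6) by (simp add: min_blocked_def)
    from exists_star[OF this _ n, of x] obtain ps where
      ps: "length ps = n" "set ps \<subseteq> ?A - {x}" "satisfies (star 2 x ps) (fst T)" by auto
    have "ps \<in> Ps zs z" using ps unfolding Ps_def by auto
    moreover have "T \<in> G zs ps"
    proof -
      have "\<forall>A\<subseteq>set (zs @ [x]). \<not> blocked c d (fst T) A" using T(6,8) unfolding min_blocked_def by blast
      moreover have "set (zs @ [x]) \<subseteq> Y T" using T(7,8) by blast
      ultimately show ?thesis using T(5) ps(3) unfolding G_def satisfies_append by blast
    qed
    moreover have "z \<in> Z zs" using T unfolding Z_def by blast
    moreover have "zs \<in> L (length zs)" using T(1,2) by (simp add: L_def lists_of_def)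
    moreover have "length zs \<in> {..N}"
      using fresh_distinct[OF T(1)] card_mono[OF finite_W T(2)] by (metis atMost_iff distinct_card)
    ultimately show "T \<in> (\<Union>m\<in>{..N}. \<Union>zs\<in>L m. \<Union>z\<in>Z zs. \<Union>ps\<in>Ps zs z. G zs ps)" by blast
  qed
  define \<beta> where "\<beta> m zs = weight zs * (p x / real \<sigma> ^ (m + n))" for m zs
  have \<beta>0: "\<beta> m zs \<ge> 0" for m zs unfolding \<beta>_def using weight_nonneg p_nonneg by simp
  have one: "Pr (G zs ps) \<le> \<beta> m zs" if zs: "zs \<in> L m" and z: "z \<in> Z zs" and ps: "ps \<in> Ps zs z" for m zs z ps
  proof -
    have fr: "fresh c {x} zs" and zsW: "set zs \<subseteq> W" and len: "length zs = m" and zW: "z \<in> W"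
      using zs z by (auto simp: L_def lists_of_def Z_def)
    have st: "state (Suc 0) (zs @ [z] @ [x]) (zs @ [x]) (walk_cs 0 zs [])"
      using state_walk(1)[OF state_root _ zsW zW] fr by simp
    have psW: "set ps \<subseteq> words \<sigma> c" and xps: "x \<notin> set ps" and lps: "length ps = n"
      using ps zsW zW xW W_words by (auto simp: Ps_def)
    have tags: "\<forall>(t, u, v)\<in>set (walk_cs 0 zs []). t < 2 \<and> u \<in> words \<sigma> c \<and> v \<in> words \<sigma> c"
    proof clarify
      fix t u v assume "(t, u, v) \<in> set (walk_cs 0 zs [])"
      then have "t < 2 * Suc 0" "u \<in> set (zs @ [z] @ [x])" "v \<in> set (zs @ [z] @ [x])"
        using st unfolding state_def by blast+
      moreover have "set (zs @ [z] @ [x]) \<subseteq> words \<sigma> c" using st W_words unfolding state_def by blast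
      ultimately show "t < 2 \<and> u \<in> words \<sigma> c \<and> v \<in> words \<sigma> c" by auto
    qed
    have "gf2_indep (map constraint_set (star 2 x ps @ walk_cs 0 zs []))"
      using tags xps psW xW W_words st by (intro gf2_indep_star) (auto simp: state_def)
    moreover have "\<forall>(t, u, v)\<in>set (star 2 x ps @ walk_cs 0 zs []). t < d \<and> u \<in> words \<sigma> c \<and> v \<in> words \<sigma> c"
    proof clarify
      fix t u v assume "(t, u, v) \<in> set (star 2 x ps @ walk_cs 0 zs [])"
      then consider "(t, u, v) \<in> set (star 2 x ps)" | "(t, u, v) \<in> set (walk_cs 0 zs [])" by auto
      then show "t < d \<and> u \<in> words \<sigma> c \<and> v \<in> words \<sigma> c"
      proof cases
        case 1
        from star_keys[OF this] show ?thesis using lps n psW xW W_words by auto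
      next
        case 2
        then have "t < 2 \<and> u \<in> words \<sigma> c \<and> v \<in> words \<sigma> c" using tags by blast
        then show ?thesis using n by auto
      qed
    qed
    moreover have "set (zs @ [x]) \<subseteq> W" using zsW xW by simp
    ultimately have "Pr (G zs ps) \<le> (\<Prod>y\<in>set (zs @ [x]). p y) / real \<sigma> ^ length (star 2 x ps @ walk_cs 0 zs [])"
      unfolding G_def by (rule Pr_satisfies_selected)
    also have "(\<Prod>y\<in>set (zs @ [x]). p y) = weight (zs @ [x])"
      using st by (simp only: state_def prod.distinct_set_conv_list)
    finally show ?thesis using len lps by (simp add: \<beta>_def add.commute)
  qed
  have per_m: "Pr (\<Union>zs\<in>L m. \<Union>z\<in>Z zs. \<Union>ps\<in>Ps zs z. G zs ps)
      \<le> (p x / real \<sigma> ^ n) * (\<theta> ^ m * (real m + 4) ^ (c + n))" for m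
  proof -
    let ?f = "real ((m + 1) ^ c) * real ((m + 2) ^ n)"
    have "Pr (\<Union>zs\<in>L m. \<Union>z\<in>Z zs. \<Union>ps\<in>Ps zs z. G zs ps) \<le> (\<Sum>zs\<in>L m. ?f * \<beta> m zs)"
    proof (rule order.trans[OF Pr_UN_le[OF finL] sum_mono])
      fix zs assume zs: "zs \<in> L m"
      then have len: "length zs = m" by (simp add: L_def lists_of_def)
      have "Pr (\<Union>z\<in>Z zs. \<Union>ps\<in>Ps zs z. G zs ps) \<le> real ((m + 1) ^ c) * (real ((m + 2) ^ n) * \<beta> m zs)"
      proof (rule Pr_UN_const[OF finZ])
        have "card (Z zs) \<le> card {z \<in> words \<sigma> c. z \<in> char_closure c (set (zs @ [x]))}"
          unfolding Z_def using W_words by (intro card_mono) auto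
        also have "\<dots> \<le> length (zs @ [x]) ^ c" by (rule card_char_closure_le)
        finally show "card (Z zs) \<le> (m + 1) ^ c" using len by simp
        fix z assume z: "z \<in> Z zs"
        show "Pr (\<Union>ps\<in>Ps zs z. G zs ps) \<le> real ((m + 2) ^ n) * \<beta> m zs"
        proof (rule Pr_UN_const)
          let ?A = "set (zs @ [z, x])"
          have sub: "Ps zs z \<subseteq> {ps. set ps \<subseteq> ?A \<and> length ps = n}" unfolding Ps_def by auto
          have fin: "finite {ps. set ps \<subseteq> ?A \<and> length ps = n}" by (intro finite_lists_length_eq) auto
          show "finite (Ps zs z)" using finite_subset[OF sub fin] .
          have "card (Ps zs z) \<le> card ?A ^ n"
            using card_mono[OF fin sub] by (simp only: card_lists_length_eq finite_set)
          also have "\<dots> \<le> (m + 2) ^ n" using card_length[of "zs @ [z, x]"] len by (intro power_mono) auto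
          finally show "card (Ps zs z) \<le> (m + 2) ^ n" .
        qed (use one[OF zs z] \<beta>0 in auto)
      qed (use \<beta>0 in auto)
      then show "Pr (\<Union>z\<in>Z zs. \<Union>ps\<in>Ps zs z. G zs ps) \<le> ?f * \<beta> m zs" by (simp only: mult.assoc)
    qed
    also have "\<dots> \<le> (\<Sum>zs\<in>lists_of W m. ?f * \<beta> m zs)"
      using \<beta>0 unfolding L_def by (intro sum_mono2) (auto intro!: mult_nonneg_nonneg)
    also have "\<dots> = ?f * (sum p W ^ m * (p x / real \<sigma> ^ (m + n)))"
      unfolding \<beta>_def sum_lists_of[OF finite_W, symmetric] sum_distrib_left sum_distrib_right by (rule refl)
    also have "\<dots> \<le> ?f * (\<theta> ^ m * (p x / real \<sigma> ^ n))"
      by (intro mult_left_mono mean_power_div p_nonneg) auto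
    also have "\<dots> \<le> (real m + 4) ^ (c + n) * (\<theta> ^ m * (p x / real \<sigma> ^ n))"
    proof (intro mult_right_mono)
      show "?f \<le> (real m + 4) ^ (c + n)"
        unfolding power_add of_nat_power by (intro mult_mono power_mono) auto
    qed (use \<theta> p_nonneg in auto)
    finally show ?thesis by (simp only: mult_ac)
  qed
  have "Pr (full_event 0 [x] [x] []) \<le> (\<Sum>m\<le>N. (p x / real \<sigma> ^ n) * (\<theta> ^ m * (real m + 4) ^ (c + n)))"
    by (rule order.trans[OF Pr_mono[OF sub]]) (intro order.trans[OF Pr_UN_le sum_mono] per_m finite_atMost)
  also have "\<dots> = (p x / real \<sigma> ^ n) * (\<Sum>m\<le>N. \<theta> ^ m * (real m + 4) ^ (c + n))"
    by (simp only: sum_distrib_left)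
  also have "\<dots> \<le> (p x / real \<sigma> ^ n) * poly_geom \<theta> (c + n)"
    using p_nonneg \<theta> by (intro mult_left_mono sum_le_poly_geom) auto
  finally show ?thesis by (simp only: mult.commute)
qed

text \<open>Only the first walk starts with \<open>S = {x}\<close>, so this is the one place where
  \<open>full_event\<close> counts. There the \<open>2 * n\<close> remaining positions save enough,
  since \<open>2 * n\<close> is at least \<open>Suc n\<close>.\<close>

lemma Pr_explored_root:
  assumes "2 * Suc n \<le> d" "1 \<le> n"
  shows "Pr (explored [x] [x] []) \<le> (chain_const \<theta> c (Suc n) + poly_geom \<theta> (c + 2 * n)) * (p x / real \<sigma> ^ Suc n)"
proof -
  let ?e = "n * (2 * c + 2)" and ?e' = "Suc n * (2 * c + 2)"
  have bd: "bounded_by (chain_const \<theta> c n) ?e n (Suc 0)" using assms by (intro bounded_by_chain) simp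
  have e': "?e + 2 * c + 2 \<le> ?e'" by simp
  from Pr_step[OF bd chain_const_nonneg[OF \<theta>] state_root e']
  have 1: "Pr (gain_event 0 [x] [x] [] \<union> root_cycle_event 0 [x] [x] [] \<union> cycle_event 0 [x] [x] [])
      \<le> chain_const \<theta> c (Suc n) * (p x / real \<sigma> ^ Suc n)"
    unfolding chain_const.simps Let_def by simp
  have "Pr (full_event 0 [x] [x] []) \<le> poly_geom \<theta> (c + 2 * n) * (p x / real \<sigma> ^ (2 * n))"
    using assms by (intro Pr_full_event) simp
  also have "\<dots> \<le> poly_geom \<theta> (c + 2 * n) * (p x / real \<sigma> ^ Suc n)"
  proof (intro mult_left_mono divide_left_mono)
    show "real \<sigma> ^ Suc n \<le> real \<sigma> ^ (2 * n)" using assms(2) \<sigma>_pos by (intro power_increasing) auto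
  qed (use p_nonneg \<theta> poly_geom_nonneg \<sigma>_pos in auto)
  finally have 2: "Pr (full_event 0 [x] [x] []) \<le> poly_geom \<theta> (c + 2 * n) * (p x / real \<sigma> ^ Suc n)" .
  have "Pr (explored [x] [x] []) \<le> Pr (gain_event 0 [x] [x] [] \<union> root_cycle_event 0 [x] [x] [] \<union> cycle_event 0 [x] [x] [] \<union> full_event 0 [x] [x] [])"
    using assms by (intro Pr_mono explored_subset state_root) simp
  also have "\<dots> \<le> chain_const \<theta> c (Suc n) * (p x / real \<sigma> ^ Suc n) + poly_geom \<theta> (c + 2 * n) * (p x / real \<sigma> ^ Suc n)"
    by (rule order.trans[OF Pr_Un_le add_mono[OF 1 2]])
  finally show ?thesis by (simp only: distrib_right)
qed

end

section \<open>Union bound over the roots\<close>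

context mixed_tabulation
begin

text \<open>A single key is never blocked, because \<open>c \<ge> 1\<close> would require its first
  character to be shared. This identifies \<open>p\<close> as the selection probability and turns
  the hypothesis on the mean into a bound on \<open>sum p W\<close>.\<close>

lemma Pr_selected:
  assumes "c \<ge> 1" "z \<in> W"
  shows "Pr {T. z \<in> Y T} = p z"
proof -
  have "\<not> blocked c d T1 A" if "A \<subseteq> {z}" for T1 A
  proof
    assume b: "blocked c d T1 A"
    then obtain y where y: "y \<in> A" unfolding blocked_def by blast
    have "0 < c" using assms(1) by simp
    with b y obtain w where "w \<in> A" "w \<noteq> y" unfolding blocked_def by blast
    with y that show False by blast
  qed
  then have "real (card {T2 \<in> \<Omega>2. {z} \<subseteq> Y (T1, T2)}) = real (card \<Omega>2) * (\<Prod>z\<in>{z}. p z)" if "T1 \<in> \<Omega>1" for T1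
    using that assms(2) by (intro card_selected_second) auto
  then have inner: "real (card {T2 \<in> \<Omega>2. z \<in> Y (T1, T2)}) = real (card \<Omega>2) * p z" if "T1 \<in> \<Omega>1" for T1
    using that by simp
  have "\<Omega>1 \<times> \<Omega>2 \<inter> {T. z \<in> Y T} = (SIGMA T1:\<Omega>1. {T2 \<in> \<Omega>2. z \<in> Y (T1, T2)})" by auto
  then have "real (card (\<Omega>1 \<times> \<Omega>2 \<inter> {T. z \<in> Y T})) = (\<Sum>T1\<in>\<Omega>1. real (card {T2 \<in> \<Omega>2. z \<in> Y (T1, T2)}))"
    using \<Omega>_props by (simp add: card_SigmaI)
  also have "\<dots> = real (card \<Omega>1) * (real (card \<Omega>2) * p z)" using inner by simp
  finally have eq: "real (card (\<Omega>1 \<times> \<Omega>2 \<inter> {T. z \<in> Y T})) = real (card \<Omega>1) * (real (card \<Omega>2) * p z)" .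
  have c: "real (card \<Omega>1) \<noteq> 0" "real (card \<Omega>2) \<noteq> 0"
    using \<Omega>_props by (auto simp: card_eq_0_iff)
  have "a * (b * q) / (a * b) = q" if "a \<noteq> 0" "b \<noteq> 0" for a b q :: real using that by simp
  then show ?thesis unfolding Pr_eq eq using c by blast
qed

lemma finite_set_mixed_pmf: "finite (set_pmf (mixed_pmf \<sigma> c d r))"
  unfolding mixed_pmf_eq using \<Omega>_props by (subst set_pmf_of_set) auto

lemma expectation_card_Y:
  assumes "c \<ge> 1"
  shows "measure_pmf.expectation (mixed_pmf \<sigma> c d r) (\<lambda>T. real (card (Y T))) = sum p W"
proof -
  have "real (card (Y T)) = (\<Sum>z\<in>W. indicator {T. z \<in> Y T} T)" for T
  proof -
    have "(\<Sum>z\<in>W. indicator {T. z \<in> Y T} T :: real) = (\<Sum>z\<in>W. indicator (Y T) z)"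
      by (intro sum.cong) (auto simp: indicator_def)
    also have "\<dots> = real (card (W \<inter> Y T))" by (simp add: indicator_def)
    also have "W \<inter> Y T = Y T" by (auto simp: Y_def)
    finally show ?thesis by simp
  qed
  then have "measure_pmf.expectation (mixed_pmf \<sigma> c d r) (\<lambda>T. real (card (Y T))) =
      measure_pmf.expectation (mixed_pmf \<sigma> c d r) (\<lambda>T. \<Sum>z\<in>W. indicator {T. z \<in> Y T} T)" by (simp only:)
  also have "\<dots> = (\<Sum>z\<in>W. measure_pmf.expectation (mixed_pmf \<sigma> c d r) (indicator {T. z \<in> Y T}))"
    by (intro Bochner_Integration.integral_sum integrable_measure_pmf_finite finite_set_mixed_pmf)
  also have "\<dots> = (\<Sum>z\<in>W. p z)"
    by (intro sum.cong refl) (simp add: Pr_selected[OF assms])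
  finally show ?thesis .
qed

text \<open>In the degeneracy order the obstruction is explored from its first key, which therefore lies in few
  zero-sum quadruples of later keys.\<close>

lemma Pr_exists_blocked:
  assumes c: "c \<ge> 1" and \<theta>: "0 < \<theta>" "\<theta> < 1" and mean: "sum p W \<le> \<theta> * real \<sigma>"
    and n: "2 * Suc n \<le> d" "1 \<le> n"
  shows "Pr {T. \<exists>A\<subseteq>Y T. blocked c d (fst T) A} \<le> (chain_const \<theta> c (Suc n) + poly_geom \<theta> (c + 2 * n)) / real \<sigma> ^ n"
proof -
  let ?C = "chain_const \<theta> c (Suc n) + poly_geom \<theta> (c + 2 * n)"
  have C0: "?C \<ge> 0" using \<theta> by (intro add_nonneg_nonneg chain_const_nonneg poly_geom_nonneg)
  obtain \<rho> :: "nat list \<Rightarrow> nat" where \<rho>: "\<And>x. x \<in> W \<Longrightarrow>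
      p x = 0 \<or> zero_degree {y \<in> W. \<rho> x \<le> \<rho> y} x \<le> 3 ^ c * sum p W"
    using degeneracy_order[OF finite_W, of "\<lambda>x A. p x = 0 \<or> zero_degree A x \<le> 3 ^ c * sum p W"]
      exists_small_zero_degree by blast
  define E where "E x = {T. \<exists>A. min_blocked (fst T) A \<and> A \<subseteq> Y T \<and> A \<subseteq> {y \<in> W. \<rho> x \<le> \<rho> y} \<and> x \<in> A}" for x
  have "{T. \<exists>A\<subseteq>Y T. blocked c d (fst T) A} \<subseteq> (\<Union>x\<in>W. E x)"
  proof
    fix T assume "T \<in> {T. \<exists>A\<subseteq>Y T. blocked c d (fst T) A}"
    then obtain A0 where A0: "A0 \<subseteq> Y T" "blocked c d (fst T) A0" by blast
    have finY: "finite (Y T)" by (rule finite_subset[OF _ finite_W]) (auto simp: Y_def)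
    let ?F = "{A. A \<subseteq> Y T \<and> blocked c d (fst T) A}"
    have "finite ?F" by (rule finite_subset[of _ "Pow (Y T)"]) (use finY in auto)
    moreover have "?F \<noteq> {}" using A0 by blast
    ultimately have "\<exists>A\<in>?F. \<forall>A'\<in>?F. A' \<le> A \<longrightarrow> A = A'" by (rule finite_has_minimal)
    then obtain A where A: "A \<in> ?F" and min: "\<forall>A'\<in>?F. A' \<subseteq> A \<longrightarrow> A = A'" by (rule bexE)
    have "min_blocked (fst T) A"
      unfolding min_blocked_def
    proof (intro conjI allI impI notI)
      show "blocked c d (fst T) A" using A by blast
      fix A' assume "A' \<subset> A" "blocked c d (fst T) A'"
      then have "A' \<in> ?F" "A' \<subseteq> A" using A by auto
      then have "A = A'" using min by blast
      then show False using \<open>A' \<subset> A\<close> by blast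
    qed
    have AW: "A \<subseteq> W" using A by (auto simp: Y_def)
    have "A \<noteq> {}" using A by (auto simp: blocked_def)
    moreover have "finite A" using AW finite_W finite_subset by blast
    ultimately have "Min (\<rho> ` A) \<in> \<rho> ` A" by (intro Min_in) auto
    then obtain x where x: "x \<in> A" and xmin: "Min (\<rho> ` A) = \<rho> x" by blast
    have "\<rho> x \<le> \<rho> y" if "y \<in> A" for y
      using that \<open>finite A\<close> unfolding xmin[symmetric] by (intro Min_le) auto
    then have sub: "A \<subseteq> {y \<in> W. \<rho> x \<le> \<rho> y}" using AW by blast
    have mb: "min_blocked (fst T) A" by fact
    have AY: "A \<subseteq> Y T" using A by blast
    have "T \<in> E x" unfolding E_def mem_Collect_eq by (intro exI[of _ A] conjI mb AY sub x)
    moreover have "x \<in> W" using x AW by blast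
    ultimately show "T \<in> (\<Union>x\<in>W. E x)" by (rule UN_I[rotated])
  qed
  then have "Pr {T. \<exists>A\<subseteq>Y T. blocked c d (fst T) A} \<le> (\<Sum>x\<in>W. Pr (E x))"
    by (rule order.trans[OF Pr_mono Pr_UN_le[OF finite_W]])
  also have "\<dots> \<le> (\<Sum>x\<in>W. ?C * (p x / real \<sigma> ^ Suc n))"
  proof (rule sum_mono)
    fix x assume xW: "x \<in> W"
    show "Pr (E x) \<le> ?C * (p x / real \<sigma> ^ Suc n)"
    proof (cases "p x = 0")
      case True
      \<comment> \<open>A root excepted from the degree bound is selected with probability
        0.\<close>
      have "E x \<subseteq> {T. x \<in> Y T}" unfolding E_def by blast
      then have "Pr (E x) \<le> p x" using Pr_mono Pr_selected[OF c xW] by metis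
      then show ?thesis using True by simp
    next
      case False
      let ?B = "{y \<in> W. \<rho> x \<le> \<rho> y}"
      interpret rooted_tabulation s c d r \<sigma> W g \<theta> x ?B
        by unfold_locales (use \<theta> mean xW \<rho>[OF xW] False in auto)
      have "E x \<subseteq> explored [x] [x] []"
      proof
        fix T assume "T \<in> E x"
        then obtain A where A: "min_blocked (fst T) A" "A \<subseteq> Y T" "A \<subseteq> ?B" "x \<in> A" unfolding E_def by blast
        have "0 < c" using c by simp
        then obtain w where "w \<in> A" "w \<noteq> x" using A(1,4) unfolding min_blocked_def blocked_def by blast
        then have "set [x] \<subset> A" using A(4) by auto
        then show "T \<in> explored [x] [x] []" unfolding explored_def using A by auto
      qed
      from order.trans[OF Pr_mono[OF this] Pr_explored_root[OF n]] show ?thesis .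
    qed
  qed
  \<comment> \<open>The root is charged but has no collision paying for it. Its sum costs one of the
    \<open>Suc n\<close> saved factors, which is the 1 in the exponent of the theorem.\<close>
  also have "\<dots> = ?C * (sum p W / real \<sigma> ^ Suc n)" by (simp only: sum_distrib_left sum_divide_distrib)
  also have "\<dots> \<le> ?C * (real \<sigma> / real \<sigma> ^ Suc n)"
  proof (intro mult_left_mono divide_right_mono C0)
    have "\<theta> * real \<sigma> \<le> 1 * real \<sigma>" using \<theta> by (intro mult_right_mono) auto
    then show "sum p W \<le> real \<sigma>" using mean by simp
  qed auto
  also have "\<dots> = ?C / real \<sigma> ^ n" using \<sigma>_pos by simp
  finally show ?thesis .
qed

lemma not_peelable_blocked:
  assumes T: "T \<in> \<Omega>1 \<times> \<Omega>2" and "\<not> peelable (extend_key d (fst T) ` Y T)"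
  shows "\<exists>A\<subseteq>Y T. blocked c d (fst T) A"
proof -
  let ?e = "extend_key d (fst T)"
  have T1: "fst T \<in> \<Omega>1" using T by auto
  have YW: "Y T \<subseteq> words \<sigma> c" using W_words by (auto simp: Y_def)
  from assms(2) obtain S where sub: "S \<subseteq> ?e ` Y T" "S \<noteq> {}"
    and no: "\<not> (\<exists>z \<in> S. \<exists>\<alpha> \<in> position_chars z. \<forall>w \<in> S - {z}. \<alpha> \<notin> position_chars w)"
    unfolding peelable_def not_all not_imp by (elim exE conjE)
  have S: "\<exists>w\<in>S - {z}. \<alpha> \<in> position_chars w" if "z \<in> S" "\<alpha> \<in> position_chars z" for z \<alpha>
  proof (rule ccontr)
    assume "\<not> ?thesis"
    then have "\<forall>w \<in> S - {z}. \<alpha> \<notin> position_chars w" by blast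
    then show False using no that by blast
  qed
  have "all_shared (c + d) S" unfolding all_shared_def
  proof (intro ballI allI impI)
    fix z i assume z: "z \<in> S" and i: "i < c + d"
    from z sub(1) obtain y where y: "y \<in> Y T" "z = ?e y" by blast
    have "y \<in> words \<sigma> c" using y(1) YW by blast
    from extend_key_words(1)[OF \<sigma>_def T1 this] have "z \<in> words \<sigma> (c + d)" unfolding y(2) .
    then have "(i, z ! i) \<in> position_chars z" using i by (simp add: length_words)
    from S[OF z this] show "\<exists>w\<in>S. w \<noteq> z \<and> w ! i = z ! i" by auto
  qed
  moreover obtain A where A: "A \<subseteq> Y T" "S = ?e ` A" using sub(1) by (meson subset_imageE)
  moreover have "A \<noteq> {}" using A(2) sub(2) by blast
  ultimately have "blocked c d (fst T) A"
    using all_shared_extend_key[OF \<sigma>_def T1, of A] YW by auto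
  then show ?thesis using A by blast
qed

lemma Pr_peelable:
  assumes "c \<ge> 1" "0 < \<theta>" "\<theta> < 1" "sum p W \<le> \<theta> * real \<sigma>" "2 * Suc n \<le> d" "1 \<le> n"
  shows "1 - (chain_const \<theta> c (Suc n) + poly_geom \<theta> (c + 2 * n)) / real \<sigma> ^ n
    \<le> Pr {T. peelable (extend_key d (fst T) ` Y T)}"
proof -
  let ?E = "{T. peelable (extend_key d (fst T) ` Y T)}"
  have "AE T in measure_pmf (mixed_pmf \<sigma> c d r). T \<in> \<Omega>1 \<times> \<Omega>2"
    unfolding mixed_pmf_eq AE_measure_pmf_iff using \<Omega>_props by (subst set_pmf_of_set) auto
  then have "AE T in measure_pmf (mixed_pmf \<sigma> c d r). T \<in> UNIV - ?E \<longrightarrow> T \<in> {T. \<exists>A\<subseteq>Y T. blocked c d (fst T) A}"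
    using not_peelable_blocked by (auto elim!: AE_mp)
  then have "Pr (UNIV - ?E) \<le> Pr {T. \<exists>A\<subseteq>Y T. blocked c d (fst T) A}"
    by (intro measure_pmf.finite_measure_mono_AE) auto
  also have "\<dots> \<le> (chain_const \<theta> c (Suc n) + poly_geom \<theta> (c + 2 * n)) / real \<sigma> ^ n"
    by (rule Pr_exists_blocked[OF assms])
  finally show ?thesis using measure_pmf.prob_compl[of ?E "mixed_pmf \<sigma> c d r"] by simp
qed

end

section \<open>Integer keys and their characters\<close>

lemma mod_power_eqI:
  fixes x y \<sigma> :: nat
  assumes "\<And>i. i < c \<Longrightarrow> x div \<sigma> ^ i mod \<sigma> = y div \<sigma> ^ i mod \<sigma>"
  shows "x mod \<sigma> ^ c = y mod \<sigma> ^ c"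
  using assms
proof (induction c)
  case (Suc c)
  have "x mod (\<sigma> ^ c * \<sigma>) = y mod (\<sigma> ^ c * \<sigma>)" using Suc unfolding mod_mult2_eq by simp
  then show ?case by (simp add: mult.commute)
qed simp

lemma inj_on_key_chars: "inj_on (key_chars \<sigma> c) {..<\<sigma> ^ c}"
proof (rule inj_onI)
  fix x y assume xy: "x \<in> {..<\<sigma> ^ c}" "y \<in> {..<\<sigma> ^ c}" and eq: "key_chars \<sigma> c x = key_chars \<sigma> c y"
  have "x div \<sigma> ^ i mod \<sigma> = y div \<sigma> ^ i mod \<sigma>" if "i < c" for i
  proof -
    have "key_chars \<sigma> c x ! i = key_chars \<sigma> c y ! i" using eq by simp
    then show ?thesis using that by (simp add: key_chars_def)
  qed
  from mod_power_eqI[of c x \<sigma> y, OF this] xy show "x = y" by simp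
qed

lemma key_chars_words: "\<sigma> > 0 \<Longrightarrow> key_chars \<sigma> c x \<in> words \<sigma> c"
  by (auto simp: key_chars_def words_def)

theorem theorem14:
  fixes c d :: nat and \<epsilon> :: real
  assumes "c \<ge> 1" and "\<epsilon> > 0"
  shows "\<exists>C::real. C > 0 \<and>
    (\<forall>(\<sigma>::nat) (u::nat) (r::nat) (X::nat set) (f::nat \<Rightarrow> nat \<Rightarrow> bool).
       (\<exists>s::nat. \<sigma> = 2 ^ s) \<longrightarrow>
       real u powr (1 / real c) \<le> real \<sigma> \<longrightarrow>
       (c \<ge> 2 \<longrightarrow> real \<sigma> \<le> real u powr (1 / (real c - 1))) \<longrightarrow>
       X \<subseteq> {..<u} \<longrightarrow>
       measure_pmf.expectation (mixed_pmf \<sigma> c d r) (\<lambda>T. real (card (selected \<sigma> c d X f T)))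
         \<le> real \<sigma> / (1 + \<epsilon>) \<longrightarrow>
       measure_pmf.prob (mixed_pmf \<sigma> c d r)
           {T. peelable (derived_key \<sigma> c d T ` selected \<sigma> c d X f T)}
         \<ge> 1 - C * real \<sigma> powi (1 - \<lfloor>real d / 2\<rfloor>))"
proof -
  define \<theta> where "\<theta> = 1 / (1 + \<epsilon>)"
  have \<theta>: "0 < \<theta>" "\<theta> < 1" using assms(2) by (auto simp: \<theta>_def)
  \<comment> \<open>There are \<open>Suc n\<close> pairs of positions if \<open>d div 2\<close> is
    positive, and summing over the root consumes one of the factors they save.\<close>
  define n where "n = d div 2 - 1"
  define C0 where "C0 = chain_const \<theta> c (Suc n) + poly_geom \<theta> (c + 2 * n)"
  have C0: "C0 \<ge> 0" unfolding C0_def using \<theta> by (intro add_nonneg_nonneg chain_const_nonneg poly_geom_nonneg)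
  have floor: "\<lfloor>real d / 2\<rfloor> = int (d div 2)" using floor_divide_of_nat_eq[of d 2] by simp
  show ?thesis
  proof (intro exI[of _ "max 1 C0"] conjI allI impI)
    fix \<sigma> u r :: nat and X :: "nat set" and f :: "nat \<Rightarrow> nat \<Rightarrow> bool"
    assume "\<exists>s. \<sigma> = 2 ^ s" and u: "real u powr (1 / real c) \<le> real \<sigma>" and X: "X \<subseteq> {..<u}"
      and mean: "measure_pmf.expectation (mixed_pmf \<sigma> c d r) (\<lambda>T. real (card (selected \<sigma> c d X f T)))
         \<le> real \<sigma> / (1 + \<epsilon>)"
    then obtain s where \<sigma>: "\<sigma> = 2 ^ s" by blast
    then have \<sigma>0: "\<sigma> > 0" by simp
    let ?P = "measure_pmf.prob (mixed_pmf \<sigma> c d r) {T. peelable (derived_key \<sigma> c d T ` selected \<sigma> c d X f T)}"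
    show "1 - max 1 C0 * real \<sigma> powi (1 - \<lfloor>real d / 2\<rfloor>) \<le> ?P"
    proof (cases "d div 2 \<le> 1")
      case True
      \<comment> \<open>The exponent is nonnegative, so with a constant of at least 1 the claimed
        lower bound is at most 0. This is why the constant is \<open>max 1 C0\<close>.\<close>
      have "1 \<le> real \<sigma> powi (1 - \<lfloor>real d / 2\<rfloor>)"
      proof -
        have "1 - \<lfloor>real d / 2\<rfloor> = int (1 - d div 2)" using True floor by simp
        then have "real \<sigma> powi (1 - \<lfloor>real d / 2\<rfloor>) = real \<sigma> ^ (1 - d div 2)" by (simp only: power_int_of_nat)
        then show ?thesis using \<sigma>0 by (simp add: one_le_power)
      qed
      then have "1 * 1 \<le> max 1 C0 * real \<sigma> powi (1 - \<lfloor>real d / 2\<rfloor>)" by (intro mult_mono) auto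
      then have "1 - max 1 C0 * real \<sigma> powi (1 - \<lfloor>real d / 2\<rfloor>) \<le> 0" by simp
      also have "0 \<le> ?P" by simp
      finally show ?thesis .
    next
      case False
      then have n: "2 * Suc n \<le> d" "1 \<le> n" "d div 2 = Suc n" by (auto simp: n_def)
      \<comment> \<open>The lower bound on the alphabet makes \<open>c\<close> digits sufficient to
        tell the keys below \<open>u\<close> apart, so passing from keys to character vectors is
        injective on \<open>X\<close>.\<close>
      have uc: "u \<le> \<sigma> ^ c"
      proof (cases "u = 0")
        case False
        have "real u = (real u powr (1 / real c)) powr real c"
          using assms(1) False by (simp add: powr_powr)
        also have "\<dots> \<le> real \<sigma> powr real c" using u by (intro powr_mono2) auto
        also have "\<dots> = real (\<sigma> ^ c)" using \<sigma>0 by (simp add: powr_realpow)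
        finally show ?thesis by (simp only: of_nat_le_iff)
      qed simp
      have inj: "inj_on (key_chars \<sigma> c) X"
        by (rule inj_on_subset[OF inj_on_key_chars]) (use X uc in auto)
      define W where "W = key_chars \<sigma> c ` X"
      define g where "g z = f (the_inv_into X (key_chars \<sigma> c) z)" for z
      have g: "g (key_chars \<sigma> c x) = f x" if "x \<in> X" for x
        using the_inv_into_f_f[OF inj that] by (simp add: g_def)
      interpret mixed_tabulation s c d r \<sigma> W g
        by unfold_locales (use \<sigma> key_chars_words[OF \<sigma>0] in \<open>auto simp: W_def\<close>)
      have dk: "derived_key \<sigma> c d T x = extend_key d (fst T) (key_chars \<sigma> c x)" for T x
        by (simp add: derived_key_def extend_key_def hash1_def)
      have Y: "Y T = key_chars \<sigma> c ` selected \<sigma> c d X f T" for T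
      proof -
        have "selected \<sigma> c d X f T = {x \<in> X. g (key_chars \<sigma> c x) (hash2 T (extend_key d (fst T) (key_chars \<sigma> c x)))}"
          unfolding selected_def mixed_tab_def comp_def dk using g by auto
        moreover have "Y T = {z \<in> key_chars \<sigma> c ` X. g z (hash2 T (extend_key d (fst T) z))}"
          unfolding Y_def unfolding W_def ..
        ultimately show ?thesis by auto
      qed
      have inj': "inj_on (key_chars \<sigma> c) (selected \<sigma> c d X f T)" for T
        by (rule inj_on_subset[OF inj]) (auto simp: selected_def)
      have "card (Y T) = card (selected \<sigma> c d X f T)" for T unfolding Y by (rule card_image[OF inj'])
      then have "sum p W \<le> \<theta> * real \<sigma>"
        using mean expectation_card_Y[OF assms(1)] by (simp add: \<theta>_def)
      from Pr_peelable[OF assms(1) \<theta> this n(1,2)]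
      have "1 - C0 / real \<sigma> ^ n \<le> Pr {T. peelable (extend_key d (fst T) ` Y T)}" unfolding C0_def .
      also have "{T. peelable (extend_key d (fst T) ` Y T)} =
          {T. peelable (derived_key \<sigma> c d T ` selected \<sigma> c d X f T)}"
        unfolding Y image_image dk ..
      finally have "1 - C0 / real \<sigma> ^ n \<le> ?P" .
      moreover have "real \<sigma> powi (1 - \<lfloor>real d / 2\<rfloor>) = 1 / real \<sigma> ^ n"
      proof -
        have "1 - \<lfloor>real d / 2\<rfloor> = - int n" unfolding floor n(3) by simp
        show ?thesis unfolding \<open>1 - \<lfloor>real d / 2\<rfloor> = - int n\<close>
          by (simp add: power_int_minus divide_inverse)
      qed
      moreover have "C0 / real \<sigma> ^ n \<le> max 1 C0 / real \<sigma> ^ n" by (intro divide_right_mono) auto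
      ultimately show ?thesis by simp
    qed
  qed simp
qed

end
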